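(* For every integer $\Delta \ge 2$ there exists a constant $c_\Delta > 0$ such that for every $n \in \mathbb{N}$ there is a graph $\Gamma$ with at most $c_\Delta n^{\Delta/2}$ vertices which is induced universal for $\mathcal{H}(n,\Delta)$, i.e. for every graph $H$ on $n$ vertices with maximum degree at most $\Delta$, $\Gamma$ contains an induced subgraph isomorphic to $H$.
   Context: $\mathcal{H}(n,\Delta)$ denotes the family of all (simple, finite) graphs on $n$ vertices with maximum degree at most $\Delta$. A graph $\Gamma$ is induced universal for a family $\mathcal{H}$ if for every $H \in \mathcal{H}$ it contains an induced subgraph isomorphic to $H$. *)

theory Defs
  imports Complex_Main
begin

definition simple_graph :: "'a set \<Rightarrow> ('a \<Rightarrow> 'a \<Rightarrow> bool) \<Rightarrow> bool" where
  "simple_graph V E \<longleftrightarrow> finite V \<and> (\<forall>u v. E u v \<longrightarrow> u \<in> V \<and> v \<in> V)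
     \<and> (\<forall>u v. E u v \<longrightarrow> E v u) \<and> (\<forall>v. \<not> E v v)"

definition degree :: "'a set \<Rightarrow> ('a \<Rightarrow> 'a \<Rightarrow> bool) \<Rightarrow> 'a \<Rightarrow> nat" where
  "degree V E v = card {u \<in> V. E v u}"

definition max_degree_le :: "'a set \<Rightarrow> ('a \<Rightarrow> 'a \<Rightarrow> bool) \<Rightarrow> nat \<Rightarrow> bool" where
  "max_degree_le V E d \<longleftrightarrow> (\<forall>v\<in>V. degree V E v \<le> d)"

definition induced_subgraph_copy ::
  "'b set \<Rightarrow> ('b \<Rightarrow> 'b \<Rightarrow> bool) \<Rightarrow> 'a set \<Rightarrow> ('a \<Rightarrow> 'a \<Rightarrow> bool) \<Rightarrow> bool" where
  "induced_subgraph_copy W F V E \<longleftrightarrow>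
     (\<exists>f. inj_on f W \<and> f ` W \<subseteq> V \<and> (\<forall>u\<in>W. \<forall>v\<in>W. F u v \<longleftrightarrow> E (f u) (f v)))"

text \<open>H(n,\<Delta>): graphs on n vertices with max degree at most \<Delta>. Every such graph is
 isomorphic to one with vertex set {0..<n}, so we quantify over those.\<close>
definition induced_universal_for ::
  "'a set \<Rightarrow> ('a \<Rightarrow> 'a \<Rightarrow> bool) \<Rightarrow> nat \<Rightarrow> nat \<Rightarrow> bool" where
  "induced_universal_for V E n \<Delta> \<longleftrightarrow>
     (\<forall>F. simple_graph {0..<n} F \<and> max_degree_le {0..<n} F \<Delta>
          \<longrightarrow> induced_subgraph_copy {0..<n} F V E)"

end

(* Let t be about sqrt n. For \<Delta> \<ge> 3 every vertex gets a position in a set of size O(t), and its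
   label lists \<Delta> numbers of size O(t) together with a bounded amount of data, which gives
   O(t^\<Delta>) labels. To save one number per vertex compared with listing all neighbours, the position
   of a vertex v is taken among the boundedly many neighbours of the position of a vertex adjacent to
   v, its host, in a lossless expander; then the position of the host also stands for the one of v.
   The hosts form forests, and the Friedman-Pippenger technique embeds these into the expander,
   injectively on each set of vertices which must be told apart.

   The forests come from a depth-first search forest of the graph: O(t) special vertices cut it into
   pieces with at most t vertices, which are grouped into O(t) clusters of size O(t). Every edge is
   oriented downwards in the tree if it is a tree edge and upwards otherwise. The label of u lists
   positions of out-neighbours, and a vertex lists the clusters of its in-neighbours from other
   clusters: a position is unambiguous only among the out-neighbours of one cluster. For \<Delta> = 2
   a ladder with O(n) vertices contains all disjoint unions of paths and cycles. *)

theory Submission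
  imports Defs "HOL-Library.FuncSet"
begin

section \<open>Lossless expanders\<close>

text \<open>The obstacle is to get by with \<Delta> numbers. A vertex outside \<open>S\<close> needs
  its own position, its own cluster, one number per out-neighbour and one per in-neighbour from a
  foreign cluster: up to two more than its degree. One is saved by the tree parent, an in-neighbour
  that is special or in the same cluster. The other is saved by the host: as an out-neighbour it is
  listed anyway, and a bounded index turns its position into that of the vertex. A vertex without
  host must find a second saving, a missing neighbour or another in-neighbour that costs nothing.
  Roots have no parent, so they are chosen with degree below \<Delta> or with a back edge coming in.
  Leaves of full degree have no child to act as host; they use an ancestor that is neither parent
  nor root, which exists because \<Delta> \<ge> 3.

  The expander has to be lossless up to two neighbours per position: only then does a set of
  forbidden positions spread to few crowded ones when it is propagated from children to hosts. The
  degree \<open>3 * \<Delta> + 5\<close> leaves a reserve of \<open>3 * \<Delta> + 2\<close>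
  neighbours, one more than the \<open>2 * \<Delta> + 1\<close> crowded neighbours and \<Delta>
  children that have to be survived.\<close>

lemma card_less_ex_notin: "card G < card F \<Longrightarrow> finite G \<Longrightarrow> \<exists>f\<in>F. f \<notin> G"
  using card_mono[of G F] by (meson leD subsetI)

text \<open>The quotient \<open>k ^ k / fact k\<close> is a single term of the series of
  \<open>exp k\<close>, and \<open>exp 1\<close> is at most 3.\<close>

lemma power_self_le_fact: "(k::nat) ^ k \<le> 3 ^ k * fact k"
proof -
  have "(real k) ^ k / fact k \<le> exp (real k)"
  proof -
    have s: "summable (\<lambda>n. real k ^ n /\<^sub>R fact n)" by (rule summable_exp_generic)
    have "(\<Sum>n\<in>{k}. real k ^ n /\<^sub>R fact n) \<le> (\<Sum>n. real k ^ n /\<^sub>R fact n)"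
      by (rule sum_le_suminf[OF s]) auto
    then show ?thesis by (simp add: exp_def field_simps)
  qed
  also have "exp (real k) = exp 1 ^ k" by (simp flip: exp_of_nat_mult)
  also have "\<dots> \<le> 3 ^ k" by (intro power_mono exp_le) auto
  finally have "real (k ^ k) \<le> real (3 ^ k * fact k)" by (simp add: field_simps)
  then show ?thesis by (simp only: of_nat_le_iff)
qed

text \<open>The usual bound \<open>(e m / k) ^ k\<close> on a binomial coefficient, with 3 in place
  of e and without division, so that \<open>k = 0\<close> is covered.\<close>

lemma binomial_mult_power_le: "(m choose k) * k ^ k \<le> (3 * m) ^ k"
proof -
  have "(m choose k) * k ^ k \<le> (m choose k) * (3 ^ k * fact k)" using power_self_le_fact by simp
  also have "\<dots> = 3 ^ k * (fact k * (m choose k))" by simp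
  also have "\<dots> \<le> 3 ^ k * m ^ k"
  proof (cases "k \<le> m")
    case True
    then have "fact (m - k) * (fact k * (m choose k)) = fact m"
      using binomial_fact_lemma[OF True] by (simp only: mult_ac)
    then have "fact k * (m choose k) = fact m div fact (m - k)"
      by (metis fact_nonzero nonzero_mult_div_cancel_left)
    then show ?thesis using fact_div_fact_le_pow[OF True] by (intro mult_le_mono order_refl) linarith
  qed (simp add: binomial_eq_0)
  finally show ?thesis by (simp add: power_mult_distrib)
qed

lemma card_funs_into:
  assumes "X \<subseteq> {..<m}" "Y \<subseteq> {..<m::nat}"
  shows "card {f \<in> ({..<m} \<times> {..<d::nat}) \<rightarrow>\<^sub>E {..<m}. \<forall>x\<in>X. \<forall>c<d. f (x, c) \<in> Y}
    = card Y ^ (d * card X) * m ^ (d * (m - card X))"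
proof -
  let ?B = "\<lambda>z. if fst z \<in> X then Y else {..<m}"
  have fX: "finite X" using assms finite_subset by blast
  have "{f \<in> ({..<m} \<times> {..<d}) \<rightarrow>\<^sub>E {..<m}. \<forall>x\<in>X. \<forall>c<d. f (x, c) \<in> Y}
      = Pi\<^sub>E ({..<m} \<times> {..<d}) ?B"
    (is "?L = ?R")
  proof (intro set_eqI iffI)
    fix f assume f: "f \<in> ?L"
    show "f \<in> ?R" using f by (intro PiE_I) (auto simp: PiE_iff extensional_def)
  next
    fix f assume f: "f \<in> ?R"
    have 1: "f (x, c) \<in> Y" if "x \<in> X" "c < d" for x c
      using PiE_mem[OF f, of "(x, c)"] that assms by auto
    have 2: "f z < m" if "z \<in> {..<m} \<times> {..<d}" for z
      using PiE_mem[OF f that] assms by (auto split: if_splits)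
    have "f \<in> ({..<m} \<times> {..<d}) \<rightarrow>\<^sub>E {..<m}"
      using 2 f by (intro PiE_I) (auto simp: PiE_iff extensional_def)
    with 1 show "f \<in> ?L" by simp
  qed
  also have "card \<dots> = (\<Prod>z\<in>{..<m} \<times> {..<d}. card (?B z))" by (simp add: card_PiE)
  also have "\<dots> = (\<Prod>x<m. \<Prod>c<d. card (?B (x, c)))"
    by (subst prod.cartesian_product) (simp add: case_prod_beta)
  also have "\<dots> = (\<Prod>x<m. if x \<in> X then card Y ^ d else m ^ d)" by (intro prod.cong) auto
  also have "\<dots> = (\<Prod>x\<in>X. card Y ^ d) * (\<Prod>x\<in>{..<m} - X. m ^ d)"
    using assms by (subst prod.subset_diff[of X "{..<m}"])
      (auto intro!: arg_cong2[where f = "(*)"] prod.cong)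
  also have "\<dots> = card Y ^ (d * card X) * m ^ (d * (m - card X))"
    using assms fX by (simp add: card_Diff_subset power_mult)
  finally show ?thesis .
qed

text \<open>One term of the union bound: the factors count \<open>X\<close>, \<open>Y\<close> and
  the maps with all neighbours of \<open>X\<close> in \<open>Y\<close>. As
  \<open>d * x = y + 2 * x\<close>, a factor \<open>y ^ y\<close> pays for the choice of
  \<open>Y\<close>; of the remaining \<open>y ^ (2 * x)\<close> a factor \<open>x ^ x\<close> pays
  for \<open>X\<close>, and the rest is absorbed by \<open>m ^ x\<close>. The spare
  \<open>3 ^ x\<close> makes the terms summable over \<open>x\<close>.\<close>

lemma bad_count_le:
  fixes d x m :: nat
  assumes "2 \<le> d" "3 ^ d * (d - 2)\<^sup>2 * x \<le> m" "x \<le> m"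
  defines "y \<equiv> (d - 2) * x"
  shows "3 ^ x * ((m choose x) * (m choose y) * (y ^ (d * x) * m ^ (d * (m - x)))) \<le> m ^ (d * m)"
proof (cases "x = 0")
  case False
  have dx: "d * x = y + 2 * x"
    using assms(1) by (metis add.commute distrib_right le_add_diff_inverse y_def)
  have e1: "y ^ (d * x) = y ^ y * y ^ (2 * x)" by (simp only: dx power_add)
  have e2: "y ^ (2 * x) = x ^ x * ((d - 2)\<^sup>2 * x) ^ x"
    unfolding y_def by (simp only: power_mult power_mult_distrib power2_eq_square mult_ac)
  have e3: "3 ^ x * (3 * m) ^ x * (3 * m) ^ y = (3 ^ d) ^ x * m ^ (x + y)"
  proof -
    have "3 ^ x * (3 * m) ^ x * (3 * m) ^ y = 3 ^ (x + x + y) * m ^ (x + y)"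
      by (simp only: power_mult_distrib power_add mult_ac)
    moreover have "x + x + y = d * x" using dx by simp
    ultimately show ?thesis by (simp only: power_mult)
  qed
  have "x ^ x * (3 ^ x * ((m choose x) * (m choose y) * y ^ (d * x)))
      = 3 ^ x * ((m choose x) * x ^ x) * ((m choose y) * y ^ y) * y ^ (2 * x)"
    by (simp only: e1 mult_ac)
  also have "\<dots> \<le> 3 ^ x * (3 * m) ^ x * (3 * m) ^ y * y ^ (2 * x)"
    by (intro mult_le_mono binomial_mult_power_le order_refl)
  also have "\<dots> = x ^ x * (m ^ (x + y) * (3 ^ d * (d - 2)\<^sup>2 * x) ^ x)"
    by (simp only: e3 e2) (simp only: power_mult_distrib mult_ac)
  also have "\<dots> \<le> x ^ x * (m ^ (x + y) * m ^ x)"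
    using assms(2) by (intro mult_le_mono power_mono order_refl) auto
  also have "\<dots> = x ^ x * m ^ (d * x)" by (simp only: dx mult_2 add_ac flip: power_add)
  finally have "3 ^ x * ((m choose x) * (m choose y) * y ^ (d * x)) \<le> m ^ (d * x)" using False by simp
  then have "3 ^ x * ((m choose x) * (m choose y) * y ^ (d * x)) * m ^ (d * (m - x))
      \<le> m ^ (d * x) * m ^ (d * (m - x))"
    by (rule mult_right_mono) simp
  also have "\<dots> = m ^ (d * m)" using assms(3) by (metis distrib_left le_add_diff_inverse power_add)
  finally show ?thesis by (simp only: mult.assoc)
qed (simp add: y_def)

text \<open>Counting: a random map is lossless on small sets because the expected number of pairs \<open>(X, Y)\<close>
  with \<open>X\<close> small, \<open>|Y| = (d - 2) |X|\<close> and all neighbours of \<open>X\<close> in \<open>Y\<close> is below 1.\<close>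

lemma lossless_expander_exists:
  fixes d k m :: nat
  assumes "2 \<le> d" "(3 ^ d * (d - 2)\<^sup>2 + d) * k \<le> m" "0 < m"
  obtains \<phi> :: "nat \<Rightarrow> nat \<Rightarrow> nat" where
    "\<And>c x. c < d \<Longrightarrow> x < m \<Longrightarrow> \<phi> c x < m"
    "\<And>X. X \<subseteq> {..<m} \<Longrightarrow> card X \<le> k \<Longrightarrow> (d - 2) * card X \<le> card (\<Union>x\<in>X. (\<lambda>c. \<phi> c x) ` {..<d})"
proof -
  let ?F = "({..<m} \<times> {..<d}) \<rightarrow>\<^sub>E {..<m}"
  let ?Bad = "\<lambda>X Y. {f \<in> ?F. \<forall>x\<in>X. \<forall>c<d. f (x, c) \<in> Y}"
  let ?P = "\<lambda>j. {X. X \<subseteq> {..<m} \<and> card X = j}"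
  let ?B = "\<lambda>x. \<Union>X\<in>?P x. \<Union>Y\<in>?P ((d - 2) * x). ?Bad X Y"
  have fin: "finite ?F" by (intro finite_PiE) auto
  have finP: "finite (?P j)" for j by (rule finite_subset[of _ "Pow {..<m}"]) auto
  have cP: "card (?P j) = m choose j" for j using n_subsets[of "{..<m}" j] by simp
  have cF: "card ?F = m ^ (d * m)" by (simp add: card_PiE mult.commute)
  have small: "3 ^ d * (d - 2)\<^sup>2 * x \<le> m" "x \<le> m" "(d - 2) * x \<le> m" if "x \<le> k" for x
  proof -
    have *: "(3 ^ d * (d - 2)\<^sup>2 + d) * x \<le> m" using that assms(2) by (meson le_trans mult_le_mono2)
    then show "3 ^ d * (d - 2)\<^sup>2 * x \<le> m" by (simp add: distrib_right)
    have "d * x \<le> m" using * by (simp add: distrib_right)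
    moreover have "x \<le> d * x" "(d - 2) * x \<le> d * x" using assms(1) by auto
    ultimately show "x \<le> m" "(d - 2) * x \<le> m" by linarith+
  qed
  have bad: "3 ^ x * card (?B x) \<le> m ^ (d * m)" if "x \<le> k" for x
  proof -
    let ?y = "(d - 2) * x"
    have "card (?B x) \<le> (\<Sum>X\<in>?P x. card (\<Union>Y\<in>?P ?y. ?Bad X Y))" using finP by (rule card_UN_le)
    also have "\<dots> \<le> (\<Sum>X\<in>?P x. \<Sum>Y\<in>?P ?y. card (?Bad X Y))" by (intro sum_mono card_UN_le finP)
    also have "\<dots> = (\<Sum>X\<in>?P x. \<Sum>Y\<in>?P ?y. ?y ^ (d * x) * m ^ (d * (m - x)))"
      by (intro sum.cong refl) (simp add: card_funs_into)
    also have "\<dots> = (m choose x) * (m choose ?y) * (?y ^ (d * x) * m ^ (d * (m - x)))"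
      by (simp add: cP mult.assoc)
    finally show ?thesis
      using bad_count_le[OF assms(1) small(1,2)[OF that]] by (meson le_trans mult_le_mono2)
  qed
  have "real (card (\<Union>x\<in>{1..k}. ?B x)) \<le> (\<Sum>x\<in>{1..k}. real (card (?B x)))"
    using card_UN_le[of "{1..k}" ?B] by (simp flip: of_nat_sum)
  also have "\<dots> \<le> (\<Sum>x\<in>{1..k}. real (m ^ (d * m)) * (1 / 3) ^ x)"
  proof (rule sum_mono)
    fix x assume "x \<in> {1..k}"
    then have "real (3 ^ x * card (?B x)) \<le> real (m ^ (d * m))"
      using bad[of x] by (simp only: of_nat_le_iff) auto
    then show "real (card (?B x)) \<le> real (m ^ (d * m)) * (1 / 3) ^ x" by (simp add: field_simps)
  qed
  also have "\<dots> = real (m ^ (d * m)) * (\<Sum>x\<in>{1..k}. (1 / 3) ^ x)" by (simp add: sum_distrib_left)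
  \<comment> \<open>The geometric series with ratio 1/3 that starts at exponent 1 stays below 1/2,
    so some map is bad for no size.\<close>
  also have "\<dots> < real (m ^ (d * m)) * 1"
  proof (rule mult_strict_left_mono)
    have eq: "(\<Sum>x\<in>{1..k}. (1 / 3 :: real) ^ x) = (1 - (1/3) ^ k) / 2" by (induction k) simp_all
    have half: "(1 - a) / 2 < 1" if "0 < a" for a :: real using that by simp
    show "(\<Sum>x\<in>{1..k}. (1 / 3 :: real) ^ x) < 1" unfolding eq by (rule half) simp
  qed (use assms in auto)
  finally have "card (\<Union>x\<in>{1..k}. ?B x) < card ?F" by (simp only: cF mult_1_right of_nat_less_iff)
  moreover have "finite (\<Union>x\<in>{1..k}. ?B x)" by (rule finite_subset[OF _ fin]) blast
  ultimately have "\<exists>f\<in>?F. f \<notin> (\<Union>x\<in>{1..k}. ?B x)" by (intro card_less_ex_notin)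
  then obtain f where f: "f \<in> ?F" and nf: "f \<notin> (\<Union>x\<in>{1..k}. ?B x)" by (rule bexE)
  have nb: "f \<notin> ?B x" if "x \<in> {1..k}" for x
  proof
    assume "f \<in> ?B x"
    with that have "f \<in> (\<Union>x\<in>{1..k}. ?B x)" by (rule UN_I)
    with nf show False ..
  qed
  show ?thesis
  proof (rule that[of "\<lambda>c x. f (x, c)"])
    show "f (x, c) < m" if "c < d" "x < m" for c x using f that by (auto simp: PiE_iff)
    fix X assume X: "X \<subseteq> {..<m}" "card X \<le> k"
    let ?N = "\<Union>x\<in>X. (\<lambda>c. f (x, c)) ` {..<d}"
    show "(d - 2) * card X \<le> card ?N"
    proof (rule ccontr)
      assume neg: "\<not> ?thesis"
      then have "card X \<noteq> 0" by (metis le0 mult_0_right)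
      then have x: "card X \<in> {1..k}" using X by auto
      have N: "?N \<subseteq> {..<m}" using f X by (force simp: PiE_iff)
      \<comment> \<open>A neighbourhood that is too small is padded to the exact size for which bad
        pairs were counted; \<open>small\<close> provides the room for this.\<close>
      obtain Y where "?N \<subseteq> Y" "Y \<subseteq> {..<m}" "card Y = (d - 2) * card X"
        using exists_subset_between[of ?N "(d - 2) * card X" "{..<m}"] N neg small(3)[OF X(2)] by auto
      then have "f \<in> ?Bad X Y" "X \<in> ?P (card X)" "Y \<in> ?P ((d - 2) * card X)" using f X by auto
      then have "f \<in> ?B (card X)" by (intro UN_I)
      then show False using nb[OF x] by contradiction
    qed
  qed
qed

section \<open>Embedding forests into expanders\<close>

text \<open>Expansion reaches up to \<open>2 * \<sigma>\<close> although at most \<sigma> positions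
  are occupied at a time: the tight sets below have size at most \<sigma>, and the union of two of
  them must still be in range.\<close>

locale expander =
  fixes m d D \<sigma> :: nat and Nb :: "nat \<Rightarrow> nat set"
  assumes Nb_sub: "x < m \<Longrightarrow> Nb x \<subseteq> {..<m}"
    and Nb_fin: "finite (Nb x)"
    and Nb_card: "card (Nb x) \<le> d"
    and expand: "X \<subseteq> {..<m} \<Longrightarrow> card X \<le> 2 * \<sigma> \<Longrightarrow> (D + 1) * card X \<le> card (\<Union>(Nb ` X))"
    and sigma_pos: "1 \<le> \<sigma>"
begin

section \<open>Friedman-Pippenger extension of partial embeddings\<close>

abbreviation NB :: "nat set \<Rightarrow> nat set" where "NB X \<equiv> \<Union>(Nb ` X)"

text \<open>Friedman--Pippenger invariant: \<open>U\<close> is the set of occupied positions and \<open>ch x\<close> counts the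
  children already placed next to \<open>x\<close>. Every position keeps a reserve of \<open>D\<close> neighbours.\<close>

definition good :: "nat set \<Rightarrow> (nat \<Rightarrow> nat) \<Rightarrow> bool" where
  "good U ch \<longleftrightarrow> (\<forall>X\<subseteq>{..<m}. card X \<le> 2 * \<sigma> \<longrightarrow> D * card X \<le> card (NB X - U) + sum ch X)"

text \<open>For a \<open>good\<close> pair this inequality is an equality: such a set cannot lose a
  free neighbour without a new child to compensate.\<close>

definition tight :: "nat set \<Rightarrow> (nat \<Rightarrow> nat) \<Rightarrow> nat set \<Rightarrow> bool" where
  "tight U ch X \<longleftrightarrow> X \<subseteq> {..<m} \<and> card X \<le> 2 * \<sigma> \<and> card (NB X - U) + sum ch X \<le> D * card X"

lemma goodD: "good U ch \<Longrightarrow> X \<subseteq> {..<m} \<Longrightarrow> card X \<le> 2 * \<sigma> \<Longrightarrow> D * card X \<le> card (NB X - U) + sum ch X"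
  unfolding good_def by blast

lemma finite_NB [simp]: "X \<subseteq> {..<m} \<Longrightarrow> finite (NB X)"
  using Nb_fin finite_subset by blast

lemma card_NB_le: "X \<subseteq> {..<m} \<Longrightarrow> card (NB X) \<le> d * card X"
proof -
  assume "X \<subseteq> {..<m}"
  then have "finite X" using finite_subset by blast
  then have "card (NB X) \<le> (\<Sum>x\<in>X. card (Nb x))" by (rule card_UN_le)
  also have "\<dots> \<le> (\<Sum>x\<in>X. d)" by (intro sum_mono Nb_card)
  finally show ?thesis by (simp add: mult.commute)
qed

text \<open>Expansion leaves at least \<open>(D + 1) * card X - card U\<close> free neighbours while
  tightness allows at most \<open>D * card X\<close>, so \<open>card X \<le> card U\<close>.\<close>

lemma tight_small:
  assumes "tight U ch X" "finite U" "card U \<le> \<sigma>"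
  shows "card X \<le> \<sigma>"
proof -
  have X: "X \<subseteq> {..<m}" "card X \<le> 2 * \<sigma>" "card (NB X - U) + sum ch X \<le> D * card X"
    using assms(1) by (auto simp: tight_def)
  have "(D + 1) * card X \<le> card (NB X)" using expand X by blast
  also have "\<dots> \<le> card (NB X - U) + card U"
    using diff_card_le_card_Diff[OF assms(2), of "NB X"] by linarith
  finally show ?thesis using X(3) assms(3) by simp
qed

text \<open>Uncrossing: the number of free neighbours is submodular and the other terms are modular.
  Goodness bounds the intersection from below, so nothing is left over for the union.\<close>

lemma tight_Un:
  assumes g: "good U ch" and U: "finite U" "card U \<le> \<sigma>"
    and X: "tight U ch X" and Y: "tight U ch Y"
  shows "tight U ch (X \<union> Y)"
proof -
  have s: "X \<subseteq> {..<m}" "Y \<subseteq> {..<m}" "card X \<le> \<sigma>" "card Y \<le> \<sigma>"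
    using tight_small[OF X U] tight_small[OF Y U] X Y by (auto simp: tight_def)
  then have fin: "finite X" "finite Y" using finite_subset by blast+
  have cU: "card (X \<union> Y) + card (X \<inter> Y) = card X + card Y" using card_Un_Int[OF fin] by simp
  have "card (NB (X \<union> Y) - U) + card (NB (X \<inter> Y) - U)
      \<le> card ((NB X - U) \<union> (NB Y - U)) + card ((NB X - U) \<inter> (NB Y - U))"
    using s by (intro add_mono card_mono) auto
  also have "\<dots> = card (NB X - U) + card (NB Y - U)"
    using s by (subst card_Un_Int[of "NB X - U" "NB Y - U"]) auto
  finally have sub: "card (NB (X \<union> Y) - U) + card (NB (X \<inter> Y) - U) \<le> card (NB X - U) + card (NB Y - U)" .
  have modular: "sum ch (X \<union> Y) + sum ch (X \<inter> Y) = sum ch X + sum ch Y" using sum.union_inter[OF fin] .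
  have "D * card (X \<inter> Y) \<le> card (NB (X \<inter> Y) - U) + sum ch (X \<inter> Y)"
    using s card_mono[of X "X \<inter> Y"] fin by (intro goodD[OF g]) auto
  moreover have "card (NB X - U) + sum ch X \<le> D * card X" "card (NB Y - U) + sum ch Y \<le> D * card Y"
    using X Y by (auto simp: tight_def)
  moreover have "D * card (X \<union> Y) + D * card (X \<inter> Y) = D * card X + D * card Y"
    using cU by (metis distrib_left)
  ultimately have "card (NB (X \<union> Y) - U) + sum ch (X \<union> Y) \<le> D * card (X \<union> Y)"
    using sub modular by linarith
  then show ?thesis using s card_Un_le[of X Y] by (auto simp: tight_def)
qed

lemma tight_Union:
  assumes g: "good U ch" and U: "finite U" "card U \<le> \<sigma>"
    and "finite \<A>" "\<And>X. X \<in> \<A> \<Longrightarrow> tight U ch X"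
  shows "tight U ch (\<Union>\<A>)"
  using assms(4,5)
proof (induction \<A> rule: finite_induct)
  case (insert X \<A>)
  then show ?case using tight_Un[OF g U, of X "\<Union>\<A>"] by auto
qed (simp add: tight_def)

text \<open>Only tight sets that miss \<open>x\<close> are endangered: other sets can spare one
  neighbour, or contain \<open>x\<close> and gain from its counter. The endangered ones are avoided
  together, by staying outside the neighbourhood of their union \<open>Z\<close>, which is tight
  itself. Goodness of \<open>insert x Z\<close> leaves \<open>x\<close> more than \<theta> free
  neighbours there.\<close>

lemma place_child:
  assumes g: "good U ch" and U: "finite U" "card U \<le> \<sigma>"
    and x: "x < m" and bad: "card (Nb x \<inter> Bd) \<le> \<theta>" and D: "ch x + \<theta> < D"
  obtains y where "y \<in> Nb x" "y \<notin> U" "y \<notin> Bd" "good (insert y U) (ch(x := Suc (ch x)))"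
proof -
  let ?A = "{X. tight U ch X \<and> x \<notin> X}"
  define Z where "Z = \<Union>?A"
  have fA: "finite ?A" by (rule finite_subset[of _ "Pow {..<m}"]) (auto simp: tight_def)
  have tX: "tight U ch Z" using tight_Union[OF g U fA] by (auto simp: Z_def)
  then have X: "Z \<subseteq> {..<m}" "card Z \<le> \<sigma>" "card (NB Z - U) + sum ch Z \<le> D * card Z"
    using tight_small[OF tX U] by (auto simp: tight_def)
  have fX: "finite Z" using X finite_subset by blast
  have xX: "x \<notin> Z" by (auto simp: Z_def)
  have "D * card (insert x Z) \<le> card (NB (insert x Z) - U) + sum ch (insert x Z)"
    by (rule goodD[OF g]) (use X x fX xX sigma_pos in \<open>auto simp: card_insert_if\<close>)
  then have "D * card Z + D \<le> card (NB (insert x Z) - U) + ch x + sum ch Z" using fX xX by simp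
  moreover have "card (NB (insert x Z) - U) \<le> card (NB Z - U) + card (Nb x - U - NB Z)"
  proof -
    have "NB (insert x Z) - U \<subseteq> (NB Z - U) \<union> (Nb x - U - NB Z)" by auto
    then have "card (NB (insert x Z) - U) \<le> card ((NB Z - U) \<union> (Nb x - U - NB Z))"
      using X Nb_fin by (intro card_mono) auto
    also have "\<dots> \<le> card (NB Z - U) + card (Nb x - U - NB Z)" by (rule card_Un_le)
    finally show ?thesis .
  qed
  ultimately have "\<theta> < card (Nb x - U - NB Z)" using X(3) D by linarith
  then have "\<not> Nb x - U - NB Z \<subseteq> Nb x \<inter> Bd"
    using card_mono[of "Nb x \<inter> Bd" "Nb x - U - NB Z"] bad Nb_fin[of x] by auto
  then obtain y where y: "y \<in> Nb x" "y \<notin> U" "y \<notin> NB Z" "y \<notin> Bd" by blast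
  have "good (insert y U) (ch(x := Suc (ch x)))" unfolding good_def
  proof (intro allI impI)
    fix X assume Xm: "X \<subseteq> {..<m}" "card X \<le> 2 * \<sigma>"
    then have fX: "finite X" using finite_subset by blast
    have gX: "D * card X \<le> card (NB X - U) + sum ch X" by (rule goodD[OF g Xm])
    have le: "card (NB X - U) \<le> Suc (card (NB X - insert y U))"
    proof -
      have "NB X - U \<subseteq> insert y (NB X - insert y U)" by auto
      then have "card (NB X - U) \<le> card (insert y (NB X - insert y U))"
        using Xm by (intro card_mono) auto
      also have "\<dots> \<le> Suc (card (NB X - insert y U))" by (rule card_insert_le_m1) auto
      finally show ?thesis .
    qed
    show "D * card X \<le> card (NB X - insert y U) + sum (ch(x := Suc (ch x))) X"
    proof (cases "x \<in> X")
      case True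
      have "sum (ch(x := Suc (ch x))) X = Suc (sum ch X)" using True fX by (simp add: sum.remove)
      then show ?thesis using gX le by simp
    next
      case False
      then have eq: "sum (ch(x := Suc (ch x))) X = sum ch X" by (intro sum.cong) auto
      show ?thesis
      proof (cases "y \<in> NB X")
        case True
        then have "\<not> tight U ch X" using y(3) False by (auto simp: Z_def)
        then have "D * card X < card (NB X - U) + sum ch X" using Xm by (auto simp: tight_def)
        then show ?thesis using le eq by simp
      next
        case False
        then have "NB X - insert y U = NB X - U" by auto
        then show ?thesis using gX eq by simp
      qed
    qed
  qed
  with y that show ?thesis by blast
qed

text \<open>Without a host no counter compensates for the lost position, so all tight sets must be
  avoided. Their union has at most \<sigma> elements, hence at most \<open>d * \<sigma>\<close>
  neighbours; this is the origin of the bound on \<open>m\<close>.\<close>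

lemma place_root:
  assumes g: "good U ch" and U: "finite U" "card U \<le> \<sigma>"
    and fin: "finite Bd" and m: "card Bd + \<sigma> + d * \<sigma> < m"
  obtains y where "y < m" "y \<notin> U" "y \<notin> Bd" "good (insert y U) ch"
proof -
  let ?A = "{X. tight U ch X}"
  define Z where "Z = \<Union>?A"
  have fA: "finite ?A" by (rule finite_subset[of _ "Pow {..<m}"]) (auto simp: tight_def)
  have tX: "tight U ch Z" using tight_Union[OF g U fA] by (auto simp: Z_def)
  then have X: "Z \<subseteq> {..<m}" "card Z \<le> \<sigma>" using tight_small[OF tX U] by (auto simp: tight_def)
  have "card (Bd \<union> U \<union> NB Z) \<le> card Bd + card U + card (NB Z)"
    using card_Un_le[of "Bd \<union> U" "NB Z"] card_Un_le[of Bd U] by linarith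
  also have "\<dots> \<le> card Bd + \<sigma> + d * \<sigma>"
    using card_NB_le[OF X(1)] X(2) U(2) by (meson add_mono le_refl le_trans mult_le_mono2)
  finally have "card (Bd \<union> U \<union> NB Z) < card {..<m}" using m by simp
  then have "\<not> {..<m} \<subseteq> Bd \<union> U \<union> NB Z"
    using card_mono[of "Bd \<union> U \<union> NB Z" "{..<m}"] fin U finite_NB[OF X(1)] by (metis finite_UnI leD)
  then obtain y where y: "y < m" "y \<notin> Bd" "y \<notin> U" "y \<notin> NB Z" by blast
  have "good (insert y U) ch" unfolding good_def
  proof (intro allI impI)
    fix X assume Xm: "X \<subseteq> {..<m}" "card X \<le> 2 * \<sigma>"
    have gX: "D * card X \<le> card (NB X - U) + sum ch X" by (rule goodD[OF g Xm])
    show "D * card X \<le> card (NB X - insert y U) + sum ch X"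
    proof (cases "y \<in> NB X")
      case True
      have "NB X - U \<subseteq> insert y (NB X - insert y U)" by auto
      then have "card (NB X - U) \<le> card (insert y (NB X - insert y U))"
        using Xm by (intro card_mono) auto
      also have "\<dots> \<le> Suc (card (NB X - insert y U))" by (rule card_insert_le_m1) auto
      finally have "card (NB X - U) \<le> Suc (card (NB X - insert y U))" .
      moreover have "\<not> tight U ch X" using y(4) True by (auto simp: Z_def)
      then have "D * card X < card (NB X - U) + sum ch X" using Xm by (auto simp: tight_def)
      ultimately show ?thesis by simp
    next
      case False
      then have "NB X - insert y U = NB X - U" by auto
      then show ?thesis using gX by simp
    qed
  qed
  with y that show ?thesis by blast
qed

lemma good_empty: "good {} (\<lambda>_. 0)"
  unfolding good_def
proof (intro allI impI)
  fix X assume "X \<subseteq> {..<m}" "card X \<le> 2 * \<sigma>"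
  then have "(D + 1) * card X \<le> card (NB X)" by (rule expand)
  then show "D * card X \<le> card (NB X - {}) + (\<Sum>x\<in>X. 0)" by simp
qed

text \<open>A vertex of largest rank hosts nobody in \<open>W\<close> and can be placed last. The
  prescribed positions \<open>p0\<close> outside \<open>W\<close> need not be injective, so several
  outside hosts may share a position: \<open>\<kappa>2\<close> bounds the children such a position
  has to serve, \<open>\<kappa>1\<close> those of a single host.\<close>

lemma embed_forest:
  fixes W :: "'v set" and host :: "'v \<Rightarrow> 'v option" and rank :: "'v \<Rightarrow> nat" and p0 :: "'v \<Rightarrow> nat"
  assumes fW: "finite W" and cW: "card W \<le> \<sigma>"
    and rank: "\<And>w h. w \<in> W \<Longrightarrow> host w = Some h \<Longrightarrow> h \<in> W \<Longrightarrow> rank h < rank w"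
    and out: "\<And>w h. w \<in> W \<Longrightarrow> host w = Some h \<Longrightarrow> h \<notin> W \<Longrightarrow> p0 h < m"
    and kin: "\<And>h. card {w \<in> W. host w = Some h} \<le> \<kappa>1"
    and kout: "\<And>x. card {w \<in> W. \<exists>h. host w = Some h \<and> h \<notin> W \<and> p0 h = x} \<le> \<kappa>2"
    and bad: "\<And>w. w \<in> W \<Longrightarrow> finite (Bad w)" "\<And>w. w \<in> W \<Longrightarrow> card (Bad w) + \<sigma> + d * \<sigma> < m"
    and badin: "\<And>w h x. w \<in> W \<Longrightarrow> host w = Some h \<Longrightarrow> h \<in> W \<Longrightarrow> x < m \<Longrightarrow> x \<notin> Bad h \<Longrightarrow> card (Nb x \<inter> Bad w) \<le> \<theta>"
    and badout: "\<And>w h. w \<in> W \<Longrightarrow> host w = Some h \<Longrightarrow> h \<notin> W \<Longrightarrow> card (Nb (p0 h) \<inter> Bad w) \<le> \<theta>"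
    and D: "\<theta> + \<kappa>1 + \<kappa>2 < D"
  obtains p where "\<And>v. v \<notin> W \<Longrightarrow> p v = p0 v" "inj_on p W"
    "\<And>w. w \<in> W \<Longrightarrow> p w < m" "\<And>w. w \<in> W \<Longrightarrow> p w \<notin> Bad w"
    "\<And>w h. w \<in> W \<Longrightarrow> host w = Some h \<Longrightarrow> p w \<in> Nb (p h)"
proof -
  let ?ch = "\<lambda>W p x. card {w \<in> W. \<exists>h. host w = Some h \<and> p h = x}"
  let ?Q = "\<lambda>W p. (\<forall>v. v \<notin> W \<longrightarrow> p v = p0 v) \<and> inj_on p W \<and>
    (\<forall>w\<in>W. p w < m \<and> p w \<notin> Bad w \<and> (\<forall>h. host w = Some h \<longrightarrow> p w \<in> Nb (p h))) \<and> good (p ` W) (?ch W p)"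
  have "\<exists>p. ?Q W p" using fW cW rank out kin kout bad badin badout
  proof (induction "card W" arbitrary: W)
    case 0
    then show ?case using good_empty by (intro exI[of _ p0]) auto
  next
    case (Suc k)
    have "W \<noteq> {}" using Suc.hyps(2) by auto
    have "Max (rank ` W) \<in> rank ` W" using Suc.prems(1) \<open>W \<noteq> {}\<close> by (intro Max_in) auto
    then obtain w where w: "w \<in> W" "rank w = Max (rank ` W)" by auto
    have max: "rank v \<le> rank w" if "v \<in> W" for v using that w(2) Suc.prems(1) by simp
    define W' where "W' = W - {w}"
    have W': "W = insert w W'" "w \<notin> W'" "finite W'" "card W' = k" "W' \<subseteq> W"
      using w Suc by (auto simp: W'_def)
    have nothost: "host v \<noteq> Some w" if "v \<in> W" for v
      using Suc.prems(3)[OF that] max[OF that] w(1) by fastforce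
    have "\<exists>p. ?Q W' p"
    proof (rule Suc.hyps(1))
      show "k = card W'" "finite W'" "card W' \<le> \<sigma>" using W'(3,4) Suc.prems(2) Suc.hyps(2) by simp_all
      show "card {v \<in> W'. host v = Some h} \<le> \<kappa>1" for h
      proof -
        have "card {v \<in> W'. host v = Some h} \<le> card {v \<in> W. host v = Some h}"
          using Suc.prems(1) W'(5) by (intro card_mono) auto
        then show ?thesis using Suc.prems(5)[of h] by linarith
      qed
      show "card {v \<in> W'. \<exists>h. host v = Some h \<and> h \<notin> W' \<and> p0 h = x} \<le> \<kappa>2" for x
      proof -
        have "{v \<in> W'. \<exists>h. host v = Some h \<and> h \<notin> W' \<and> p0 h = x} \<subseteq> {v \<in> W. \<exists>h. host v = Some h \<and> h \<notin> W \<and> p0 h = x}"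
          using nothost W'(1,5) by blast
        then have "card {v \<in> W'. \<exists>h. host v = Some h \<and> h \<notin> W' \<and> p0 h = x} \<le> card {v \<in> W. \<exists>h. host v = Some h \<and> h \<notin> W \<and> p0 h = x}"
          using Suc.prems(1) by (intro card_mono) auto
        then show ?thesis using Suc.prems(6)[of x] by linarith
      qed
      show "rank h < rank v" if "v \<in> W'" "host v = Some h" "h \<in> W'" for v h
        using Suc.prems(3)[of v h] that W'(5) by blast
      show "p0 h < m" if "v \<in> W'" "host v = Some h" "h \<notin> W'" for v h
        using Suc.prems(4)[of v h] that W'(1,5) nothost by blast
      show "finite (Bad v)" "card (Bad v) + \<sigma> + d * \<sigma> < m" if "v \<in> W'" for v
        using Suc.prems(7,8) that W'(5) by blast+
      show "card (Nb x \<inter> Bad v) \<le> \<theta>" if "v \<in> W'" "host v = Some h" "h \<in> W'" "x < m" "x \<notin> Bad h" for v h x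
        using Suc.prems(9)[of v h x] that W'(5) by blast
      show "card (Nb (p0 h) \<inter> Bad v) \<le> \<theta>" if "v \<in> W'" "host v = Some h" "h \<notin> W'" for v h
        using Suc.prems(10)[of v h] that W'(1,5) nothost by blast
    qed
    then obtain p where Q: "?Q W' p" by (rule exE)
    have p: "\<And>v. v \<notin> W' \<Longrightarrow> p v = p0 v" "inj_on p W'"
        "\<And>v. v \<in> W' \<Longrightarrow> p v < m" "\<And>v. v \<in> W' \<Longrightarrow> p v \<notin> Bad v"
        "\<And>v h. v \<in> W' \<Longrightarrow> host v = Some h \<Longrightarrow> p v \<in> Nb (p h)"
      using Q by blast+
    have g: "good (p ` W') (?ch W' p)" using Q by (elim conjE)
    let ?U = "p ` W'"
    have U: "finite ?U" "card ?U \<le> \<sigma>"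
      using W'(3,4) Suc.prems(2) Suc.hyps(2) card_image_le[of W' p] by simp_all
    \<comment> \<open>By injectivity on \<open>W'\<close> at most one vertex of \<open>W'\<close>
      sits at \<open>x\<close>; all other children near \<open>x\<close> have hosts outside
      \<open>W\<close>.\<close>
    have chle: "?ch W' p x \<le> \<kappa>1 + \<kappa>2" for x
    proof -
      have out: "p h = p0 h" if "h \<notin> W'" for h using p(1) that .
      let ?I = "{v \<in> W'. \<exists>h\<in>W'. host v = Some h \<and> p h = x}"
        and ?O = "{v \<in> W. \<exists>h. host v = Some h \<and> h \<notin> W \<and> p0 h = x}"
      have "card ?I \<le> \<kappa>1"
      proof (cases "\<exists>h\<in>W'. p h = x")
        case True
        then obtain h where h: "h \<in> W'" "p h = x" by blast
        have sub: "?I \<subseteq> {v \<in> W. host v = Some h}" using h p(2) W'(5) by (auto dest: inj_onD)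
        show ?thesis
          using card_mono[of "{v \<in> W. host v = Some h}", OF _ sub] Suc.prems(1) Suc.prems(5)[of h] by auto
      next
        case False
        then have "?I = {}" by blast
        then show ?thesis by (simp only: card.empty le0)
      qed
      moreover have "card ?O \<le> \<kappa>2" using Suc.prems(6) .
      moreover have "{v \<in> W'. \<exists>h. host v = Some h \<and> p h = x} \<subseteq>
         ?I \<union> ?O"
        using out nothost W' by auto
      then have "?ch W' p x \<le> card (?I \<union> ?O)" using W'(3) Suc.prems(1) by (intro card_mono) auto
      ultimately show ?thesis using card_Un_le[of "?I" "?O"] by linarith
    qed
    let ?inc = "\<lambda>x. ?ch W' p x + (if \<exists>h. host w = Some h \<and> p h = x then 1 else 0)"
    have "\<exists>y. y < m \<and> y \<notin> ?U \<and> y \<notin> Bad w \<and> (\<forall>h. host w = Some h \<longrightarrow> y \<in> Nb (p h)) \<and>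
        good (insert y ?U) ?inc"
    proof (cases "host w")
      case None
      obtain y where "y < m" "y \<notin> ?U" "y \<notin> Bad w" "good (insert y ?U) (?ch W' p)"
        using place_root[OF g U, of "Bad w"] Suc.prems(7,8) w(1) by blast
      then show ?thesis using None by auto
    next
      case (Some h)
      have hw: "h \<noteq> w" using nothost w(1) Some by blast
      have "p h < m \<and> card (Nb (p h) \<inter> Bad w) \<le> \<theta>"
      proof (cases "h \<in> W'")
        case True
        then show ?thesis using p(3,4) Suc.prems(9)[OF w(1) Some] W'(5) by blast
      next
        case False
        then have "h \<notin> W" "p h = p0 h" using hw W'(1) p(1)[of h] by auto
        then show ?thesis using Suc.prems(4,10)[OF w(1) Some] by simp
      qed
      then obtain y where y: "y \<in> Nb (p h)" "y \<notin> ?U" "y \<notin> Bad w"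
          "good (insert y ?U) ((?ch W' p)(p h := Suc (?ch W' p (p h))))"
        using place_child[OF g U, of "p h" "Bad w" \<theta>] chle[of "p h"] D by auto
      moreover have "(?ch W' p)(p h := Suc (?ch W' p (p h)))
          = ?inc"
        using Some by (auto simp: fun_eq_iff)
      moreover have "y < m" using y(1) Nb_sub \<open>p h < m \<and> _\<close> by blast
      ultimately show ?thesis using Some by auto
    qed
    then obtain y where y: "y < m" "y \<notin> ?U" "y \<notin> Bad w" "\<forall>h. host w = Some h \<longrightarrow> y \<in> Nb (p h)"
      "good (insert y ?U) ?inc"
      by blast
    let ?p = "p(w := y)"
    have im: "?p ` W = insert y ?U" using W'(1,2) by auto
    have same: "?p h = p h" if "host v = Some h" "v \<in> W" for v h
      using nothost[OF that(2)] that(1) by auto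
    have ch: "?ch W ?p = ?inc"
    proof
      fix x
      have "{v \<in> W. \<exists>h. host v = Some h \<and> ?p h = x} = {v \<in> W. \<exists>h. host v = Some h \<and> p h = x}"
        using same by (intro Collect_cong) metis
      also have "\<dots> = {v \<in> W'. \<exists>h. host v = Some h \<and> p h = x} \<union> (if \<exists>h. host w = Some h \<and> p h = x then {w} else {})"
        using W'(1) by auto
      finally show "?ch W ?p x = ?inc x" using W'(2,3) by simp
    qed
    have "?Q W ?p"
    proof (intro conjI)
      show "\<forall>v. v \<notin> W \<longrightarrow> ?p v = p0 v" using p(1) W'(1) w(1) by auto
      show "inj_on ?p W"
      proof -
        have "?p ` W' = p ` W'" "inj_on ?p W'" using W'(2) inj_on_fun_updI[OF p(2) y(2)] by auto
        then show ?thesis unfolding W'(1) inj_on_insert using W'(2) y(2) by auto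
      qed
      show "\<forall>v\<in>W. ?p v < m \<and> ?p v \<notin> Bad v \<and> (\<forall>h. host v = Some h \<longrightarrow> ?p v \<in> Nb (?p h))"
      proof (intro ballI conjI allI impI)
        fix v assume v: "v \<in> W"
        show "?p v < m" "?p v \<notin> Bad v" using v p(3,4) y(1,3) W'(1) by (auto split: if_splits)
        fix h assume h: "host v = Some h"
        show "?p v \<in> Nb (?p h)" unfolding same[OF h v] using p(5)[OF _ h] y(4) h v W'(1) by auto
      qed
      show "good (?p ` W) (?ch W ?p)" unfolding im ch by (rule y(5))
    qed
    then show ?case by blast
  qed
  with that show ?thesis by blast
qed

section \<open>Look-ahead and placement in batches\<close>

text \<open>Otherwise about \<open>card Y / (\<theta> - 1)\<close> crowded positions would see,
  besides \<open>Y\<close>, at most \<open>d - \<theta> - 1\<close> neighbours each, altogether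
  fewer than \<open>d - 2\<close> per position. Expansion forbids this because
  \<open>d \<le> D + 3\<close>.\<close>

lemma few_crowded:
  assumes ld: "d \<le> D + 3" and fY: "finite Y" and cY: "card Y \<le> 2 * \<sigma>" and th2: "2 \<le> \<theta> - 1"
  shows "(\<theta> - 1) * card {x \<in> {..<m}. \<theta> < card (Nb x \<inter> Y)} \<le> card Y"
proof (rule ccontr)
  let ?Z = "{x \<in> {..<m}. \<theta> < card (Nb x \<inter> Y)}"
  \<comment> \<open>The least number with \<open>card Y < (\<theta> - 1) * z\<close>; taking no more
    crowded positions than that stays within the range of expansion.\<close>
  define z where "z = card Y div (\<theta> - 1) + 1"
  assume "\<not> ?thesis"
  then have "card Y < (\<theta> - 1) * card ?Z" by simp
  then have "card Y div (\<theta> - 1) < card ?Z" using th2 by (simp add: div_less_iff_less_mult mult.commute)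
  then have "z \<le> card ?Z" by (simp add: z_def)
  then obtain Z where Z: "Z \<subseteq> ?Z" "card Z = z" "finite Z" by (rule obtain_subset_with_card_n)
  have "card Y div (\<theta> - 1) \<le> card Y div 2" using th2 by (intro div_le_mono2) auto
  then have z\<sigma>: "z \<le> 2 * \<sigma>" using cY sigma_pos unfolding z_def by linarith
  have zY: "card Y < (\<theta> - 1) * z"
  proof -
    have "card Y < (\<theta> - 1) + (\<theta> - 1) * (card Y div (\<theta> - 1))"
      using th2 by (intro dividend_less_times_div) linarith
    then show ?thesis by (simp only: z_def distrib_left mult_1_right add.commute)
  qed
  have "NB Z \<subseteq> Y \<union> (\<Union>x\<in>Z. Nb x - Y)" by auto
  then have "card (NB Z) \<le> card (Y \<union> (\<Union>x\<in>Z. Nb x - Y))" using fY Z Nb_fin by (intro card_mono) auto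
  also have "\<dots> \<le> card Y + card (\<Union>x\<in>Z. Nb x - Y)" by (rule card_Un_le)
  also have "card (\<Union>x\<in>Z. Nb x - Y) \<le> (\<Sum>x\<in>Z. card (Nb x - Y))" using Z by (intro card_UN_le) auto
  also have "\<dots> \<le> (\<Sum>x\<in>Z. d - (\<theta> + 1))"
  proof (rule sum_mono)
    fix x assume "x \<in> Z"
    then have "\<theta> < card (Nb x \<inter> Y)" using Z by auto
    moreover have "card (Nb x - Y) + card (Nb x \<inter> Y) = card (Nb x)"
      using card_Diff_subset_Int[of "Nb x" Y] card_mono[of "Nb x" "Nb x \<inter> Y"] Nb_fin[of x] by auto
    ultimately show "card (Nb x - Y) \<le> d - (\<theta> + 1)" using Nb_card[of x] by linarith
  qed
  finally have le: "card (NB Z) \<le> card Y + z * (d - (\<theta> + 1))" using Z by simp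
  have "(D + 1) * z \<le> card (NB Z)" using expand[of Z] Z z\<sigma> by auto
  then have "(D + 1) * z < (\<theta> - 1) * z + z * (d - (\<theta> + 1))" using le zY by linarith
  also have "\<dots> = z * (\<theta> - 1 + (d - (\<theta> + 1)))" by (simp add: algebra_simps)
  finally have "(D + 1) < \<theta> - 1 + (d - (\<theta> + 1))" by (metis mult.commute mult_less_cancel2)
  moreover have "\<theta> < d"
  proof -
    have "z \<noteq> 0" by (simp add: z_def)
    then obtain x where "x \<in> Z" using Z by fastforce
    then have "\<theta> < card (Nb x \<inter> Y)" using Z by auto
    also have "\<dots> \<le> card (Nb x)" using Nb_fin by (intro card_mono) auto
    finally show ?thesis using Nb_card[of x] by linarith
  qed
  ultimately show False using ld th2 by linarith
qed

text \<open>Look-ahead: a position is bad for a vertex if it is forbidden or if too many of its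
  neighbours are bad for one of the children. Expansion keeps these sets small.\<close>

lemma lookahead:
  fixes W :: "'v set" and host :: "'v \<Rightarrow> 'v option" and rank :: "'v \<Rightarrow> nat"
  assumes fW: "finite W" and ld: "d \<le> D + 3"
    and rank: "\<And>w h. w \<in> W \<Longrightarrow> host w = Some h \<Longrightarrow> h \<in> W \<Longrightarrow> rank h < rank w"
    and kin: "\<And>h. card {w \<in> W. host w = Some h} \<le> \<kappa>" and \<kappa>: "1 \<le> \<kappa>"
    and B: "\<And>w. w \<in> W \<Longrightarrow> finite (B w)" "\<And>w. w \<in> W \<Longrightarrow> card (B w) \<le> \<sigma>"
  obtains Bad where "\<And>w. w \<in> W \<Longrightarrow> finite (Bad w)" "\<And>w. w \<in> W \<Longrightarrow> B w \<subseteq> Bad w"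
    "\<And>w. w \<in> W \<Longrightarrow> card (Bad w) \<le> 2 * \<sigma>"
    "\<And>w h x. w \<in> W \<Longrightarrow> host w = Some h \<Longrightarrow> h \<in> W \<Longrightarrow> x < m \<Longrightarrow> x \<notin> Bad h \<Longrightarrow> card (Nb x \<inter> Bad w) \<le> 2 * \<kappa> + 1"
proof -
  let ?Q = "\<lambda>W Bad. (\<forall>w\<in>W. finite (Bad w) \<and> B w \<subseteq> Bad w \<and> card (Bad w) \<le> 2 * \<sigma> \<and>
      (\<forall>h x. host w = Some h \<longrightarrow> h \<in> W \<longrightarrow> x < m \<longrightarrow> x \<notin> Bad h \<longrightarrow> card (Nb x \<inter> Bad w) \<le> 2 * \<kappa> + 1))"
  have "\<exists>Bad. ?Q W Bad" using fW rank kin B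
  proof (induction "card W" arbitrary: W)
    case 0
    then show ?case by simp
  next
    case (Suc k)
    have "W \<noteq> {}" using Suc.hyps(2) by auto
    \<comment> \<open>A vertex of least rank is treated last, since its bad set depends on those of
      the vertices it hosts.\<close>
    have "Min (rank ` W) \<in> rank ` W" using Suc.prems(1) \<open>W \<noteq> {}\<close> by (intro Min_in) auto
    then obtain w where w: "w \<in> W" "rank w = Min (rank ` W)" by auto
    have min: "rank w \<le> rank v" if "v \<in> W" for v using that w(2) Suc.prems(1) by simp
    define W' where "W' = W - {w}"
    have W': "W = insert w W'" "w \<notin> W'" "finite W'" "card W' = k" "W' \<subseteq> W"
      using w Suc by (auto simp: W'_def)
    have hostw: "h \<notin> W" if "host w = Some h" for h
      using Suc.prems(2)[OF w(1) that] min[of h] by fastforce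
    have "\<exists>Bad. ?Q W' Bad"
    proof (rule Suc.hyps(1))
      show "card {v \<in> W'. host v = Some h} \<le> \<kappa>" for h
      proof -
        have "card {v \<in> W'. host v = Some h} \<le> card {v \<in> W. host v = Some h}"
          using Suc.prems(1) W'(5) by (intro card_mono) auto
        then show ?thesis using Suc.prems(3)[of h] by linarith
      qed
      show "rank h < rank v" if "v \<in> W'" "host v = Some h" "h \<in> W'" for v h
        using Suc.prems(2)[of v h] that W'(5) by blast
      show "finite (B v)" "card (B v) \<le> \<sigma>" if "v \<in> W'" for v using Suc.prems(4,5) that W'(5) by blast+
    qed (use W' in simp_all)
    then obtain Bad where Bad: "?Q W' Bad" by (rule exE)
    let ?K = "{v \<in> W. host v = Some w}"
    have K: "?K \<subseteq> W'" "finite ?K" using hostw w(1) Suc.prems(1) W'(1) by auto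
    let ?C = "\<lambda>v. {x \<in> {..<m}. 2 * \<kappa> + 1 < card (Nb x \<inter> Bad v)}"
    have C: "\<kappa> * card (?C v) \<le> \<sigma>" if "v \<in> ?K" for v
    proof -
      have "v \<in> W'" using that K by blast
      then have "finite (Bad v)" "card (Bad v) \<le> 2 * \<sigma>" using Bad by blast+
      then have "(2 * \<kappa> + 1 - 1) * card (?C v) \<le> card (Bad v)" using \<kappa> by (intro few_crowded ld) auto
      then show ?thesis using \<open>card (Bad v) \<le> 2 * \<sigma>\<close> by simp
    qed
    define Bw where "Bw = B w \<union> (\<Union>v\<in>?K. ?C v)"
    have "\<kappa> * card (\<Union>v\<in>?K. ?C v) \<le> \<kappa> * (\<Sum>v\<in>?K. card (?C v))" by (intro mult_le_mono2 card_UN_le K)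
    also have "\<dots> = (\<Sum>v\<in>?K. \<kappa> * card (?C v))" by (rule sum_distrib_left)
    also have "\<dots> \<le> (\<Sum>v\<in>?K. \<sigma>)" by (intro sum_mono C)
    also have "\<dots> = card ?K * \<sigma>" by simp
    also have "\<dots> \<le> \<kappa> * \<sigma>" by (intro mult_le_mono1 Suc.prems(3))
    finally have "card (\<Union>v\<in>?K. ?C v) \<le> \<sigma>" using \<kappa> by simp
    then have cBw: "card Bw \<le> 2 * \<sigma>"
      using card_Un_le[of "B w" "\<Union>v\<in>?K. ?C v"] Suc.prems(5)[OF w(1)] unfolding Bw_def by linarith
    have "?Q W (Bad(w := Bw))"
    proof (intro ballI conjI allI impI)
      fix v assume v: "v \<in> W"
      show "finite ((Bad(w := Bw)) v)"
        using v Bad W'(1) Suc.prems(4)[OF w(1)] K(2) by (auto simp: Bw_def)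
      show "B v \<subseteq> (Bad(w := Bw)) v" using v Bad W'(1) by (auto simp: Bw_def)
      show "card ((Bad(w := Bw)) v) \<le> 2 * \<sigma>" using v Bad W'(1) cBw by auto
      fix h x assume h: "host v = Some h" "h \<in> W" "x < m" "x \<notin> (Bad(w := Bw)) h"
      have vw: "v \<noteq> w" using h hostw by blast
      then have v': "v \<in> W'" using v W'(1) by blast
      show "card (Nb x \<inter> (Bad(w := Bw)) v) \<le> 2 * \<kappa> + 1"
      proof (cases "h = w")
        case True
        then have "x \<notin> ?C v" using h v by (auto simp: Bw_def)
        then show ?thesis using vw h(3) by auto
      next
        case False
        then have "h \<in> W'" "x \<notin> Bad h" using h W'(1) by auto
        then show ?thesis using Bad v' h(1,3) vw by auto
      qed
    qed
    then show ?case by blast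
  qed
  then obtain Bad where "?Q W Bad" by (rule exE)
  then show ?thesis by (intro that[of Bad]) blast+
qed

text \<open>All vertices together may exceed \<sigma>, so batches closed under hosts are embedded
  one after the other, each starting with no position occupied. Earlier batches are remembered only
  through the positions of conflicting vertices, at most \<sigma> for each vertex, which the
  look-ahead extends to bad sets. Inside a batch the embedding is injective anyway.\<close>

lemma embed_batches:
  fixes I :: "'i set" and W :: "'i \<Rightarrow> 'v set" and host :: "'v \<Rightarrow> 'v option" and rank :: "'v \<Rightarrow> nat"
    and conf :: "'v \<Rightarrow> 'v \<Rightarrow> bool"
  assumes fI: "finite I" and ld: "d \<le> D + 3" and D: "3 * \<kappa> + 1 < D" and \<kappa>: "1 \<le> \<kappa>"
    and m: "3 * \<sigma> + d * \<sigma> < m"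
    and fW: "\<And>i. i \<in> I \<Longrightarrow> finite (W i)" and cW: "\<And>i. i \<in> I \<Longrightarrow> card (W i) \<le> \<sigma>"
    and disj: "\<And>i j. i \<in> I \<Longrightarrow> j \<in> I \<Longrightarrow> i \<noteq> j \<Longrightarrow> W i \<inter> W j = {}"
    and host: "\<And>i w h. i \<in> I \<Longrightarrow> w \<in> W i \<Longrightarrow> host w = Some h \<Longrightarrow> h \<in> W i \<and> rank h < rank w"
    and kin: "\<And>i h. i \<in> I \<Longrightarrow> card {w \<in> W i. host w = Some h} \<le> \<kappa>"
    and conf: "\<And>v w. conf v w \<Longrightarrow> conf w v"
      "\<And>w. w \<in> \<Union>(W ` I) \<Longrightarrow> card {v \<in> \<Union>(W ` I). conf w v} \<le> \<sigma>"
  obtains p where "\<And>w. w \<in> \<Union>(W ` I) \<Longrightarrow> p w < m"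
    "\<And>w h. w \<in> \<Union>(W ` I) \<Longrightarrow> host w = Some h \<Longrightarrow> p w \<in> Nb (p h)"
    "\<And>v w. v \<in> \<Union>(W ` I) \<Longrightarrow> w \<in> \<Union>(W ` I) \<Longrightarrow> v \<noteq> w \<Longrightarrow> conf v w \<Longrightarrow> p v \<noteq> p w"
proof -
  let ?Q = "\<lambda>J p. (\<forall>w\<in>\<Union>(W ` J). p w < m \<and> (\<forall>h. host w = Some h \<longrightarrow> p w \<in> Nb (p h)) \<and>
      (\<forall>v\<in>\<Union>(W ` J). v \<noteq> w \<longrightarrow> conf v w \<longrightarrow> p v \<noteq> p w))"
  have "\<exists>p. ?Q J p" if "J \<subseteq> I" for J using finite_subset[OF that fI] that
  proof (induction J rule: finite_induct)
    case empty
    then show ?case by simp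
  next
    case (insert i J)
    then obtain p where p: "?Q J p" by auto
    have i: "i \<in> I" and J: "J \<subseteq> I" "finite J" using insert by auto
    let ?P = "\<Union>(W ` J)"
    have fP: "finite ?P" using J fW by auto
    have dis: "W i \<inter> ?P = {}" using disj[OF i] insert.hyps(2) J by blast
    define B where "B w = p ` {v \<in> ?P. conf w v}" for w
    have B: "finite (B w)" "card (B w) \<le> \<sigma>" if "w \<in> W i" for w
    proof -
      show "finite (B w)" unfolding B_def by (intro finite_imageI finite_subset[OF _ fP]) auto
      have "card (B w) \<le> card {v \<in> ?P. conf w v}"
        unfolding B_def by (intro card_image_le finite_subset[OF _ fP]) auto
      also have "\<dots> \<le> card {v \<in> \<Union>(W ` I). conf w v}" using fI fW J by (intro card_mono) auto
      also have "\<dots> \<le> \<sigma>" using conf(2) i that by blast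
      finally show "card (B w) \<le> \<sigma>" .
    qed
    obtain Bad where Bad: "\<And>w. w \<in> W i \<Longrightarrow> finite (Bad w)" "\<And>w. w \<in> W i \<Longrightarrow> B w \<subseteq> Bad w"
      "\<And>w. w \<in> W i \<Longrightarrow> card (Bad w) \<le> 2 * \<sigma>"
      "\<And>w h x. w \<in> W i \<Longrightarrow> host w = Some h \<Longrightarrow> h \<in> W i \<Longrightarrow> x < m \<Longrightarrow> x \<notin> Bad h \<Longrightarrow> card (Nb x \<inter> Bad w) \<le> 2 * \<kappa> + 1"
    proof (rule lookahead[of "W i" host rank \<kappa> B])
      show "rank h < rank w" if "w \<in> W i" "host w = Some h" "h \<in> W i" for w h
        using host[OF i] that by blast
    qed (use fW[OF i] ld kin[OF i] \<kappa> B in blast)+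
    have none: "{w \<in> W i. \<exists>h. host w = Some h \<and> h \<notin> W i \<and> p h = x} = {}" for x using host[OF i] by blast
    obtain p' where p': "\<And>v. v \<notin> W i \<Longrightarrow> p' v = p v" "inj_on p' (W i)"
      "\<And>w. w \<in> W i \<Longrightarrow> p' w < m" "\<And>w. w \<in> W i \<Longrightarrow> p' w \<notin> Bad w"
      "\<And>w h. w \<in> W i \<Longrightarrow> host w = Some h \<Longrightarrow> p' w \<in> Nb (p' h)"
    proof (rule embed_forest[of "W i" host rank p \<kappa> 0 Bad "2 * \<kappa> + 1"])
      show "rank h < rank w" if "w \<in> W i" "host w = Some h" "h \<in> W i" for w h
        using host[OF i] that by blast
      show "card {w \<in> W i. \<exists>h. host w = Some h \<and> h \<notin> W i \<and> p h = x} \<le> 0" for x unfolding none by simp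
      show "card (Bad w) + \<sigma> + d * \<sigma> < m" if "w \<in> W i" for w using Bad(3)[OF that] m by linarith
      show "p h < m" "card (Nb (p h) \<inter> Bad w) \<le> 2 * \<kappa> + 1" if "w \<in> W i" "host w = Some h" "h \<notin> W i" for w h
        using host[OF i] that by blast+
      show "2 * \<kappa> + 1 + \<kappa> + 0 < D" using D by simp
    qed (use fW[OF i] cW[OF i] kin[OF i] Bad in blast)+
    have old: "p' v = p v" if "v \<in> ?P" for v using p'(1) that dis by blast
    have oldhost: "h \<in> ?P" if "v \<in> ?P" "host v = Some h" for v h using that host J by blast
    have new: "p' w \<noteq> p' v" if "w \<in> W i" "v \<in> ?P" "conf w v" for v w
    proof -
      have "p v \<in> Bad w" using Bad(2)[OF that(1)] that by (auto simp: B_def)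
      then show ?thesis using p'(4)[OF that(1)] old[OF that(2)] by metis
    qed
    have "?Q (insert i J) p'"
    proof (intro ballI conjI allI impI)
      fix w assume "w \<in> \<Union>(W ` insert i J)"
      then consider "w \<in> W i" | "w \<in> ?P" "w \<notin> W i" by auto
      note w = this
      show "p' w < m" using w by cases (use p' p old in auto)
      show "p' w \<in> Nb (p' h)" if "host w = Some h" for h using w
      proof cases
        case 2
        then show ?thesis using p oldhost[OF 2(1) that] old that by auto
      qed (use p'(5) that in blast)
      fix v assume "v \<in> \<Union>(W ` insert i J)" and vw: "v \<noteq> w" "conf v w"
      then consider "v \<in> W i" | "v \<in> ?P" "v \<notin> W i" by auto
      then show "p' v \<noteq> p' w"
      proof cases
        case 1
        from w show ?thesis
        proof cases
          case 1
          then show ?thesis using p'(2) \<open>v \<in> W i\<close> vw by (auto dest: inj_onD)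
        next
          case 2
          then show ?thesis using new[OF 1] vw by blast
        qed
      next
        case v: 2
        from w show ?thesis
        proof cases
          case 1
          then show ?thesis using new[OF 1 v(1)] vw conf(1) by metis
        next
          case 2
          then show ?thesis using p v vw old by metis
        qed
      qed
    qed
    then show ?case by blast
  qed
  then obtain p where "?Q I p" by blast
  then show ?thesis by (intro that[of p]) blast+
qed

end

section \<open>Labels\<close>

type_synonym desc = "nat \<times> nat \<times> nat"

type_synonym label = "nat list \<times> desc set \<times> desc set \<times> desc set \<times> desc set"

text \<open>A label consists of \<open>\<Delta>\<close> numbers below \<open>N\<close> and a bounded amount of extra data: four sets
  of triples \<open>(tag, i, c)\<close>, each standing for the tagged number obtained by applying the \<open>c\<close>-th
  decoding function to the \<open>i\<close>-th number. Only the numbers grow with \<open>n\<close>.\<close>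

definition tr :: "nat \<Rightarrow> (nat \<Rightarrow> nat \<Rightarrow> nat) \<Rightarrow> nat \<Rightarrow> nat \<Rightarrow> nat" where
  "tr d \<phi> c x = (if c < d then \<phi> c x else if c = d then x else 0)"

definition dec :: "nat \<Rightarrow> (nat \<Rightarrow> nat \<Rightarrow> nat) \<Rightarrow> nat list \<Rightarrow> desc set \<Rightarrow> (nat \<times> nat) set" where
  "dec d \<phi> xs S = (\<lambda>(tag, i, c). (tag, tr d \<phi> c (xs ! i))) ` S"

definition descs :: "nat \<Rightarrow> nat \<Rightarrow> nat \<Rightarrow> desc set" where
  "descs \<tau> \<Delta> d = {..<\<tau>} \<times> {..<\<Delta>} \<times> {..<d + 2}"

definition labels :: "nat \<Rightarrow> nat \<Rightarrow> nat \<Rightarrow> nat \<Rightarrow> label set" where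
  "labels \<tau> \<Delta> d N = {xs. set xs \<subseteq> {..<N} \<and> length xs = \<Delta>} \<times> Pow (descs \<tau> \<Delta> d) \<times>
     Pow (descs \<tau> \<Delta> d) \<times> Pow (descs \<tau> \<Delta> d) \<times> Pow (descs \<tau> \<Delta> d)"

lemma finite_labels [simp]: "finite (labels \<tau> \<Delta> d N)"
  unfolding labels_def descs_def by (intro finite_cartesian_product finite_lists_length_eq) simp_all

lemma card_labels: "card (labels \<tau> \<Delta> d N) = N ^ \<Delta> * (2 ^ (\<tau> * (\<Delta> * (d + 2)))) ^ 4"
proof -
  have "card {xs. set xs \<subseteq> {..<N} \<and> length xs = \<Delta>} = N ^ \<Delta>"
    using card_lists_length_eq[of "{..<N}" \<Delta>] by simp
  moreover have "card (Pow (descs \<tau> \<Delta> d)) = 2 ^ (\<tau> * (\<Delta> * (d + 2)))"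
    by (simp only: descs_def card_Pow card_cartesian_product card_lessThan finite_cartesian_product finite_lessThan)
  ultimately show ?thesis
    unfolding labels_def card_cartesian_product by (simp only: power4_eq_xxxx mult.assoc)
qed

text \<open>A certificate for the arc \<open>u \<rightarrow> w\<close>: \<open>u\<close> stores an identity of \<open>w\<close> and, unless the tag
  of this identity lies in \<open>T\<close>, also \<open>w\<close> stores the key of \<open>u\<close>.\<close>

definition cert :: "nat set \<Rightarrow> (nat \<times> nat) set \<Rightarrow> (nat \<times> nat) set \<Rightarrow> (nat \<times> nat) set \<Rightarrow> (nat \<times> nat) set \<Rightarrow> bool" where
  "cert T Out Key ID InK \<longleftrightarrow> (\<exists>e\<in>Out \<inter> ID. fst e \<in> T \<or> Key \<inter> InK \<noteq> {})"

fun label_arc :: "nat set \<Rightarrow> nat \<Rightarrow> (nat \<Rightarrow> nat \<Rightarrow> nat) \<Rightarrow> label \<Rightarrow> label \<Rightarrow> bool" where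
  "label_arc T d \<phi> (xs, Out, Key, ID, InK) (xs', Out', Key', ID', InK') =
     cert T (dec d \<phi> xs Out) (dec d \<phi> xs Key) (dec d \<phi> xs' ID') (dec d \<phi> xs' InK')"

definition label_edge :: "nat set \<Rightarrow> nat \<Rightarrow> (nat \<Rightarrow> nat \<Rightarrow> nat) \<Rightarrow> label set \<Rightarrow> label \<Rightarrow> label \<Rightarrow> bool" where
  "label_edge T d \<phi> L a b \<longleftrightarrow> a \<in> L \<and> b \<in> L \<and> a \<noteq> b \<and> (label_arc T d \<phi> a b \<or> label_arc T d \<phi> b a)"

lemma simple_graph_labels: "finite L \<Longrightarrow> simple_graph L (label_edge T d \<phi> L)"
  by (auto simp: simple_graph_def label_edge_def)

definition decodable :: "nat \<Rightarrow> nat \<Rightarrow> (nat \<Rightarrow> nat \<Rightarrow> nat) \<Rightarrow> nat set \<Rightarrow> (nat \<times> nat) set \<Rightarrow> bool" where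
  "decodable \<tau> d \<phi> W S \<longleftrightarrow> (\<forall>(tag, v)\<in>S. tag < \<tau> \<and> (v = 0 \<or> v \<in> W \<or> (\<exists>c<d. \<exists>x\<in>W. v = \<phi> c x)))"

lemma decodable_dec:
  assumes S: "decodable \<tau> d \<phi> W S" and W: "W \<subseteq> set xs" and len: "length xs = \<Delta>" "\<Delta> > 0"
  obtains R where "R \<subseteq> descs \<tau> \<Delta> d" "dec d \<phi> xs R = S"
proof
  let ?f = "\<lambda>(tag, i, c). (tag, tr d \<phi> c (xs ! i))"
  let ?R = "{r \<in> descs \<tau> \<Delta> d. ?f r \<in> S}"
  show "?R \<subseteq> descs \<tau> \<Delta> d" by blast
  have "e \<in> ?f ` ?R" if e: "e \<in> S" for e
  proof -
    obtain tag v where tv: "e = (tag, v)" "tag < \<tau>" "v = 0 \<or> v \<in> W \<or> (\<exists>c<d. \<exists>x\<in>W. v = \<phi> c x)"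
      using S e unfolding decodable_def by (cases e) blast
    have "\<exists>i<\<Delta>. \<exists>c<d + 2. tr d \<phi> c (xs ! i) = v" using tv(3)
    proof (elim disjE)
      assume "v = 0"
      then have "tr d \<phi> (d + 1) (xs ! 0) = v" by (simp add: tr_def)
      then show ?thesis using len by auto
    next
      assume "v \<in> W"
      then obtain i where "i < \<Delta>" "xs ! i = v" using W len by (auto simp: in_set_conv_nth subset_iff)
      then have "tr d \<phi> d (xs ! i) = v" by (simp add: tr_def)
      then show ?thesis using \<open>i < \<Delta>\<close> by (intro exI[of _ i] exI[of _ d] conjI) auto
    next
      assume "\<exists>c<d. \<exists>x\<in>W. v = \<phi> c x"
      then obtain c x where c: "c < d" "x \<in> W" "v = \<phi> c x" by blast
      then obtain i where "i < \<Delta>" "xs ! i = x" using W len by (auto simp: in_set_conv_nth subset_iff)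
      then have "tr d \<phi> c (xs ! i) = v" using c by (simp add: tr_def)
      then show ?thesis using \<open>i < \<Delta>\<close> c(1) by (intro exI[of _ i] exI[of _ c] conjI) auto
    qed
    then obtain i c where "i < \<Delta>" "c < d + 2" "tr d \<phi> c (xs ! i) = v" by blast
    then have "(tag, i, c) \<in> ?R" "?f (tag, i, c) = e" using tv e by (auto simp: descs_def)
    then show ?thesis by (metis (no_types, lifting) image_eqI)
  qed
  then show "dec d \<phi> xs ?R = S" unfolding dec_def by blast
qed

text \<open>Separates combinatorics from encoding. The graph on the labels depends on the decoding
  functions alone, so it remains to give every vertex four sets that can be computed from at most
  \<Delta> numbers. Key and identity must determine the vertex, which makes the labelling
  injective.\<close>

lemma induced_copy_in_labels:
  fixes V :: "'v set" and F :: "'v \<Rightarrow> 'v \<Rightarrow> bool"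
  assumes \<Delta>: "\<Delta> > 0" and N: "N > 0"
    and W: "\<And>v. v \<in> V \<Longrightarrow> finite (W v)" "\<And>v. v \<in> V \<Longrightarrow> card (W v) \<le> \<Delta>" "\<And>v. v \<in> V \<Longrightarrow> W v \<subseteq> {..<N}"
    and dec: "\<And>v. v \<in> V \<Longrightarrow> decodable \<tau> d \<phi> (W v) (Out v)" "\<And>v. v \<in> V \<Longrightarrow> decodable \<tau> d \<phi> (W v) (Key v)"
      "\<And>v. v \<in> V \<Longrightarrow> decodable \<tau> d \<phi> (W v) (ID v)" "\<And>v. v \<in> V \<Longrightarrow> decodable \<tau> d \<phi> (W v) (InK v)"
    and inj: "\<And>u v. u \<in> V \<Longrightarrow> v \<in> V \<Longrightarrow> Key u = Key v \<Longrightarrow> ID u = ID v \<Longrightarrow> u = v"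
    and irr: "\<And>u. \<not> F u u"
    and F: "\<And>u v. u \<in> V \<Longrightarrow> v \<in> V \<Longrightarrow> u \<noteq> v \<Longrightarrow> F u v \<longleftrightarrow>
      cert T (Out u) (Key u) (ID v) (InK v) \<or> cert T (Out v) (Key v) (ID u) (InK u)"
  shows "induced_subgraph_copy V F (labels \<tau> \<Delta> d N) (label_edge T d \<phi> (labels \<tau> \<Delta> d N))"
proof -
  let ?G = "\<lambda>v l. case l of (xs, A, B, C, D) \<Rightarrow>
      dec d \<phi> xs A = Out v \<and> dec d \<phi> xs B = Key v \<and> dec d \<phi> xs C = ID v \<and> dec d \<phi> xs D = InK v"
  have "\<exists>l \<in> labels \<tau> \<Delta> d N. ?G v l" if v: "v \<in> V" for v
  proof -
    obtain ys where ys: "set ys = W v" "length ys = card (W v)"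
      using finite_distinct_list[OF W(1)[OF v]] distinct_card by metis
    \<comment> \<open>Padding with 0, admissible because \<open>N > 0\<close>, brings all lists to
      length \<Delta>.\<close>
    define xs where "xs = ys @ replicate (\<Delta> - length ys) 0"
    have xs: "W v \<subseteq> set xs" "length xs = \<Delta>" "set xs \<subseteq> {..<N}"
      using ys W(2,3)[OF v] N by (auto simp: xs_def)
    obtain A where A: "A \<subseteq> descs \<tau> \<Delta> d" "dec d \<phi> xs A = Out v"
      by (rule decodable_dec[OF dec(1)[OF v] xs(1,2) \<Delta>])
    obtain B where B: "B \<subseteq> descs \<tau> \<Delta> d" "dec d \<phi> xs B = Key v"
      by (rule decodable_dec[OF dec(2)[OF v] xs(1,2) \<Delta>])
    obtain C where C: "C \<subseteq> descs \<tau> \<Delta> d" "dec d \<phi> xs C = ID v"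
      by (rule decodable_dec[OF dec(3)[OF v] xs(1,2) \<Delta>])
    obtain D where D: "D \<subseteq> descs \<tau> \<Delta> d" "dec d \<phi> xs D = InK v"
      by (rule decodable_dec[OF dec(4)[OF v] xs(1,2) \<Delta>])
    show ?thesis using xs A B C D by (intro bexI[of _ "(xs, A, B, C, D)"]) (auto simp: labels_def)
  qed
  then have "\<forall>v\<in>V. \<exists>l. l \<in> labels \<tau> \<Delta> d N \<and> ?G v l"
    by (intro ballI) (simp only: Bex_def)
  from bchoice[OF this] obtain f where f0: "\<forall>v\<in>V. f v \<in> labels \<tau> \<Delta> d N \<and> ?G v (f v)" ..
  note f = f0[THEN bspec, THEN conjunct1] f0[THEN bspec, THEN conjunct2]
  have arc: "label_arc T d \<phi> (f u) (f v) \<longleftrightarrow> cert T (Out u) (Key u) (ID v) (InK v)"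
    if "u \<in> V" "v \<in> V" for u v
    using f(2)[OF that(1)] f(2)[OF that(2)] by (cases "f u"; cases "f v") auto
  have inj_f: "inj_on f V"
  proof
    fix u v assume uv: "u \<in> V" "v \<in> V" "f u = f v"
    then have "Key u = Key v \<and> ID u = ID v" using f(2)[OF uv(1)] f(2)[OF uv(2)] by (cases "f v") auto
    then show "u = v" using inj uv by blast
  qed
  have "F u v \<longleftrightarrow> label_edge T d \<phi> (labels \<tau> \<Delta> d N) (f u) (f v)" if uv: "u \<in> V" "v \<in> V" for u v
  proof (cases "u = v")
    case True
    then show ?thesis using irr by (simp add: label_edge_def)
  next
    case False
    then have "f u \<noteq> f v" using inj_f uv by (auto dest: inj_onD)
    then show ?thesis using F[OF uv False] arc uv f(1) by (simp add: label_edge_def)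
  qed
  then show ?thesis unfolding induced_subgraph_copy_def using inj_f f(1) by blast
qed

lemma universal_nat_copy:
  fixes L :: "'a set"
  assumes L: "finite L" "simple_graph L E" "induced_universal_for L E n \<Delta>"
  shows "\<exists>(V :: nat set) E'. simple_graph V E' \<and> card V = card L \<and> induced_universal_for V E' n \<Delta>"
proof -
  obtain g :: "'a \<Rightarrow> nat" where g: "inj_on g L" using finite_imp_inj_to_nat_seg[OF L(1)] by blast
  let ?E = "\<lambda>x y. \<exists>a\<in>L. \<exists>b\<in>L. x = g a \<and> y = g b \<and> E a b"
  have E: "?E (g a) (g b) \<longleftrightarrow> E a b" if "a \<in> L" "b \<in> L" for a b using g that by (auto dest: inj_onD)
  have "simple_graph (g ` L) ?E" unfolding simple_graph_def
  proof (intro conjI allI impI)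
    have irr: "\<not> E a a" and sym: "E a b \<Longrightarrow> E b a" for a b using L(2) by (auto simp: simple_graph_def)
    show "finite (g ` L)" using L(1) by simp
    fix x y
    show "x \<in> g ` L" "y \<in> g ` L" "?E y x" if "?E x y" using that sym by blast+
    show "\<not> ?E x x" using irr g by (auto dest: inj_onD)
  qed
  moreover have "induced_universal_for (g ` L) ?E n \<Delta>" unfolding induced_universal_for_def
  proof (intro allI impI)
    fix F assume "simple_graph {0..<n} F \<and> max_degree_le {0..<n} F \<Delta>"
    then obtain f where f: "inj_on f {0..<n}" "f ` {0..<n} \<subseteq> L"
      "\<forall>u\<in>{0..<n}. \<forall>v\<in>{0..<n}. F u v \<longleftrightarrow> E (f u) (f v)"
      using L(3) unfolding induced_universal_for_def induced_subgraph_copy_def by blast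
    have "inj_on (g \<circ> f) {0..<n}" using f g by (meson comp_inj_on inj_on_subset)
    moreover have "(g \<circ> f) ` {0..<n} \<subseteq> g ` L" using f(2) by auto
    moreover have "F u v \<longleftrightarrow> ?E ((g \<circ> f) u) ((g \<circ> f) v)" if "u \<in> {0..<n}" "v \<in> {0..<n}" for u v
    proof -
      have "f u \<in> L" "f v \<in> L" using f(2) that by auto
      then show ?thesis using E f(3) that by simp
    qed
    ultimately show "induced_subgraph_copy {0..<n} F (g ` L) ?E"
      unfolding induced_subgraph_copy_def by blast
  qed
  ultimately show ?thesis using card_image[OF g] by blast
qed

section \<open>Depth-first forests\<close>

text \<open>\<open>Tr\<close> is the (parent, child) relation of a rooted forest on \<open>U\<close> with depth function \<open>dep\<close>, such
  that every edge of \<open>F\<close> joins a vertex to one of its ancestors, as for a depth-first search.\<close>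

definition normal_forest :: "('v \<Rightarrow> 'v \<Rightarrow> bool) \<Rightarrow> 'v set \<Rightarrow> ('v \<times> 'v) set \<Rightarrow> ('v \<Rightarrow> nat) \<Rightarrow> bool" where
  "normal_forest F U Tr dep \<longleftrightarrow> Tr \<subseteq> U \<times> U \<and> (\<forall>(x, y)\<in>Tr. F x y \<and> dep y = Suc (dep x)) \<and>
     (\<forall>x x' y. (x, y) \<in> Tr \<longrightarrow> (x', y) \<in> Tr \<longrightarrow> x = x') \<and>
     (\<forall>x\<in>U. \<forall>y\<in>U. F x y \<longrightarrow> (x, y) \<in> Tr\<^sup>+ \<or> (y, x) \<in> Tr\<^sup>+)"

text \<open>For symmetric \<open>F\<close> these sets are the unions of components of the graph on
  \<open>W\<close>. Connectedness is expressed by them instead of walks: only the empty set and the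
  whole set are closed.\<close>

definition closed_in :: "('v \<Rightarrow> 'v \<Rightarrow> bool) \<Rightarrow> 'v set \<Rightarrow> 'v set \<Rightarrow> bool" where
  "closed_in F W U \<longleftrightarrow> U \<subseteq> W \<and> (\<forall>x\<in>U. \<forall>y\<in>W. F x y \<longrightarrow> y \<in> U)"

lemma normal_forestD:
  assumes "normal_forest F U Tr dep"
  shows "(x, y) \<in> Tr \<Longrightarrow> x \<in> U \<and> y \<in> U" "(x, y) \<in> Tr \<Longrightarrow> F x y \<and> dep y = Suc (dep x)"
    "(x, y) \<in> Tr \<Longrightarrow> (x', y) \<in> Tr \<Longrightarrow> x = x'"
    "x \<in> U \<Longrightarrow> y \<in> U \<Longrightarrow> F x y \<Longrightarrow> (x, y) \<in> Tr\<^sup>+ \<or> (y, x) \<in> Tr\<^sup>+"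
  using assms unfolding normal_forest_def by blast+

text \<open>The tree on \<open>U1\<close> is hung below \<open>r\<close> as one more child subtree.
  Edges between the two trees end at \<open>r\<close>, an ancestor of everything else, so the forest
  stays normal.\<close>

lemma normal_tree_graft:
  assumes sym: "\<And>x y. F x y \<Longrightarrow> F y x" and irr: "\<And>x. \<not> F x x"
    and T1: "normal_forest F U1 T1 d1" "s \<in> U1" "\<And>x. (x, s) \<notin> T1" "d1 s = 0"
      "\<And>x. x \<in> U1 \<Longrightarrow> x \<noteq> s \<Longrightarrow> (s, x) \<in> T1\<^sup>+"
    and T2: "normal_forest F U2 T2 d2" "r \<in> U2" "\<And>x. (x, r) \<notin> T2" "d2 r = 0"
      "\<And>x. x \<in> U2 \<Longrightarrow> x \<noteq> r \<Longrightarrow> (r, x) \<in> T2\<^sup>+"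
    and disj: "U1 \<inter> U2 = {}" and rs: "F r s"
    and sep: "\<And>x y. x \<in> U1 \<Longrightarrow> y \<in> U2 \<Longrightarrow> y \<noteq> r \<Longrightarrow> \<not> F x y"
  defines "Tr \<equiv> insert (r, s) (T1 \<union> T2)" and "dep \<equiv> \<lambda>x. if x \<in> U1 then Suc (d1 x) else d2 x"
  shows "normal_forest F (U1 \<union> U2) Tr dep" "\<And>x. (x, r) \<notin> Tr" "dep r = 0"
    "\<And>x. x \<in> U1 \<union> U2 \<Longrightarrow> x \<noteq> r \<Longrightarrow> (r, x) \<in> Tr\<^sup>+"
proof -
  have sub: "T1 \<subseteq> U1 \<times> U1" "T2 \<subseteq> U2 \<times> U2" using T1(1) T2(1) by (auto simp: normal_forest_def)
  have m1: "T1\<^sup>+ \<subseteq> Tr\<^sup>+" and m2: "T2\<^sup>+ \<subseteq> Tr\<^sup>+" by (auto simp: Tr_def intro: trancl_mono)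
  have rsT: "(r, s) \<in> Tr\<^sup>+" by (auto simp: Tr_def)
  show top: "(r, x) \<in> Tr\<^sup>+" if "x \<in> U1 \<union> U2" "x \<noteq> r" for x
  proof (cases "x \<in> U1")
    case True
    show ?thesis
    proof (cases "x = s")
      case False
      then have "(s, x) \<in> Tr\<^sup>+" using T1(5) True m1 by blast
      then show ?thesis using rsT by (rule trancl_trans[rotated])
    qed (use rsT in simp)
  next
    case False
    then show ?thesis using T2(5) that m2 by blast
  qed
  show "(x, r) \<notin> Tr" for x using T2(2,3) sub disj T1(2) by (auto simp: Tr_def)
  show "dep r = 0" using T2(2,4) disj by (auto simp: dep_def)
  show "normal_forest F (U1 \<union> U2) Tr dep" unfolding normal_forest_def
  proof (intro conjI)
    show "Tr \<subseteq> (U1 \<union> U2) \<times> (U1 \<union> U2)" using sub T1(2) T2(2) by (auto simp: Tr_def)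
    show "\<forall>(x, y)\<in>Tr. F x y \<and> dep y = Suc (dep x)"
    proof (intro ballI, clarify)
      fix x y assume "(x, y) \<in> Tr"
      then consider "x = r" "y = s" | "(x, y) \<in> T1" | "(x, y) \<in> T2" by (auto simp: Tr_def)
      then show "F x y \<and> dep y = Suc (dep x)"
      proof cases
        case 1
        then show ?thesis using rs T1(2,4) T2(2,4) disj by (auto simp: dep_def)
      next
        case 2
        then show ?thesis using T1(1) sub(1) by (auto simp: dep_def normal_forest_def)
      next
        case 3
        moreover have "x \<notin> U1" "y \<notin> U1" using 3 sub(2) disj by auto
        ultimately show ?thesis using T2(1) by (auto simp: dep_def normal_forest_def)
      qed
    qed
    show "\<forall>x x' y. (x, y) \<in> Tr \<longrightarrow> (x', y) \<in> Tr \<longrightarrow> x = x'"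
    proof (intro allI impI)
      fix x x' y assume xy: "(x, y) \<in> Tr" "(x', y) \<in> Tr"
      show "x = x'"
      proof (cases "y = s")
        case True
        then have "x = r \<and> x' = r" using xy T1(2,3) sub disj by (auto simp: Tr_def)
        then show ?thesis by simp
      next
        case False
        then have "(x, y) \<in> T1 \<union> T2" "(x', y) \<in> T1 \<union> T2" using xy by (auto simp: Tr_def)
        then have "(x, y) \<in> T1 \<and> (x', y) \<in> T1 \<or> (x, y) \<in> T2 \<and> (x', y) \<in> T2" using sub disj by blast
        then show ?thesis using T1(1) T2(1) unfolding normal_forest_def by blast
      qed
    qed
    show "\<forall>x\<in>U1 \<union> U2. \<forall>y\<in>U1 \<union> U2. F x y \<longrightarrow> (x, y) \<in> Tr\<^sup>+ \<or> (y, x) \<in> Tr\<^sup>+"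
    proof (intro ballI impI)
      fix x y assume xy: "x \<in> U1 \<union> U2" "y \<in> U1 \<union> U2" "F x y"
      show "(x, y) \<in> Tr\<^sup>+ \<or> (y, x) \<in> Tr\<^sup>+"
      proof (cases "x = r \<or> y = r")
        case True
        then show ?thesis using top xy irr by metis
      next
        case False
        then have "x \<in> U1 \<and> y \<in> U1 \<or> x \<in> U2 \<and> y \<in> U2" using xy sep sym by blast
        then show ?thesis
          using normal_forestD(4)[OF T1(1) _ _ xy(3)] normal_forestD(4)[OF T2(1) _ _ xy(3)] m1 m2 by blast
      qed
    qed
  qed
qed

text \<open>Depth-first search as a recursion: explore the component of a neighbour \<open>s\<close>
  after deleting \<open>r\<close>, then remove this component and continue from \<open>r\<close>.
  The first call loses \<open>r\<close>, the second at least \<open>s\<close>.\<close>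

lemma normal_tree_exists:
  assumes sym: "\<And>x y. F x y \<Longrightarrow> F y x" and irr: "\<And>x. \<not> F x x"
    and "finite W" "r \<in> W"
  shows "\<exists>U Tr dep. r \<in> U \<and> closed_in F W U \<and> normal_forest F U Tr dep \<and> (\<forall>x. (x, r) \<notin> Tr) \<and>
    dep r = 0 \<and> (\<forall>x\<in>U. x \<noteq> r \<longrightarrow> (r, x) \<in> Tr\<^sup>+)"
  using assms(3,4)
proof (induction "card W" arbitrary: W r rule: less_induct)
  case less
  show ?case
  proof (cases "\<exists>s\<in>W. F r s")
    case False
    then show ?thesis using less.prems irr
      by (intro exI[of _ "{r}"] exI[of _ "{}"] exI[of _ "\<lambda>_. 0"]) (auto simp: closed_in_def normal_forest_def)
  next
    case True
    then obtain s where s: "s \<in> W" "F r s" by blast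
    then have sr: "s \<noteq> r" using irr by auto
    have "card (W - {r}) < card W" using less.prems by (intro card_Diff1_less)
    then obtain U1 T1 d1 where 1: "s \<in> U1" "closed_in F (W - {r}) U1" "normal_forest F U1 T1 d1"
      "\<And>x. (x, s) \<notin> T1" "d1 s = 0" "\<And>x. x \<in> U1 \<Longrightarrow> x \<noteq> s \<Longrightarrow> (s, x) \<in> T1\<^sup>+"
      using less.hyps[of "W - {r}" s] less.prems s sr by auto
    have rU: "r \<notin> U1" "U1 \<subseteq> W" using 1(2) by (auto simp: closed_in_def)
    have "card (W - U1) < card W" using less.prems 1(1) s(1) by (intro psubset_card_mono) auto
    then obtain U2 T2 d2 where 2: "r \<in> U2" "closed_in F (W - U1) U2" "normal_forest F U2 T2 d2"
      "\<And>x. (x, r) \<notin> T2" "d2 r = 0" "\<And>x. x \<in> U2 \<Longrightarrow> x \<noteq> r \<Longrightarrow> (r, x) \<in> T2\<^sup>+"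
      using less.hyps[of "W - U1" r] less.prems rU by auto
    have disj: "U1 \<inter> U2 = {}" using 2(2) by (auto simp: closed_in_def)
    have sep: "\<not> F x y" if "x \<in> U1" "y \<in> U2" "y \<noteq> r" for x y
      using 1(2) 2(2) that unfolding closed_in_def by blast
    have cl: "closed_in F W (U1 \<union> U2)" using 1(2) 2 sym unfolding closed_in_def by blast
    note g = normal_tree_graft[OF sym irr 1(3,1,4,5,6) 2(3,1,4,5,6) disj s(2) sep]
    show ?thesis using g cl 2(1) by (intro exI[of _ "U1 \<union> U2"] exI conjI) blast+
  qed
qed

text \<open>A largest proper connected subset has an edge to some \<open>f\<close> outside, and
  adding \<open>f\<close> keeps it connected; by maximality \<open>f\<close> is all that it
  misses.\<close>

lemma noncut_vertex:
  assumes fin: "finite W" and conn: "\<And>K. closed_in F W K \<Longrightarrow> K = {} \<or> K = W" and two: "x \<in> W" "y \<in> W" "x \<noteq> y"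
    and sym: "\<And>x y. F x y \<Longrightarrow> F y x"
  shows "\<exists>f\<in>W. \<forall>K. closed_in F (W - {f}) K \<longrightarrow> K = {} \<or> K = W - {f}"
proof -
  let ?C = "\<lambda>C. C \<subset> W \<and> C \<noteq> {} \<and> (\<forall>K. closed_in F C K \<longrightarrow> K = {} \<or> K = C)"
  have "?C {x}" using two by (auto simp: closed_in_def)
  moreover have "\<forall>C. ?C C \<longrightarrow> card C < Suc (card W)" using fin by (auto intro!: le_imp_less_Suc card_mono)
  ultimately have "\<exists>C. ?C C \<and> (\<forall>C'. ?C C' \<longrightarrow> card C' \<le> card C)" by (rule ex_has_greatest_nat)
  then obtain C where C: "?C C" and max: "\<And>C'. ?C C' \<Longrightarrow> card C' \<le> card C" by blast
  have "\<not> closed_in F W C" using conn C by blast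
  then obtain u f where uf: "u \<in> C" "f \<in> W" "F u f" "f \<notin> C" using C by (auto simp: closed_in_def)
  have "W - {f} = C"
  proof (rule ccontr)
    assume neq: "W - {f} \<noteq> C"
    have K: "K = {} \<or> K = insert f C" if K: "closed_in F (insert f C) K" for K
    proof -
      have "closed_in F C (K \<inter> C)" using K by (auto simp: closed_in_def)
      then have "K \<inter> C = {} \<or> K \<inter> C = C" using C by blast
      then show ?thesis
      proof
        assume "K \<inter> C = {}"
        then have "f \<notin> K" using K uf(1,3) sym unfolding closed_in_def by blast
        then show ?thesis using K \<open>K \<inter> C = {}\<close> by (auto simp: closed_in_def)
      next
        assume KC: "K \<inter> C = C"
        then have "f \<in> K" using K uf(1,3) unfolding closed_in_def by blast
        then show ?thesis using K KC by (auto simp: closed_in_def)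
      qed
    qed
    have "?C (insert f C)" using C uf neq K by blast
    from max[OF this] show False using uf(4) finite_subset[OF _ fin, of C] C by auto
  qed
  then show ?thesis using uf(2) C by (intro bexI[of _ f]) auto
qed

lemma normal_forest_Un:
  assumes "normal_forest F U1 T1 d1" "normal_forest F U2 T2 d2" "U1 \<inter> U2 = {}"
    and sep: "\<And>x y. x \<in> U1 \<Longrightarrow> y \<in> U2 \<Longrightarrow> \<not> F x y \<and> \<not> F y x"
  shows "normal_forest F (U1 \<union> U2) (T1 \<union> T2) (\<lambda>x. if x \<in> U1 then d1 x else d2 x)"
  unfolding normal_forest_def
proof (intro conjI)
  note n1 = normal_forestD[OF assms(1)] and n2 = normal_forestD[OF assms(2)]
  have sub: "T1 \<subseteq> U1 \<times> U1" "T2 \<subseteq> U2 \<times> U2" using n1(1) n2(1) by auto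
  then show "T1 \<union> T2 \<subseteq> (U1 \<union> U2) \<times> (U1 \<union> U2)" by blast
  show "\<forall>(x, y)\<in>T1 \<union> T2. F x y \<and> (if y \<in> U1 then d1 y else d2 y) = Suc (if x \<in> U1 then d1 x else d2 x)"
  proof (intro ballI, clarify)
    fix x y assume "(x, y) \<in> T1 \<union> T2"
    then consider "(x, y) \<in> T1" "x \<in> U1" "y \<in> U1" | "(x, y) \<in> T2" "x \<notin> U1" "y \<notin> U1"
      using sub assms(3) by blast
    then show "F x y \<and> (if y \<in> U1 then d1 y else d2 y) = Suc (if x \<in> U1 then d1 x else d2 x)"
      by cases (use n1(2) n2(2) in auto)
  qed
  show "\<forall>x x' y. (x, y) \<in> T1 \<union> T2 \<longrightarrow> (x', y) \<in> T1 \<union> T2 \<longrightarrow> x = x'"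
  proof (intro allI impI)
    fix x x' y assume "(x, y) \<in> T1 \<union> T2" "(x', y) \<in> T1 \<union> T2"
    then have "(x, y) \<in> T1 \<and> (x', y) \<in> T1 \<or> (x, y) \<in> T2 \<and> (x', y) \<in> T2" using sub assms(3) by blast
    then show "x = x'" using n1(3) n2(3) by blast
  qed
  show "\<forall>x\<in>U1 \<union> U2. \<forall>y\<in>U1 \<union> U2. F x y \<longrightarrow> (x, y) \<in> (T1 \<union> T2)\<^sup>+ \<or> (y, x) \<in> (T1 \<union> T2)\<^sup>+"
  proof (intro ballI impI)
    fix x y assume xy: "x \<in> U1 \<union> U2" "y \<in> U1 \<union> U2" "F x y"
    then have "x \<in> U1 \<and> y \<in> U1 \<or> x \<in> U2 \<and> y \<in> U2" using sep by blast
    moreover have "T1\<^sup>+ \<subseteq> (T1 \<union> T2)\<^sup>+" "T2\<^sup>+ \<subseteq> (T1 \<union> T2)\<^sup>+" by (auto intro: trancl_mono)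
    ultimately show "(x, y) \<in> (T1 \<union> T2)\<^sup>+ \<or> (y, x) \<in> (T1 \<union> T2)\<^sup>+"
      using n1(4)[of x y] n2(4)[of x y] xy(3) by blast
  qed
qed

lemma closed_in_trans: "closed_in F W U \<Longrightarrow> closed_in F V W \<Longrightarrow> closed_in F V U"
  unfolding closed_in_def by blast

section \<open>Choice of the roots\<close>

text \<open>A root has no parent to serve as an in-neighbour that costs nothing. A missing
  neighbour, or a non-tree edge, which will be oriented towards the root, takes its place.\<close>

abbreviation slack :: "('v \<Rightarrow> 'v \<Rightarrow> bool) \<Rightarrow> nat \<Rightarrow> 'v set \<Rightarrow> ('v \<times> 'v) set \<Rightarrow> 'v \<Rightarrow> bool" where
  "slack F \<Delta> V Tr r \<equiv> card {y \<in> V. F r y} < \<Delta> \<or> (\<exists>y\<in>V. F r y \<and> (r, y) \<notin> Tr)"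

text \<open>A vertex of degree below \<Delta> is a suitable root. If there is none, a noncut vertex
  \<open>f\<close> is used: the rest is connected and forms a single subtree below one neighbour
  \<open>s\<close>, so a second neighbour \<open>y\<close> is joined to \<open>f\<close> by a
  non-tree edge.\<close>

lemma rooted_normal_tree_exists:
  assumes sym: "\<And>x y. F x y \<Longrightarrow> F y x" and irr: "\<And>x. \<not> F x x" and \<Delta>: "2 \<le> \<Delta>"
    and fin: "finite V" "W \<noteq> {}" and cl: "closed_in F V W"
    and conn: "\<And>K. closed_in F W K \<Longrightarrow> K = {} \<or> K = W"
  shows "\<exists>Tr dep. normal_forest F W Tr dep \<and>
    (\<forall>r\<in>W. (\<forall>x. (x, r) \<notin> Tr) \<longrightarrow> slack F \<Delta> V Tr r)"
proof (cases "\<exists>r\<in>W. card {y \<in> V. F r y} < \<Delta>")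
  case True
  have fW: "finite W" using cl fin finite_subset by (auto simp: closed_in_def)
  from True obtain r where r: "r \<in> W" "card {y \<in> V. F r y} < \<Delta>" by blast
  obtain U Tr dep where T: "r \<in> U" "closed_in F W U" "normal_forest F U Tr dep"
    "\<And>x. x \<in> U \<Longrightarrow> x \<noteq> r \<Longrightarrow> (r, x) \<in> Tr\<^sup>+"
    using normal_tree_exists[of F W r] sym irr fW r(1) by blast
  have "U = W" using conn[OF T(2)] T(1) by blast
  moreover have "x = r" if "x \<in> U" "\<forall>y. (y, x) \<notin> Tr" for x
    using T(4)[OF that(1)] that(2) tranclD2 by metis
  ultimately show ?thesis using T(3) r(2) by metis
next
  case False
  have fW: "finite W" using cl fin finite_subset by (auto simp: closed_in_def)
  have nbr: "\<exists>y\<in>W. F x y \<and> y \<noteq> z" if x: "x \<in> W" for x z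
  proof -
    have eq: "{y \<in> V. F x y} = {y \<in> W. F x y}" using cl x by (auto simp: closed_in_def)
    have "2 \<le> card {y \<in> W. F x y}" using False x \<Delta> eq by force
    then have "\<not> {y \<in> W. F x y} \<subseteq> {z}" using card_mono[of "{z}" "{y \<in> W. F x y}"] by auto
    then show ?thesis by blast
  qed
  obtain a where a: "a \<in> W" using fin by blast
  obtain b where b: "b \<in> W" "a \<noteq> b" using nbr[OF a] by metis
  obtain f where f: "f \<in> W" "\<forall>K. closed_in F (W - {f}) K \<longrightarrow> K = {} \<or> K = W - {f}"
    using noncut_vertex[of W F a b, OF fW conn a b sym] by (rule bexE)
  obtain s where s: "s \<in> W" "F f s" "s \<noteq> f" using nbr[OF f(1)] by blast
  obtain y where y: "y \<in> W" "F f y" "y \<noteq> s" using nbr[OF f(1)] by blast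
  have "finite (W - {f})" "s \<in> W - {f}" using fW s by auto
  from normal_tree_exists[of F "W - {f}" s, OF sym irr this]
  obtain U Tr dep where T: "s \<in> U" "closed_in F (W - {f}) U" "normal_forest F U Tr dep"
    "\<And>x. (x, s) \<notin> Tr" "dep s = 0" "\<And>x. x \<in> U \<Longrightarrow> x \<noteq> s \<Longrightarrow> (s, x) \<in> Tr\<^sup>+"
    by blast
  have U: "U = W - {f}" using f(2)[rule_format, OF T(2)] T(1) by blast
  have "normal_forest F {f} {} (\<lambda>_. 0)" using irr by (auto simp: normal_forest_def)
  note g = normal_tree_graft[where F = F, OF sym irr T(3,1,4,5,6) this _ _ _ _ _ s(2)]
  have W: "U \<union> {f} = W" using U f(1) by blast
  define Tr' where "Tr' = insert (f, s) (Tr \<union> {})"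
  have n: "normal_forest F (U \<union> {f}) Tr' (\<lambda>x. if x \<in> U then Suc (dep x) else 0)"
    unfolding Tr'_def by (rule g) (use U in auto)
  have top: "(f, x) \<in> Tr'\<^sup>+" if "x \<in> U \<union> {f}" "x \<noteq> f" for x
    unfolding Tr'_def by (rule g) (use U that in auto)
  have "x = f" if "x \<in> W" "\<forall>y. (y, x) \<notin> Tr'" for x using top[of x] that W tranclD2 by metis
  moreover have "(f, y) \<notin> Tr'" using normal_forestD(1)[OF T(3), of f y] U y(3) by (auto simp: Tr'_def)
  moreover have "y \<in> V" using y(1) cl by (auto simp: closed_in_def)
  ultimately show ?thesis using n y(2) unfolding W by blast
qed

lemma normal_forest_exists:
  assumes sym: "\<And>x y. F x y \<Longrightarrow> F y x" and irr: "\<And>x. \<not> F x x" and \<Delta>: "2 \<le> \<Delta>"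
    and fin: "finite V" and cl: "closed_in F V W"
  shows "\<exists>Tr dep. normal_forest F W Tr dep \<and>
    (\<forall>r\<in>W. (\<forall>x. (x, r) \<notin> Tr) \<longrightarrow> slack F \<Delta> V Tr r)"
  using cl
proof (induction "card W" arbitrary: W rule: less_induct)
  case less
  have fW: "finite W" using less.prems fin finite_subset by (auto simp: closed_in_def)
  show ?case
  proof (cases "W = {}")
    case True
    then show ?thesis by (auto simp: normal_forest_def)
  next
    case False
    \<comment> \<open>A nonempty closed set of least size is a connected component.\<close>
    let ?P = "\<lambda>K. closed_in F W K \<and> K \<noteq> {}"
    have "?P W" using False by (auto simp: closed_in_def)
    then obtain W0 where W0: "?P W0" and min: "\<And>K. ?P K \<Longrightarrow> card W0 \<le> card K"
      using ex_has_least_nat[of ?P W card] by metis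
    have sub: "W0 \<subseteq> W" "finite W0" using W0 fW finite_subset by (auto simp: closed_in_def)
    have clV: "closed_in F V W0" using W0 less.prems closed_in_trans by metis
    have conn: "K = {} \<or> K = W0" if K: "closed_in F W0 K" for K
    proof (cases "K = {}")
      case False
      then have "card W0 \<le> card K" using min K W0 closed_in_trans by metis
      then show ?thesis using K sub(2) card_seteq[of W0 K] by (auto simp: closed_in_def)
    qed simp
    obtain T0 d0 where 0: "normal_forest F W0 T0 d0"
      "\<forall>r\<in>W0. (\<forall>x. (x, r) \<notin> T0) \<longrightarrow> slack F \<Delta> V T0 r"
      using rooted_normal_tree_exists[of F \<Delta> V W0] sym irr \<Delta> fin W0 clV conn by blast
    have "card (W - W0) < card W" using W0 sub fW by (intro psubset_card_mono) auto
    moreover have "closed_in F V (W - W0)" using less.prems W0 sym unfolding closed_in_def by blast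
    ultimately obtain T1 d1 where 1: "normal_forest F (W - W0) T1 d1"
      "\<forall>r\<in>W - W0. (\<forall>x. (x, r) \<notin> T1) \<longrightarrow> slack F \<Delta> V T1 r"
      using less.hyps by blast
    have sep: "\<not> F x y \<and> \<not> F y x" if "x \<in> W0" "y \<in> W - W0" for x y
      using W0 that sym unfolding closed_in_def by blast
    have n: "normal_forest F (W0 \<union> (W - W0)) (T0 \<union> T1) (\<lambda>x. if x \<in> W0 then d0 x else d1 x)"
      by (rule normal_forest_Un[OF 0(1) 1(1) _ sep]) auto
    have W: "W0 \<union> (W - W0) = W" using sub by blast
    have "slack F \<Delta> V (T0 \<union> T1) r"
      if r: "r \<in> W" "\<forall>x. (x, r) \<notin> T0 \<union> T1" for r
    proof (cases "r \<in> W0")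
      case True
      then have "\<And>y. (r, y) \<notin> T1" using normal_forestD(1)[OF 1(1)] by blast
      then show ?thesis using 0(2) True r(2) by blast
    next
      case False
      then have "\<And>y. (r, y) \<notin> T0" using normal_forestD(1)[OF 0(1)] by blast
      then show ?thesis using 1(2) False r by blast
    qed
    then show ?thesis using n unfolding W by blast
  qed
qed

section \<open>Cutting the forest at few special vertices\<close>

text \<open>Invariant of the bottom-up choice of the special vertices \<open>S\<close>: \<open>W\<close> is the part treated so far,
  \<open>H\<close> the vertices with a special vertex at or below them, \<open>g x\<close> the top of the piece of \<open>x\<close>.
  \<open>S1\<close> are the special vertices that close a piece of size at least \<open>t\<close>, \<open>S2\<close> are roots.\<close>

definition cut_inv :: "nat \<Rightarrow> 'v set \<Rightarrow> ('v \<times> 'v) set \<Rightarrow> 'v set \<Rightarrow> 'v set \<Rightarrow> 'v set \<Rightarrow> ('v \<Rightarrow> 'v) \<Rightarrow> 'v set \<Rightarrow> 'v set \<Rightarrow> bool" where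
  "cut_inv t V Tr W S H g S1 S2 \<longleftrightarrow>
    S = S1 \<union> S2 \<and> S \<subseteq> H \<and> H \<subseteq> W \<and> (\<forall>v\<in>W. v \<in> H \<longleftrightarrow> v \<in> S \<or> (\<exists>c\<in>H. (v, c) \<in> Tr)) \<and>
    (\<forall>u v. (u, v) \<in> Tr \<longrightarrow> u \<in> W - S \<longrightarrow> v \<notin> S \<longrightarrow> g u = g v) \<and>
    (\<forall>x\<in>W - S. g x \<in> W - S \<and> (\<forall>u\<in>W. (u, g x) \<in> Tr \<longrightarrow> u \<in> S)) \<and>
    (\<forall>v\<in>W - S. (\<forall>u\<in>W. (u, v) \<in> Tr \<longrightarrow> u \<in> S) \<longrightarrow> g v = v) \<and>
    (\<forall>k. card {x \<in> W - S. g x = k} \<le> t) \<and>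
    (\<forall>v\<in>H. (\<forall>u. (u, v) \<notin> Tr) \<longrightarrow> v \<in> S) \<and>
    card S2 + card {x \<in> H. \<exists>u\<in>V - W. (u, x) \<in> Tr} \<le> card S1 \<and>
    t * card S1 + card {x \<in> W - S. \<forall>u\<in>W. (u, g x) \<notin> Tr} \<le> card W"

text \<open>Two potentials pay for the special vertices. Closing pieces that together with
  \<open>v\<close> have at least \<open>t\<close> vertices pays for a member of \<open>S1\<close>.
  It creates at most one vertex of \<open>H\<close> that waits for its parent, and a root put into
  \<open>S2\<close> uses up such a vertex, so \<open>S2\<close> is no larger than \<open>S1\<close>.
  A root above special vertices is made special because back edges into it may come from other
  clusters.\<close>

lemma cut_inv_step:
  assumes inv: "cut_inv t V Tr W S H g S1 S2" and t: "1 \<le> t"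
    and fin: "finite W" and v: "v \<in> V" "v \<notin> W"
    and par: "\<And>u. (u, v) \<in> Tr \<Longrightarrow> u \<in> V \<and> u \<notin> insert v W" and kids: "\<And>c. (v, c) \<in> Tr \<Longrightarrow> c \<in> W"
    and kidsW: "\<And>u c. u \<in> W \<Longrightarrow> (u, c) \<in> Tr \<Longrightarrow> c \<in> W"
    and uniq: "\<And>x x' y. (x, y) \<in> Tr \<Longrightarrow> (x', y) \<in> Tr \<Longrightarrow> x = x'"
  shows "\<exists>S H g S1 S2. cut_inv t V Tr (insert v W) S H g S1 S2"
proof -
  have S: "S = S1 \<union> S2" "S \<subseteq> H" "H \<subseteq> W" and H: "\<And>u. u \<in> W \<Longrightarrow> u \<in> H \<longleftrightarrow> u \<in> S \<or> (\<exists>c\<in>H. (u, c) \<in> Tr)"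
    and edge: "\<And>u w. (u, w) \<in> Tr \<Longrightarrow> u \<in> W - S \<Longrightarrow> w \<notin> S \<Longrightarrow> g u = g w"
    and gW: "\<And>x. x \<in> W - S \<Longrightarrow> g x \<in> W - S" and gtop: "\<And>x u. x \<in> W - S \<Longrightarrow> u \<in> W \<Longrightarrow> (u, g x) \<in> Tr \<Longrightarrow> u \<in> S"
    and top: "\<And>x. x \<in> W - S \<Longrightarrow> \<forall>u\<in>W. (u, x) \<in> Tr \<longrightarrow> u \<in> S \<Longrightarrow> g x = x"
    and size: "\<And>k. card {x \<in> W - S. g x = k} \<le> t"
    and root: "\<And>v. v \<in> H \<Longrightarrow> \<forall>u. (u, v) \<notin> Tr \<Longrightarrow> v \<in> S"
    and count: "card S2 + card {x \<in> H. \<exists>u\<in>V - W. (u, x) \<in> Tr} \<le> card S1"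
    and pot: "t * card S1 + card {x \<in> W - S. \<forall>u\<in>W. (u, g x) \<notin> Tr} \<le> card W"
    using inv unfolding cut_inv_def by blast+
  have finS: "finite S" "finite S1" "finite S2" "finite H"
    using S fin finite_subset by (metis Un_upper1 Un_upper2)+
  have vS: "v \<notin> S" "v \<notin> H" "v \<notin> S1" "v \<notin> S2" using S v by auto
  \<comment> \<open>The pieces that would be merged into one piece with top
    \<open>v\<close>.\<close>
  define R where "R = {x \<in> W - S. (v, g x) \<in> Tr}"
  define O' where "O' = {x \<in> W - S. \<forall>u\<in>W. (u, g x) \<notin> Tr}"
  define h where "h = {x \<in> H. \<exists>u\<in>V - W. (u, x) \<in> Tr}"
  have finR: "finite R" "finite O'" "finite h" using fin finS by (auto simp: R_def O'_def h_def)
  have RO: "R \<subseteq> O'" using uniq v(2) by (auto simp: R_def O'_def)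
  have nov: "(u, v) \<notin> Tr" if "u \<in> W" for u using par that by blast
  have vv: "(v, v) \<notin> Tr" using par by blast
  have cW: "card (insert v W) = Suc (card W)" using fin v by simp
  have countH: "card S2 + card h \<le> card S1" using count by (simp add: h_def)
  have potO: "t * card S1 + card O' \<le> card W" using pot by (simp add: O'_def)
  have Hnew: "u \<in> insert v H \<longleftrightarrow> u \<in> S \<or> (\<exists>c\<in>insert v H. (u, c) \<in> Tr)" if "u \<in> W" for u
    using H[OF that] nov that v by blast
  show ?thesis
  \<comment> \<open>Special are the vertices whose merged piece would reach size \<open>t\<close>,
    and the roots with a special vertex below.\<close>
  proof (cases "t \<le> card R + 1 \<or> (\<forall>u. (u, v) \<notin> Tr) \<and> (\<exists>c\<in>H. (v, c) \<in> Tr)")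
    case special: True
    let ?S = "insert v S"
    have basic1: "?S \<subseteq> insert v H" "insert v H \<subseteq> insert v W" using S by auto
    have basic2: "\<forall>u\<in>insert v W. u \<in> insert v H \<longleftrightarrow> u \<in> ?S \<or> (\<exists>c\<in>insert v H. (u, c) \<in> Tr)"
      using Hnew v by blast
    have basic3: "\<forall>u w. (u, w) \<in> Tr \<longrightarrow> u \<in> insert v W - ?S \<longrightarrow> w \<notin> ?S \<longrightarrow> g u = g w" using edge by blast
    have basic4: "\<forall>x\<in>insert v W - ?S. g x \<in> insert v W - ?S \<and> (\<forall>u\<in>insert v W. (u, g x) \<in> Tr \<longrightarrow> u \<in> ?S)"
      using gW gtop v by blast
    have basic5: "\<forall>x\<in>insert v W - ?S. (\<forall>u\<in>insert v W. (u, x) \<in> Tr \<longrightarrow> u \<in> ?S) \<longrightarrow> g x = x"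
      using top v by blast
    have "\<forall>x\<in>insert v H. (\<forall>u. (u, x) \<notin> Tr) \<longrightarrow> x \<in> ?S" using root by blast
    note basic = basic1 basic2 basic3 basic4 basic5 this
    have sz: "\<forall>k. card {x \<in> insert v W - ?S. g x = k} \<le> t"
    proof
      fix k
      have "{x \<in> insert v W - ?S. g x = k} \<subseteq> {x \<in> W - S. g x = k}" by auto
      then have "card {x \<in> insert v W - ?S. g x = k} \<le> card {x \<in> W - S. g x = k}"
        using fin by (intro card_mono) auto
      then show "card {x \<in> insert v W - ?S. g x = k} \<le> t" using size[of k] by linarith
    qed
    define h' where "h' = {x \<in> insert v H. \<exists>u\<in>V - insert v W. (u, x) \<in> Tr}"
    define O2 where "O2 = {x \<in> insert v W - ?S. \<forall>u\<in>insert v W. (u, g x) \<notin> Tr}"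
    have O2: "O2 \<subseteq> O' - R" by (auto simp: O2_def O'_def R_def)
    show ?thesis
    proof (cases "t \<le> card R + 1")
      case True
      have "h' \<subseteq> insert v h" by (auto simp: h'_def h_def)
      then have "card h' \<le> card (insert v h)" using finR by (intro card_mono) auto
      then have "card h' \<le> Suc (card h)" using card_insert_le_m1[of "Suc (card h)" h v] by simp
      then have c: "card S2 + card h' \<le> card (insert v S1)" using countH vS finS by simp
      have "card O2 \<le> card (O' - R)" using O2 finR by (intro card_mono) auto
      also have "\<dots> = card O' - card R" using RO finR by (intro card_Diff_subset) auto
      finally have "card O2 + card R \<le> card O'" using card_mono[OF finR(2) RO] by linarith
      then have p: "t * card (insert v S1) + card O2 \<le> card (insert v W)"
        using potO True vS finS cW by simp
      have "cut_inv t V Tr (insert v W) ?S (insert v H) g (insert v S1) S2"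
        unfolding cut_inv_def using c p unfolding h'_def O2_def
        by (intro conjI basic sz) (simp_all only: S(1) Un_insert_left Un_insert_right)
      then show ?thesis by blast
    next
      case False
      then have rt: "\<forall>u. (u, v) \<notin> Tr" and "\<exists>c\<in>H. (v, c) \<in> Tr" using special by auto
      then obtain c where c: "c \<in> H" "(v, c) \<in> Tr" by blast
      \<comment> \<open>The child \<open>c\<close> no longer waits once \<open>v\<close> is treated,
        and a root never waits: this pays for the new member of \<open>S2\<close>.\<close>
      have "c \<in> h" using c v by (auto simp: h_def)
      have "h' \<subseteq> h - {c}" using rt c uniq by (auto simp: h'_def h_def)
      then have "card h' \<le> card (h - {c})" using finR by (intro card_mono) auto
      also have "\<dots> < card h" using \<open>c \<in> h\<close> finR by (intro card_Diff1_less)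
      finally have c: "card (insert v S2) + card h' \<le> card S1" using countH vS finS by simp
      have "card O2 \<le> card O'" using O2 finR by (intro card_mono) auto
      then have p: "t * card S1 + card O2 \<le> card (insert v W)" using potO cW by simp
      have "cut_inv t V Tr (insert v W) ?S (insert v H) g S1 (insert v S2)"
        unfolding cut_inv_def using c p unfolding h'_def O2_def
        by (intro conjI basic sz) (simp_all only: S(1) Un_insert_left Un_insert_right)
      then show ?thesis by blast
    qed
  next
    case normal: False
    then have cR: "Suc (card R) \<le> t" and rk: "\<And>c. \<forall>u. (u, v) \<notin> Tr \<Longrightarrow> c \<in> H \<Longrightarrow> (v, c) \<notin> Tr" by auto
    define H' where "H' = (if \<exists>c\<in>H. (v, c) \<in> Tr then insert v H else H)"
    define g' where "g' x = (if x = v \<or> x \<in> R then v else g x)" for x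
    have gR: "x \<in> R \<longleftrightarrow> y \<in> R" if "g x = g y" "x \<in> W - S" "y \<in> W - S" for x y
      using that by (auto simp: R_def)
    have 1: "S \<subseteq> H'" "H' \<subseteq> insert v W" using S by (auto simp: H'_def)
    have 2: "\<forall>u\<in>insert v W. u \<in> H' \<longleftrightarrow> u \<in> S \<or> (\<exists>c\<in>H'. (u, c) \<in> Tr)"
    proof
      fix u assume "u \<in> insert v W"
      then show "u \<in> H' \<longleftrightarrow> u \<in> S \<or> (\<exists>c\<in>H'. (u, c) \<in> Tr)"
        using H[of u] nov[of u] vS vv v by (auto simp: H'_def)
    qed
    have 3: "\<forall>u w. (u, w) \<in> Tr \<longrightarrow> u \<in> insert v W - S \<longrightarrow> w \<notin> S \<longrightarrow> g' u = g' w"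
    proof (intro allI impI)
      fix u w assume uw: "(u, w) \<in> Tr" "u \<in> insert v W - S" "w \<notin> S"
      show "g' u = g' w"
      proof (cases "u = v")
        case True
        then have w: "w \<in> W - S" using kids uw by blast
        have "\<forall>x\<in>W. (x, w) \<in> Tr \<longrightarrow> x \<in> S" using uniq[OF uw(1)] True v by blast
        then have "g w = w" using top w by blast
        then have "w \<in> R" using w uw True by (auto simp: R_def)
        then show ?thesis using True by (simp add: g'_def)
      next
        case False
        then have u: "u \<in> W - S" using uw by blast
        then have w: "w \<in> W - S" using kidsW uw by blast
        have "g u = g w" using edge uw u by blast
        then show ?thesis using gR[OF _ u w] False w v by (auto simp: g'_def)
      qed
    qed
    have 4: "\<forall>x\<in>insert v W - S. g' x \<in> insert v W - S \<and> (\<forall>u\<in>insert v W. (u, g' x) \<in> Tr \<longrightarrow> u \<in> S)"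
    proof
      fix x assume x: "x \<in> insert v W - S"
      show "g' x \<in> insert v W - S \<and> (\<forall>u\<in>insert v W. (u, g' x) \<in> Tr \<longrightarrow> u \<in> S)"
      proof (cases "x = v \<or> x \<in> R")
        case True
        then show ?thesis using nov vv vS by (auto simp: g'_def)
      next
        case False
        then have "x \<in> W - S" "(v, g x) \<notin> Tr" using x by (auto simp: R_def)
        then show ?thesis using False gW[of x] gtop[of x] by (auto simp: g'_def)
      qed
    qed
    have 5: "\<forall>x\<in>insert v W - S. (\<forall>u\<in>insert v W. (u, x) \<in> Tr \<longrightarrow> u \<in> S) \<longrightarrow> g' x = x"
    proof (intro ballI impI)
      fix x assume x: "x \<in> insert v W - S" "\<forall>u\<in>insert v W. (u, x) \<in> Tr \<longrightarrow> u \<in> S"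
      show "g' x = x"
      proof (cases "x = v")
        case False
        then have "g x = x" using top x by blast
        moreover have "x \<notin> R" using calculation x(2) vS by (auto simp: R_def)
        ultimately show ?thesis using False by (simp add: g'_def)
      qed (simp add: g'_def)
    qed
    have 6: "\<forall>k. card {x \<in> insert v W - S. g' x = k} \<le> t"
    proof
      fix k
      show "card {x \<in> insert v W - S. g' x = k} \<le> t"
      proof (cases "k = v")
        case True
        have "{x \<in> insert v W - S. g' x = k} \<subseteq> insert v R"
          using True gW v by (auto simp: g'_def split: if_splits)
        then have "card {x \<in> insert v W - S. g' x = k} \<le> card (insert v R)"
          using finR by (intro card_mono) auto
        also have "\<dots> \<le> Suc (card R)" by (rule card_insert_le_m1) auto
        finally show ?thesis using cR by linarith
      next
        case False
        have "{x \<in> insert v W - S. g' x = k} \<subseteq> {x \<in> W - S. g x = k}"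
          using False by (auto simp: g'_def split: if_splits)
        then have "card {x \<in> insert v W - S. g' x = k} \<le> card {x \<in> W - S. g x = k}"
          using fin by (intro card_mono) auto
        then show ?thesis using size[of k] by linarith
      qed
    qed
    have 7: "\<forall>x\<in>H'. (\<forall>u. (u, x) \<notin> Tr) \<longrightarrow> x \<in> S" using root rk by (auto simp: H'_def)
    have 8: "card S2 + card {x \<in> H'. \<exists>u\<in>V - insert v W. (u, x) \<in> Tr} \<le> card S1"
    proof (cases "\<exists>c\<in>H. (v, c) \<in> Tr")
      case True
      then obtain c where c: "c \<in> H" "(v, c) \<in> Tr" by blast
      have ch: "c \<in> h" using c v by (auto simp: h_def)
      have "{x \<in> H'. \<exists>u\<in>V - insert v W. (u, x) \<in> Tr} \<subseteq> insert v (h - {c})"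
        using c uniq by (auto simp: h_def H'_def split: if_splits)
      then have "card {x \<in> H'. \<exists>u\<in>V - insert v W. (u, x) \<in> Tr} \<le> card (insert v (h - {c}))"
        using finR by (intro card_mono) auto
      also have "\<dots> \<le> Suc (card (h - {c}))" by (rule card_insert_le_m1) auto
      also have "\<dots> = card h" using ch finR by (intro card_Suc_Diff1) auto
      finally show ?thesis using countH by linarith
    next
      case False
      have "{x \<in> H'. \<exists>u\<in>V - insert v W. (u, x) \<in> Tr} \<subseteq> h" using False by (auto simp: h_def H'_def)
      then have "card {x \<in> H'. \<exists>u\<in>V - insert v W. (u, x) \<in> Tr} \<le> card h"
        using finR by (intro card_mono) auto
      then show ?thesis using countH by linarith
    qed
    have 9: "t * card S1 + card {x \<in> insert v W - S. \<forall>u\<in>insert v W. (u, g' x) \<notin> Tr} \<le> card (insert v W)"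
    proof -
      have "{x \<in> insert v W - S. \<forall>u\<in>insert v W. (u, g' x) \<notin> Tr} \<subseteq> insert v O'"
        using RO by (auto simp: O'_def g'_def split: if_splits)
      then have "card {x \<in> insert v W - S. \<forall>u\<in>insert v W. (u, g' x) \<notin> Tr} \<le> card (insert v O')"
        using finR by (intro card_mono) auto
      also have "\<dots> \<le> Suc (card O')" by (rule card_insert_le_m1) auto
      finally show ?thesis using potO cW by linarith
    qed
    have "cut_inv t V Tr (insert v W) S H' g' S1 S2"
      unfolding cut_inv_def using S(1) 1 2 3 4 5 6 7 8 9 by blast
    then show ?thesis by blast
  qed
qed

lemma cut_forest:
  assumes nf: "normal_forest F V Tr dep" and fin: "finite V" and t: "1 \<le> t"
  shows "\<exists>S H g S1 S2. cut_inv t V Tr V S H g S1 S2"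
proof -
  note n = normal_forestD[OF nf]
  have "\<exists>S H g S1 S2. cut_inv t V Tr W S H g S1 S2"
    if "W \<subseteq> V" "\<And>u c. u \<in> W \<Longrightarrow> (u, c) \<in> Tr \<Longrightarrow> c \<in> W" for W
    using finite_subset[OF that(1) fin] that
  proof (induction "card W" arbitrary: W)
    case 0
    then have "W = {}" by simp
    then show ?case by (auto simp: cut_inv_def intro!: exI[of _ "{}"])
  next
    case (Suc k)
    have "W \<noteq> {}" using Suc.hyps(2) by auto
    then have "Min (dep ` W) \<in> dep ` W" using Suc.prems(1) by (intro Min_in) auto
    then obtain v where v: "v \<in> W" "dep v = Min (dep ` W)" by auto
    have min: "dep v \<le> dep u" if "u \<in> W" for u using v(2) Suc.prems(1) that by simp
    have nopar: "u \<notin> W" if "(u, v) \<in> Tr" for u using n(2)[OF that] min[of u] by auto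
    let ?W = "W - {v}"
    have W: "insert v ?W = W" using v by blast
    have kids: "c \<in> ?W" if "u \<in> W" "(u, c) \<in> Tr" for u c using Suc.prems(3)[OF that] nopar that by blast
    have "\<exists>S H g S1 S2. cut_inv t V Tr ?W S H g S1 S2"
    proof (rule Suc.hyps(1))
      show "k = card ?W" using Suc.hyps(2) Suc.prems(1) v(1) by simp
      show "finite ?W" "?W \<subseteq> V" using Suc.prems by auto
      show "c \<in> ?W" if "u \<in> ?W" "(u, c) \<in> Tr" for u c using kids that by blast
    qed
    then obtain S H g S1 S2 where inv: "cut_inv t V Tr ?W S H g S1 S2" by (elim exE)
    have "\<exists>S H g S1 S2. cut_inv t V Tr (insert v ?W) S H g S1 S2"
    proof (rule cut_inv_step[OF inv t])
      show "finite ?W" "v \<in> V" "v \<notin> ?W" using Suc.prems v by auto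
      show "u \<in> V \<and> u \<notin> insert v ?W" if "(u, v) \<in> Tr" for u using nopar[OF that] n(1)[OF that] W by auto
      show "c \<in> ?W" if "(v, c) \<in> Tr" for c using kids that v by blast
      show "c \<in> ?W" if "u \<in> ?W" "(u, c) \<in> Tr" for u c using kids that by blast
      show "x = x'" if "(x, y) \<in> Tr" "(x', y) \<in> Tr" for x x' y using n(3) that by blast
    qed
    then show ?case unfolding W .
  qed
  then show ?thesis using n(1) by blast
qed

section \<open>Decomposition of a graph of bounded degree\<close>

text \<open>Greedy packing: an item goes into a bin of weight below \<open>t\<close>, or into a new
  bin if there is none. So at most one bin ever weighs less than \<open>t\<close>, which bounds
  their number.\<close>

lemma group_weights:
  fixes sz :: "'k \<Rightarrow> nat"
  assumes "finite K" "\<And>k. k \<in> K \<Longrightarrow> sz k \<le> t" "1 \<le> t"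
  shows "\<exists>f J. (\<forall>k\<in>K. f k < J) \<and> (\<forall>j. (\<Sum>k | k \<in> K \<and> f k = j. sz k) \<le> 2 * t) \<and> t * J \<le> sum sz K + t"
proof -
  let ?s = "\<lambda>K (f :: 'k \<Rightarrow> nat) j. \<Sum>k | k \<in> K \<and> f k = j. sz k"
  let ?Q = "\<lambda>K f J. (\<forall>k\<in>K. f k < J) \<and> (\<forall>j. ?s K f j \<le> 2 * t) \<and>
      (\<forall>i<J. \<forall>j<J. i \<noteq> j \<longrightarrow> ?s K f i < t \<longrightarrow> t \<le> ?s K f j)"
  have "\<exists>f J. ?Q K f J" using assms(1,2)
  proof (induction K rule: finite_induct)
    case empty
    show ?case by (rule exI, rule exI[of _ 0]) simp
  next
    case (insert k K)
    have "\<exists>f J. ?Q K f J" by (rule insert.IH) (use insert.prems in blast)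
    then obtain f J where "?Q K f J" by (elim exE)
    then have f: "\<And>k. k \<in> K \<Longrightarrow> f k < J" "\<And>j. ?s K f j \<le> 2 * t"
      "\<And>i j. i < J \<Longrightarrow> j < J \<Longrightarrow> i \<noteq> j \<Longrightarrow> ?s K f i < t \<Longrightarrow> t \<le> ?s K f j"
      by simp_all
    have upd: "?s (insert k K) (f(k := i)) j = ?s K f j + (if j = i then sz k else 0)" for i j
    proof -
      have "{x. x \<in> insert k K \<and> (f(k := i)) x = j} = {x. x \<in> K \<and> f x = j} \<union> (if j = i then {k} else {})"
        using insert.hyps(2) by auto
      then show ?thesis using insert.hyps by (simp add: sum.union_disjoint)
    qed
    have szk: "sz k \<le> t" using insert.prems by blast
    show ?case
    proof (cases "\<exists>i<J. ?s K f i < t")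
      case True
      then obtain i where i: "i < J" "?s K f i < t" by blast
      have "?s (insert k K) (f(k := i)) j \<le> 2 * t" for j unfolding upd using f(2)[of j] i(2) szk by auto
      moreover have "t \<le> ?s (insert k K) (f(k := i)) b"
        if "a < J" "b < J" "a \<noteq> b" "?s (insert k K) (f(k := i)) a < t" for a b
        using that f(3)[of a b] unfolding upd by linarith
      ultimately show ?thesis using f(1) i(1) by (intro exI[of _ "f(k := i)"] exI[of _ J]) auto
    next
      case False
      have new: "?s K f J = 0" using f(1) by (intro sum.neutral) fastforce
      have "?s (insert k K) (f(k := J)) j \<le> 2 * t" for j unfolding upd using f(2)[of j] new szk by auto
      moreover have "t \<le> ?s (insert k K) (f(k := J)) b"
        if "a < Suc J" "b < Suc J" "a \<noteq> b" "?s (insert k K) (f(k := J)) a < t" for a b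
      proof -
        have "\<not> a < J"
        proof
          assume "a < J"
          then have "t \<le> ?s K f a" using False by (meson not_less)
          then show False using that(4) unfolding upd by linarith
        qed
        then have "b < J" using that by linarith
        then have "t \<le> ?s K f b" using False by (meson not_less)
        then show ?thesis unfolding upd by linarith
      qed
      ultimately show ?thesis
        using f(1) by (intro exI[of _ "f(k := J)"] exI[of _ "Suc J"]) (auto simp: less_SucI)
    qed
  qed
  then obtain f J where "?Q K f J" by (elim exE)
  then have f: "\<And>k. k \<in> K \<Longrightarrow> f k < J" "\<And>j. ?s K f j \<le> 2 * t"
    "\<And>i j. i < J \<Longrightarrow> j < J \<Longrightarrow> i \<noteq> j \<Longrightarrow> ?s K f i < t \<Longrightarrow> t \<le> ?s K f j"
    by simp_all
  have total: "(\<Sum>j<J. ?s K f j) = sum sz K" using sum.group[of K "{..<J}" f sz] assms(1) f(1) by auto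
  have "t * J \<le> sum sz K + t"
  proof (cases "\<exists>i<J. ?s K f i < t")
    case True
    then obtain i where i: "i < J" "?s K f i < t" by blast
    have "(\<Sum>j\<in>{..<J} - {i}. t) \<le> (\<Sum>j\<in>{..<J} - {i}. ?s K f j)"
      using f(3)[OF i(1) _ _ i(2)] by (intro sum_mono) auto
    also have "\<dots> \<le> (\<Sum>j<J. ?s K f j)" by (intro sum_mono2) auto
    finally have "t * (J - 1) \<le> sum sz K" using i(1) total by (simp add: mult.commute)
    then show ?thesis using i(1) by (cases J) auto
  next
    case False
    have "(\<Sum>j<J. t) \<le> (\<Sum>j<J. ?s K f j)"
    proof (rule sum_mono)
      fix j assume "j \<in> {..<J}"
      then show "t \<le> ?s K f j" using False by (meson lessThan_iff not_less)
    qed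
    then show ?thesis using total by (simp add: mult.commute)
  qed
  then show ?thesis using f(1,2) by blast
qed

text \<open>\<open>S\<close> are the few special vertices, \<open>A\<close> the others with a special vertex below them in the tree and
  \<open>B\<close> the rest; vertices outside \<open>S\<close> have a cluster \<open>q v\<close>. \<open>D\<close> orients the edges; \<open>host v\<close> is an out-neighbour whose identity
  determines that of \<open>v\<close> up to a bounded choice. The budgets say that \<open>\<Delta>\<close> numbers suffice:
  in-neighbours in the own cluster or in \<open>S\<close> cost nothing.\<close>

locale scheme =
  fixes V :: "'v set" and F :: "'v \<Rightarrow> 'v \<Rightarrow> bool" and \<Delta> t M :: nat and S A B :: "'v set"
    and D :: "'v \<Rightarrow> 'v \<Rightarrow> bool" and q :: "'v \<Rightarrow> nat" and host :: "'v \<Rightarrow> 'v option" and rank :: "'v \<Rightarrow> nat"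
    and Tarc :: "'v \<Rightarrow> 'v \<Rightarrow> bool"
  assumes fin: "finite V" and part: "V = S \<union> A \<union> B" "S \<inter> A = {}" "S \<inter> B = {}" "A \<inter> B = {}"
    and F_iff: "u \<in> V \<Longrightarrow> v \<in> V \<Longrightarrow> F u v \<longleftrightarrow> D u v \<or> D v u"
    and D_V: "D u v \<Longrightarrow> u \<in> V \<and> v \<in> V \<and> u \<noteq> v"
    and D_out: "card {v. D u v} \<le> \<Delta>" and D_in: "card {v. D v u} \<le> \<Delta>"
    and card_S: "card S \<le> 2 * t" and card_q: "card {v \<in> A \<union> B. q v = k} \<le> 2 * t"
    and q_less: "v \<in> A \<union> B \<Longrightarrow> q v < M"
    and Tarc: "Tarc s v \<Longrightarrow> s \<in> S \<and> v \<in> A \<union> B \<and> D s v"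
    and Tarc_uniq: "Tarc s v \<Longrightarrow> Tarc s' v' \<Longrightarrow> q v = q v' \<Longrightarrow> v = v'"
    and S_to_B: "s \<in> S \<Longrightarrow> v \<in> B \<Longrightarrow> D s v \<Longrightarrow> Tarc s v"
    and to_B: "v \<in> B \<Longrightarrow> D u v \<Longrightarrow> u \<notin> S \<Longrightarrow> q u = q v"
    and host: "host v = Some w \<Longrightarrow> D v w \<and> v \<notin> S \<and> rank w < rank v"
    and host_A: "v \<in> A \<Longrightarrow> \<exists>w. host v = Some w \<and> w \<in> A \<union> S \<and> (w \<in> A \<longrightarrow> q w = q v)"
    and host_A_uniq: "v \<in> A \<Longrightarrow> v' \<in> A \<Longrightarrow> host v = Some w \<Longrightarrow> host v' = Some w \<Longrightarrow> v = v'"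
    and host_B: "v \<in> B \<Longrightarrow> host v = Some w \<Longrightarrow> w \<in> B \<Longrightarrow> q w = q v"
    and budget_S: "v \<in> S \<Longrightarrow> card {w. D v w} + 1 \<le> \<Delta>"
    and budget: "v \<in> A \<union> B \<Longrightarrow>
      card {w. D v w} + card {u. D u v \<and> u \<notin> S \<and> q u \<noteq> q v} + (if host v = None then 2 else 1) \<le> \<Delta>"

text \<open>A piece whose top is a child of a special vertex becomes a cluster of its own, so that
  the cluster names the child; the other pieces are packed. No special vertex lies below a vertex of
  \<open>B\<close>, so its descendants share its cluster and back edges from them are free. A vertex
  of \<open>A\<close> is hosted by a child towards a special vertex, one of \<open>B\<close> by any
  child, and a leaf of full degree by an ancestor. If this ancestor lies in \<open>B\<close>, it
  belongs to \<open>RB\<close> and gets no host, which prevents cycles; it can afford this, as both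
  its parent and the leaf are free in-neighbours.\<close>

lemma scheme_exists:
  fixes V :: "'v set"
  assumes fin: "finite V" and sym: "\<And>x y. F x y \<Longrightarrow> F y x" and irr: "\<And>x. \<not> F x x"
    and FV: "\<And>x y. F x y \<Longrightarrow> x \<in> V \<and> y \<in> V" and deg: "\<And>v. v \<in> V \<Longrightarrow> card {y \<in> V. F v y} \<le> \<Delta>"
    and \<Delta>: "3 \<le> \<Delta>" and t: "1 \<le> t" "card V \<le> t * t"
  shows "\<exists>S A B D q host rank Tarc. scheme V F \<Delta> t (2 * \<Delta> * t + (t + 1)) S A B D q host rank Tarc"
proof -
  have two: "2 \<le> \<Delta>" using \<Delta> by simp
  have cl: "closed_in F V V" by (auto simp: closed_in_def)
  have NV: "{y \<in> V. F v y} = {y. F v y}" for v using FV by auto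
  have finN: "finite {y. F v y}" for v by (rule finite_subset[OF _ fin]) (use FV in auto)
  have degN: "card {y. F v y} \<le> \<Delta>" for v
  proof (cases "v \<in> V")
    case False
    then have "{y. F v y} = {}" using FV by auto
    then show ?thesis by (simp only: card.empty le0)
  qed (use deg[of v] NV in simp)
  obtain Tr dep where nf: "normal_forest F V Tr dep"
    and roots0: "\<forall>r\<in>V. (\<forall>x. (x, r) \<notin> Tr) \<longrightarrow> slack F \<Delta> V Tr r"
    using normal_forest_exists[of F \<Delta> V V, OF sym irr two fin cl] by blast
  note n = normal_forestD[OF nf]
  have depm: "dep x < dep y" if "(x, y) \<in> Tr\<^sup>+" for x y
    using that by (induction rule: trancl_induct) (use n(2) in fastforce)+
  obtain S H g S1 S2 where cut: "cut_inv t V Tr V S H g S1 S2" using cut_forest[OF nf fin t(1)] by blast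
  have S: "S = S1 \<union> S2" "S \<subseteq> H" "H \<subseteq> V" and H: "\<And>u. u \<in> V \<Longrightarrow> u \<in> H \<longleftrightarrow> u \<in> S \<or> (\<exists>c\<in>H. (u, c) \<in> Tr)"
    and edge: "\<And>u w. (u, w) \<in> Tr \<Longrightarrow> u \<in> V - S \<Longrightarrow> w \<notin> S \<Longrightarrow> g u = g w"
    and gW: "\<And>x. x \<in> V - S \<Longrightarrow> g x \<in> V - S"
    and top: "\<And>x. x \<in> V - S \<Longrightarrow> \<forall>u\<in>V. (u, x) \<in> Tr \<longrightarrow> u \<in> S \<Longrightarrow> g x = x"
    and size: "\<And>k. card {x \<in> V - S. g x = k} \<le> t"
    and root: "\<And>v. v \<in> H \<Longrightarrow> \<forall>u. (u, v) \<notin> Tr \<Longrightarrow> v \<in> S"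
    and count0: "card S2 + card {x \<in> H. \<exists>u\<in>V - V. (u, x) \<in> Tr} \<le> card S1"
    and pot0: "t * card S1 + card {x \<in> V - S. \<forall>u\<in>V. (u, g x) \<notin> Tr} \<le> card V"
    using cut unfolding cut_inv_def by blast+
  have count: "card S2 \<le> card S1" and pot: "t * card S1 \<le> card V" using count0 pot0 by linarith+
  have finS: "finite S" using S(2,3) fin by (meson finite_subset order_trans)
  have cS: "card S \<le> 2 * t"
  proof -
    have "t * card S1 \<le> t * t" using pot t(2) by linarith
    then have "card S1 \<le> t" using t(1) by simp
    then show ?thesis using count card_Un_le[of S1 S2] S(1) by simp
  qed
  define A where "A = H - S"
  define B where "B = V - H"
  have AB: "A \<union> B = V - S" using S(2,3) by (auto simp: A_def B_def)
  have kidB: "c \<in> B \<and> g c = g v" if "v \<in> B" "(v, c) \<in> Tr" for v c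
  proof -
    have v: "v \<in> V" "c \<in> V" "v \<notin> H" using that n(1) by (auto simp: B_def)
    then have "c \<notin> H" using H that(2) by blast
    moreover have "v \<notin> S" "c \<notin> S" using v calculation S(2) by blast+
    ultimately show ?thesis using edge[OF that(2)] v by (simp add: B_def)
  qed
  have downB: "u \<in> B \<and> g u = g v" if "(v, u) \<in> Tr\<^sup>+" "v \<in> B" for u v
    using that(1) by (induction rule: trancl_induct) (use kidB that(2) in metis)+
  define K1 where "K1 = {v \<in> V - S. \<exists>u\<in>S. (u, v) \<in> Tr}"
  have finK1: "finite K1" using fin by (simp add: K1_def)
  have cK1: "card K1 \<le> 2 * \<Delta> * t"
  proof -
    have "K1 \<subseteq> (\<Union>u\<in>S. {y. F u y})" using n(2) by (auto simp: K1_def)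
    then have "card K1 \<le> card (\<Union>u\<in>S. {y. F u y})" using finS finN by (intro card_mono finite_UN_I) auto
    also have "\<dots> \<le> (\<Sum>u\<in>S. card {y. F u y})" by (rule card_UN_le[OF finS])
    also have "\<dots> \<le> (\<Sum>u\<in>S. \<Delta>)" by (intro sum_mono degN)
    also have "\<dots> \<le> 2 * t * \<Delta>" using cS by simp
    finally show ?thesis by (simp add: mult_ac)
  qed
  obtain idx :: "'v \<Rightarrow> nat" where idx: "inj_on idx K1" "\<And>k. k \<in> K1 \<Longrightarrow> idx k < card K1"
  proof -
    obtain f :: "'v \<Rightarrow> nat" and k where "f ` K1 = {i. i < k}" "inj_on f K1"
      using finite_imp_inj_to_nat_seg[OF finK1] by blast
    moreover from this have "k = card K1" using card_image[of f K1] by simp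
    ultimately show ?thesis using that[of f] by blast
  qed
  define K2 where "K2 = (V - S) - K1"
  define sz where "sz k = card {x \<in> V - S. g x = k}" for k
  have "finite K2" using fin by (simp add: K2_def)
  then obtain grp J where grp: "\<And>k. k \<in> K2 \<Longrightarrow> grp k < J" "\<And>j. (\<Sum>k | k \<in> K2 \<and> grp k = j. sz k) \<le> 2 * t"
    "t * J \<le> sum sz K2 + t"
    using group_weights[of K2 sz t] size t(1) unfolding sz_def by blast
  have "sum sz K2 \<le> card V"
  proof -
    have "sum sz K2 = card (\<Union>k\<in>K2. {x \<in> V - S. g x = k})"
      unfolding sz_def using fin \<open>finite K2\<close> by (intro card_UN_disjoint[symmetric]) auto
    also have "\<dots> \<le> card V" using fin by (intro card_mono) auto
    finally show ?thesis .
  qed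
  then have "t * J \<le> t * (t + 1)" using grp(3) t(2) by (simp add: algebra_simps)
  then have J: "J \<le> t + 1" using t(1) by (metis mult_le_cancel1 not_one_le_zero neq0_conv)
  \<comment> \<open>Numbers below \<open>2 * \<Delta> * t\<close> are reserved for pieces hanging at
    special vertices, at most \<Delta> at each; the at most \<open>t + 1\<close> packed groups
    follow.\<close>
  define q where "q x = (if g x \<in> K1 then idx (g x) else 2 * \<Delta> * t + grp (g x))" for x
  have qg: "g x = g y \<Longrightarrow> q x = q y" for x y by (simp add: q_def)
  have idxM: "k \<in> K1 \<Longrightarrow> idx k < 2 * \<Delta> * t" for k using idx(2)[of k] cK1 by linarith
  have qless: "q v < 2 * \<Delta> * t + (t + 1)" if "v \<in> V - S" for v
  proof (cases "g v \<in> K1")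
    case True
    then show ?thesis using idxM[OF True] by (simp add: q_def)
  next
    case False
    then have "g v \<in> K2" using gW[OF that] by (simp add: K2_def)
    then show ?thesis using grp(1) J False by (fastforce simp: q_def)
  qed
  have cq: "card {v \<in> V - S. q v = k} \<le> 2 * t" for k
  proof (cases "k < 2 * \<Delta> * t")
    case True
    show ?thesis
    proof (cases "{v \<in> V - S. q v = k} = {}")
      case False
      then obtain w where w: "w \<in> V - S" "q w = k" by blast
      have gw: "g w \<in> K1" using w(2) True by (auto simp: q_def split: if_splits)
      have "g v = g w" if "v \<in> V - S" "q v = k" for v
      proof -
        have "g v \<in> K1" using that(2) True by (auto simp: q_def split: if_splits)
        then show ?thesis using that w gw idx(1) by (auto simp: q_def dest: inj_onD)
      qed
      then have "{v \<in> V - S. q v = k} \<subseteq> {x \<in> V - S. g x = g w}" by blast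
      then have "card {v \<in> V - S. q v = k} \<le> card {x \<in> V - S. g x = g w}"
        using fin by (intro card_mono) auto
      then show ?thesis using size[of "g w"] by linarith
    next
      case True
      then show ?thesis by (simp only: card.empty le0)
    qed
  next
    case False
    let ?K = "{k'. k' \<in> K2 \<and> grp k' = k - 2 * \<Delta> * t}"
    have "{v \<in> V - S. q v = k} \<subseteq> (\<Union>k'\<in>?K. {x \<in> V - S. g x = k'})"
    proof
      fix v assume v: "v \<in> {v \<in> V - S. q v = k}"
      have "g v \<notin> K1" using v idxM False by (auto simp: q_def)
      then have "g v \<in> ?K" using v gW[of v] by (auto simp: q_def K2_def)
      then show "v \<in> (\<Union>k'\<in>?K. {x \<in> V - S. g x = k'})" using v by blast
    qed
    then have "card {v \<in> V - S. q v = k} \<le> card (\<Union>k'\<in>?K. {x \<in> V - S. g x = k'})"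
      using fin \<open>finite K2\<close> by (intro card_mono) auto
    also have "\<dots> \<le> (\<Sum>k'\<in>?K. sz k')" unfolding sz_def using \<open>finite K2\<close> by (intro card_UN_le) auto
    also have "\<dots> \<le> 2 * t" by (rule grp(2))
    finally show ?thesis .
  qed
  define D where "D u v \<longleftrightarrow> (u, v) \<in> Tr \<or> F u v \<and> (v, u) \<in> Tr\<^sup>+ \<and> (v, u) \<notin> Tr" for u v
  have DF: "F u v" if "D u v" for u v using that n(2) by (auto simp: D_def)
  have Danti: "\<not> D v u" if "D u v" for u v
  proof
    assume "D v u"
    have "\<not> ((u, v) \<in> Tr\<^sup>+ \<and> (v, u) \<in> Tr\<^sup>+)" using depm by (meson less_asym)
    then show False using that \<open>D v u\<close> r_into_trancl unfolding D_def by blast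
  qed
  have FD: "D u v \<or> D v u" if "F u v" for u v
    using n(4)[of u v] FV[OF that] that sym[OF that] by (auto simp: D_def)
  \<comment> \<open>Out-neighbours, charged in-neighbours \<open>C\<close> and free in-neighbours
    \<open>X\<close> are disjoint because \<open>D\<close> is antisymmetric; every free one saves a
    number.\<close>
  have bud: "card {w. D v w} + card C + card X \<le> card {y. F v y}"
    if "X \<subseteq> {u. D u v}" "C \<subseteq> {u. D u v}" "X \<inter> C = {}" for v X C
  proof -
    have "X \<subseteq> {y. F v y}" "C \<subseteq> {y. F v y}" "{w. D v w} \<subseteq> {y. F v y}" using that DF sym by blast+
    moreover from this have f: "finite X" "finite C" "finite {w. D v w}" using finN finite_subset by blast+
    ultimately have "card ({w. D v w} \<union> (C \<union> X)) \<le> card {y. F v y}" using finN by (intro card_mono) auto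
    moreover have "card ({w. D v w} \<union> (C \<union> X)) = card {w. D v w} + card (C \<union> X)"
      using f that Danti by (intro card_Un_disjoint) auto
    moreover have "card (C \<union> X) = card C + card X" using f that by (intro card_Un_disjoint) auto
    ultimately show ?thesis by linarith
  qed
  let ?C = "\<lambda>v. {u. D u v \<and> u \<notin> S \<and> q u \<noteq> q v}"
  have parent_free: "D u v \<and> u \<notin> ?C v" if "(u, v) \<in> Tr" "v \<in> V - S" for u v
  proof -
    have "q u = q v" if "u \<notin> S"
      using edge[OF \<open>(u, v) \<in> Tr\<close>] n(1)[OF \<open>(u, v) \<in> Tr\<close>] \<open>v \<in> V - S\<close> that by (intro qg) blast
    then show ?thesis using that(1) by (auto simp: D_def)
  qed
  have rootback: "D y r" if "r \<in> V" "\<forall>x. (x, r) \<notin> Tr" "F r y" "(r, y) \<notin> Tr" for r y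
  proof -
    have "(y, r) \<notin> Tr\<^sup>+" using that(2) tranclD2 by metis
    then have "(r, y) \<in> Tr\<^sup>+" using n(4)[of r y] FV that by blast
    then show ?thesis using that(4) sym[OF that(3)] by (simp add: D_def)
  qed
  define leaf where "leaf v \<longleftrightarrow> v \<in> B \<and> (\<forall>c. (v, c) \<notin> Tr) \<and> card {y. F v y} = \<Delta>" for v
  define yf where "yf v = (SOME y. F v y \<and> (y, v) \<notin> Tr \<and> (\<exists>u. (u, y) \<in> Tr))" for v
  have chain: "y = y' \<or> (y, y') \<in> Tr\<^sup>+ \<or> (y', y) \<in> Tr\<^sup>+" if "(y, v) \<in> Tr\<^sup>+" "(y', v) \<in> Tr\<^sup>+" for y y' v
    using that
  proof (induction rule: trancl_induct)
    case (base z)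
    show ?case using base(2)
    proof (cases rule: tranclE)
      case base': base
      then show ?thesis using n(3)[OF base(1)] by blast
    next
      case (step c)
      then show ?thesis using n(3)[OF base(1)] by blast
    qed
  next
    case (step w z)
    note IH = step.IH
    show ?case using step.prems
    proof (cases rule: tranclE)
      case base
      then have "y' = w" using n(3)[OF step.hyps(2)] by blast
      then show ?thesis using step.hyps(1) by blast
    next
      case (step c)
      then have "(y', w) \<in> Tr\<^sup>+" using n(3)[OF \<open>(w, z) \<in> Tr\<close>] by blast
      then show ?thesis by (rule IH)
    qed
  qed
  have anc_root: "y = y'" if "(y, v) \<in> Tr\<^sup>+" "(y', v) \<in> Tr\<^sup>+" "\<forall>x. (x, y) \<notin> Tr" "\<forall>x. (x, y') \<notin> Tr" for y y' v
    using chain[OF that(1,2)] that(3,4) tranclD2 by metis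
  have leafup: "(y, v) \<in> Tr\<^sup>+" if "leaf v" "F v y" for v y
  proof -
    have "(v, y) \<notin> Tr\<^sup>+" using that(1) tranclD unfolding leaf_def by metis
    then show ?thesis using n(4)[of v y] FV[OF that(2)] that(2) by blast
  qed
  \<comment> \<open>All neighbours of a leaf are ancestors. At most one is the parent and, ancestors
    forming a chain, at most one is a root; by \<Delta> \<ge> 3 another one remains.\<close>
  have yf: "F v (yf v) \<and> (yf v, v) \<notin> Tr \<and> (\<exists>u. (u, yf v) \<in> Tr)" if v: "leaf v" for v
  proof -
    have "\<exists>y. F v y \<and> (y, v) \<notin> Tr \<and> (\<exists>u. (u, y) \<in> Tr)"
    proof (rule ccontr)
      assume neg: "\<not> ?thesis"
      let ?X = "{y. F v y \<and> (y, v) \<in> Tr}" and ?Y = "{y. F v y \<and> (\<forall>u. (u, y) \<notin> Tr)}"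
      have "{y. F v y} \<subseteq> ?X \<union> ?Y" using neg by blast
      moreover have fXY: "finite ?X" "finite ?Y" using finN[of v] by simp_all
      ultimately have "card {y. F v y} \<le> card ?X + card ?Y"
        using card_mono[of "?X \<union> ?Y" "{y. F v y}"] card_Un_le[of ?X ?Y] by simp
      moreover have "card ?X \<le> 1" using n(3) fXY by (intro card_le_Suc0_iff_eq[THEN iffD2, simplified One_nat_def[symmetric]]) auto
      moreover have "card ?Y \<le> 1"
        using anc_root leafup[OF v] fXY by (intro card_le_Suc0_iff_eq[THEN iffD2, simplified One_nat_def[symmetric]]) auto
      ultimately show False using v \<Delta> by (simp add: leaf_def)
    qed
    then show ?thesis unfolding yf_def by (rule someI_ex)
  qed
  define RB where "RB = {y \<in> B. \<exists>f. leaf f \<and> yf f = y}"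
  define host where "host v = (if v \<in> A then Some (SOME c. c \<in> H \<and> (v, c) \<in> Tr)
     else if v \<in> B - RB then (if \<exists>c. (v, c) \<in> Tr then Some (SOME c. (v, c) \<in> Tr)
       else if leaf v then Some (yf v) else None) else None)" for v
  define Mx where "Mx = Max (dep ` V)"
  have depMx: "v \<in> V \<Longrightarrow> dep v \<le> Mx" for v using fin by (simp add: Mx_def)
  \<comment> \<open>Host chains descend the tree, so depth is reversed. All of \<open>A\<close>
    ranks below the hosted part of \<open>B\<close>, since a leaf of \<open>B\<close> may be hosted
    by an ancestor in \<open>A\<close>; \<open>S\<close> and \<open>RB\<close> end every
    chain.\<close>
  define rank where "rank v = (if v \<in> S \<or> v \<in> RB then 0 else if v \<in> A then 1 + (Mx - dep v) else 2 + Mx + (Mx - dep v))" for v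
  have hostA: "\<exists>c. host v = Some c \<and> c \<in> H \<and> (v, c) \<in> Tr" if "v \<in> A" for v
  proof -
    have "\<exists>c. c \<in> H \<and> (v, c) \<in> Tr" using that H[of v] S by (auto simp: A_def)
    then have "(SOME c. c \<in> H \<and> (v, c) \<in> Tr) \<in> H \<and> (v, SOME c. c \<in> H \<and> (v, c) \<in> Tr) \<in> Tr"
      by (rule someI_ex)
    then show ?thesis using that by (simp add: host_def)
  qed
  have hostB: "v \<in> B - RB \<and> (((v, w) \<in> Tr) \<or> leaf v \<and> w = yf v)" if "v \<notin> A" "host v = Some w" for v w
  proof -
    have "v \<in> B - RB" using that by (auto simp: host_def split: if_splits)
    moreover have "(v, SOME c. (v, c) \<in> Tr) \<in> Tr" if "\<exists>c. (v, c) \<in> Tr" using that by (rule someI_ex)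
    ultimately show ?thesis using that by (auto simp: host_def split: if_splits)
  qed
  have ABd: "A \<inter> B = {}" "S \<inter> A = {}" "S \<inter> B = {}" "V = S \<union> A \<union> B" "RB \<subseteq> B"
    using S by (auto simp: A_def B_def RB_def)
  have yfup: "(yf v, v) \<in> Tr\<^sup>+ \<and> D v (yf v)" if "leaf v" for v
    using leafup[OF that] yf[OF that] by (auto simp: D_def)
  have "scheme V F \<Delta> t (2 * \<Delta> * t + (t + 1)) S A B D q host rank (\<lambda>s v. s \<in> S \<and> v \<notin> S \<and> (s, v) \<in> Tr)"
  proof
    show "finite V" "V = S \<union> A \<union> B" "S \<inter> A = {}" "S \<inter> B = {}" "A \<inter> B = {}" using fin ABd by auto
    show "F u v \<longleftrightarrow> D u v \<or> D v u" for u v using FD DF sym by blast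
    show "u \<in> V \<and> v \<in> V \<and> u \<noteq> v" if "D u v" for u v using DF[OF that] FV irr by metis
    show "card {v. D u v} \<le> \<Delta>" for u using bud[of "{}" u "{}"] degN[of u] by simp
    show "card {v. D v u} \<le> \<Delta>" for u using bud[of "{v. D v u}" u "{}"] degN[of u] by simp
    show "card S \<le> 2 * t" by (rule cS)
    show "card {v \<in> A \<union> B. q v = k} \<le> 2 * t" for k using cq[of k] unfolding AB .
    show "q v < 2 * \<Delta> * t + (t + 1)" if "v \<in> A \<union> B" for v using qless that unfolding AB .
    show "s \<in> S \<and> v \<in> A \<union> B \<and> D s v" if "s \<in> S \<and> v \<notin> S \<and> (s, v) \<in> Tr" for s v
      using that n(1)[of s v] unfolding AB by (auto simp: D_def)
    show "v = v'" if "s \<in> S \<and> v \<notin> S \<and> (s, v) \<in> Tr" "s' \<in> S \<and> v' \<notin> S \<and> (s', v') \<in> Tr" "q v = q v'" for s s' v v'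
    proof -
      have "x \<in> K1 \<and> g x = x" if "s \<in> S \<and> x \<notin> S \<and> (s, x) \<in> Tr" for s x
        using that n(1)[of s x] n(3)[of s x] top[of x] by (auto simp: K1_def)
      then have "v \<in> K1" "g v = v" "v' \<in> K1" "g v' = v'" using that(1,2) by blast+
      then show ?thesis using that(3) idx(1) by (auto simp: q_def dest: inj_onD)
    qed
    \<comment> \<open>A back arc from \<open>s\<close> to \<open>v\<close> would put a special
      vertex below a vertex of \<open>B\<close>.\<close>
    show "s \<in> S \<and> v \<notin> S \<and> (s, v) \<in> Tr" if "s \<in> S" "v \<in> B" "D s v" for s v
    proof -
      have "(v, s) \<notin> Tr\<^sup>+" using downB[of v s] that ABd by blast
      then show ?thesis using that ABd by (auto simp: D_def)
    qed
    show "q u = q v" if "v \<in> B" "D u v" "u \<notin> S" for u v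
    proof (cases "(u, v) \<in> Tr")
      case True
      then show ?thesis using edge[OF True] that n(1)[OF True] qg ABd by blast
    next
      case False
      then have "(v, u) \<in> Tr\<^sup>+" using that by (simp add: D_def)
      then show ?thesis using downB that(1) qg by metis
    qed
    show "D v w \<and> v \<notin> S \<and> rank w < rank v" if h: "host v = Some w" for v w
    proof (cases "v \<in> A")
      case True
      then have w: "w \<in> H" "(v, w) \<in> Tr" using hostA h by fastforce+
      have "w \<in> S \<or> w \<in> A \<and> w \<notin> RB" using w(1) ABd by (auto simp: A_def)
      then have "rank w < rank v"
        using True ABd n(2)[OF w(2)] depMx[of w] n(1)[OF w(2)] by (auto simp: rank_def)
      then show ?thesis using w True by (auto simp: D_def A_def)
    next
      case False
      then have v: "v \<in> B - RB" "(v, w) \<in> Tr \<or> leaf v \<and> w = yf v" using hostB h by blast+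
      have rv: "rank v = 2 + Mx + (Mx - dep v)" using v ABd by (auto simp: rank_def)
      from v(2) show ?thesis
      proof
        assume vw: "(v, w) \<in> Tr"
        then have "w \<in> B" using downB v(1) by blast
        then have "rank w < rank v"
          using rv ABd n(2)[OF vw] depMx[of w] n(1)[OF vw] by (auto simp: rank_def)
        then show ?thesis using vw v ABd by (auto simp: D_def)
      next
        assume l: "leaf v \<and> w = yf v"
        have "w \<in> V" using yf l FV by blast
        then have "w \<in> S \<or> w \<in> RB \<or> w \<in> A \<and> w \<notin> RB" using ABd l by (auto simp: RB_def)
        then have "rank w < rank v" using rv by (auto simp: rank_def)
        then show ?thesis using l yfup v ABd by blast
      qed
    qed
    show "\<exists>w. host v = Some w \<and> w \<in> A \<union> S \<and> (w \<in> A \<longrightarrow> q w = q v)" if "v \<in> A" for v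
    proof -
      obtain c where c: "host v = Some c" "c \<in> H" "(v, c) \<in> Tr" using hostA[OF \<open>v \<in> A\<close>] by blast
      have "q c = q v" if "c \<in> A"
      proof -
        have "v \<in> V - S" "c \<notin> S" using \<open>v \<in> A\<close> that n(1)[OF c(3)] by (auto simp: A_def)
        then have "g c = g v" using edge[OF c(3)] by simp
        then show ?thesis by (rule qg)
      qed
      then show ?thesis using c by (auto simp: A_def)
    qed
    show "v = v'" if "v \<in> A" "v' \<in> A" "host v = Some w" "host v' = Some w" for v v' w
      using hostA[OF that(1)] hostA[OF that(2)] that(3,4) n(3) by auto
    show "q w = q v" if "v \<in> B" "host v = Some w" "w \<in> B" for v w
    proof -
      have "(v, w) \<in> Tr \<or> leaf v \<and> w = yf v" using hostB that ABd by blast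
      then have "(v, w) \<in> Tr\<^sup>+ \<or> (w, v) \<in> Tr\<^sup>+" using yfup by blast
      then show ?thesis using downB that(1,3) qg by metis
    qed
    show "card {w. D v w} + 1 \<le> \<Delta>" if v: "v \<in> S" for v
    proof -
      have vV: "v \<in> V" using v ABd by blast
      have *: "card {w. D v w} + 1 \<le> \<Delta>" if "D u v" for u
        using bud[of "{u}" v "{}"] that degN[of v] by simp
      show ?thesis
      proof (cases "\<exists>u. (u, v) \<in> Tr")
        case True
        then show ?thesis using * by (auto simp: D_def)
      next
        case False
        then have "card {y. F v y} < \<Delta> \<or> (\<exists>y\<in>V. F v y \<and> (v, y) \<notin> Tr)"
          using roots0 vV unfolding NV by blast
        then show ?thesis
        proof
          assume "card {y. F v y} < \<Delta>"
          then show ?thesis using bud[of "{}" v "{}"] by simp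
        next
          assume "\<exists>y\<in>V. F v y \<and> (v, y) \<notin> Tr"
          then show ?thesis using * rootback[OF vV] False by blast
        qed
      qed
    qed
    show "card {w. D v w} + card (?C v) + (if host v = None then 2 else 1) \<le> \<Delta>" if v: "v \<in> A \<union> B" for v
    proof -
      have vV: "v \<in> V - S" using v unfolding AB .
      have C: "?C v \<subseteq> {u. D u v}" by blast
      have one: "card {w. D v w} + card (?C v) + 1 \<le> card {y. F v y}" if "D u v" "u \<notin> ?C v" for u
        using bud[of "{u}" v "?C v"] C that by auto
      have zero: "card {w. D v w} + card (?C v) \<le> card {y. F v y}" using bud[of "{}" v "?C v"] C by auto
      show ?thesis
      \<comment> \<open>Only vertices of \<open>B\<close> can lack a host. Those in
        \<open>RB\<close> have two free in-neighbours; the others are childless and, not being a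
        \<open>leaf\<close>, of degree below \<Delta>.\<close>
      proof (cases "host v = None")
        case True
        then have vB: "v \<in> B" using v hostA[of v] by auto
        show ?thesis
        proof (cases "v \<in> RB")
          case True
          then obtain f where f: "leaf f" "yf f = v" by (auto simp: RB_def)
          obtain u where u: "(u, v) \<in> Tr" using yf[OF f(1)] f(2) by blast
          have vf: "(v, f) \<in> Tr\<^sup>+" "D f v" using yfup[OF f(1)] f(2) by auto
          have "f \<notin> ?C v" using downB[OF vf(1) vB] qg by blast
          moreover have "f \<noteq> u" using depm[OF vf(1)] n(2)[OF u] by auto
          ultimately have "card {w. D v w} + card (?C v) + card {u, f} \<le> card {y. F v y}"
            using bud[of "{u, f}" v "?C v"] C parent_free[OF u vV] vf(2) by auto
          then show ?thesis using \<open>f \<noteq> u\<close> \<open>host v = None\<close> degN[of v] by simp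
        next
          case False
          then have nok: "\<forall>c. (v, c) \<notin> Tr" "\<not> leaf v"
            using \<open>host v = None\<close> vB ABd by (auto simp: host_def split: if_splits)
          then have dl: "card {y. F v y} < \<Delta>" using degN[of v] vB by (fastforce simp: leaf_def)
          show ?thesis
          proof (cases "\<exists>u. (u, v) \<in> Tr")
            case True
            then show ?thesis using one parent_free vV dl \<open>host v = None\<close> by fastforce
          next
            case False
            have "\<not> F v y" for y
            proof
              assume "F v y"
              then have "(v, y) \<in> Tr\<^sup>+ \<or> (y, v) \<in> Tr\<^sup>+" using n(4) FV by blast
              then show False using False nok(1) tranclD tranclD2 by metis
            qed
            then have "card {y. F v y} = 0" by simp
            then show ?thesis using zero \<Delta> \<open>host v = None\<close> by simp
          qed
        qed
      next
        case False
        have "card {w. D v w} + card (?C v) + 1 \<le> \<Delta>"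
        proof (cases "\<exists>u. (u, v) \<in> Tr")
          case True
          then show ?thesis using one parent_free vV degN[of v] by fastforce
        next
          case noparent: False
          have vB: "v \<in> B" using v root[of v] noparent by (auto simp: A_def)
          have "card {y. F v y} < \<Delta> \<or> (\<exists>y\<in>V. F v y \<and> (v, y) \<notin> Tr)"
            using roots0 vV noparent unfolding NV by blast
          then show ?thesis
          proof
            assume "\<exists>y\<in>V. F v y \<and> (v, y) \<notin> Tr"
            then obtain y where y: "F v y" "(v, y) \<notin> Tr" by blast
            have Dy: "D y v" using rootback y noparent vV by blast
            then have "(v, y) \<in> Tr\<^sup>+" using noparent by (auto simp: D_def)
            then have "y \<notin> ?C v" using downB vB qg by blast
            then show ?thesis using one[OF Dy] degN[of v] by linarith
          qed (use zero in linarith)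
        qed
        then show ?thesis unfolding if_not_P[OF False] .
      qed
    qed
  qed
  then show ?thesis by blast
qed

section \<open>Positions of the vertices\<close>

context scheme begin

definition key :: "'v \<Rightarrow> nat option" where
  "key u = (if u \<in> S then None else Some (q u))"

text \<open>Positions must tell apart the out-neighbours in \<open>A\<close> of all vertices with
  key \<open>k\<close>. The vertices of \<open>A\<close> with key \<open>k\<close> are added to make
  the labelling injective.\<close>

definition layer :: "nat option \<Rightarrow> 'v set" where
  "layer k = {w \<in> A. key w = k \<or> (\<exists>u. D u w \<and> key u = k)}"

definition conf :: "'v \<Rightarrow> 'v \<Rightarrow> bool" where
  "conf v w \<longleftrightarrow> v \<in> S \<and> w \<in> S \<or> (\<exists>k. v \<in> layer k \<and> w \<in> layer k)"

lemma finite_parts: "finite S" "finite A" "finite B" "finite (layer k)" "finite {w. D v w}" "finite {w. D w v}"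
proof -
  show "finite S" "finite A" "finite B" using fin part(1) by auto
  then show "finite (layer k)" by (simp add: layer_def)
  show "finite {w. D v w}" "finite {w. D w v}" by (rule finite_subset[OF _ fin]; use D_V in blast)+
qed

lemma card_key: "card {u \<in> V. key u = k} \<le> 2 * t"
proof (cases k)
  case None
  then have "{u \<in> V. key u = k} = S" using part(1) by (auto simp: key_def)
  then show ?thesis using card_S by simp
next
  case (Some j)
  then have "{u \<in> V. key u = k} = {v \<in> A \<union> B. q v = j}" using part by (auto simp: key_def)
  then show ?thesis using card_q[of j] by simp
qed

lemma card_layer: "card (layer k) \<le> 2 * t * (\<Delta> + 1)"
proof -
  let ?U = "{u \<in> V. key u = k}"
  have fU: "finite ?U" using fin by simp
  have "layer k \<subseteq> ?U \<union> (\<Union>u\<in>?U. {w. D u w})" using part(1) D_V by (auto simp: layer_def)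
  then have "card (layer k) \<le> card (?U \<union> (\<Union>u\<in>?U. {w. D u w}))"
    using fU finite_parts(5) by (intro card_mono) auto
  also have "\<dots> \<le> card ?U + card (\<Union>u\<in>?U. {w. D u w})" by (rule card_Un_le)
  also have "card (\<Union>u\<in>?U. {w. D u w}) \<le> (\<Sum>u\<in>?U. card {w. D u w})" by (rule card_UN_le[OF fU])
  also have "\<dots> \<le> (\<Sum>u\<in>?U. \<Delta>)" by (intro sum_mono D_out)
  also have "card ?U + (\<Sum>u\<in>?U. \<Delta>) = card ?U * (\<Delta> + 1)" by simp
  also have "\<dots> \<le> 2 * t * (\<Delta> + 1)" by (intro mult_le_mono1 card_key)
  finally show ?thesis by simp
qed

text \<open>Outside \<open>S\<close>, a vertex can only lie in the layers of its own key and of the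
  keys of its at most \<Delta> in-neighbours.\<close>

lemma card_conf: "card {v \<in> A \<union> S. conf w v} \<le> 2 * t * (\<Delta> + 1) * (\<Delta> + 1)"
proof (cases "w \<in> S")
  case True
  then have "{v \<in> A \<union> S. conf w v} \<subseteq> S" using part by (auto simp: conf_def layer_def)
  then have "card {v \<in> A \<union> S. conf w v} \<le> card S" using finite_parts(1) by (intro card_mono)
  also have "\<dots> \<le> 2 * t * 1 * 1" using card_S by simp
  also have "\<dots> \<le> 2 * t * (\<Delta> + 1) * (\<Delta> + 1)" by (intro mult_le_mono order_refl) auto
  finally show ?thesis .
next
  case False
  let ?K = "insert (key w) (key ` {u. D u w})"
  have fK: "finite ?K" using finite_parts(6) by simp
  have "{v \<in> A \<union> S. conf w v} \<subseteq> (\<Union>k\<in>?K. layer k)" using False by (auto simp: conf_def layer_def)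
  then have "card {v \<in> A \<union> S. conf w v} \<le> card (\<Union>k\<in>?K. layer k)"
    using fK finite_parts(4) by (intro card_mono finite_UN_I)
  also have "\<dots> \<le> (\<Sum>k\<in>?K. card (layer k))" by (rule card_UN_le[OF fK])
  also have "\<dots> \<le> (\<Sum>k\<in>?K. 2 * t * (\<Delta> + 1))" by (intro sum_mono card_layer)
  also have "\<dots> = 2 * t * (\<Delta> + 1) * card ?K" by simp
  also have "\<dots> \<le> 2 * t * (\<Delta> + 1) * (\<Delta> + 1)"
  proof (rule mult_le_mono2)
    have "card ?K \<le> Suc (card (key ` {u. D u w}))" by (rule card_insert_le_m1) auto
    also have "card (key ` {u. D u w}) \<le> card {u. D u w}" using finite_parts(6) by (rule card_image_le)
    also have "\<dots> \<le> \<Delta>" by (rule D_in)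
    finally show "card ?K \<le> \<Delta> + 1" by simp
  qed
  finally show ?thesis .
qed

lemma card_host: "card {w \<in> X. host w = Some h} \<le> \<Delta>"
proof -
  have "{w \<in> X. host w = Some h} \<subseteq> {w. D w h}" using host by blast
  then have "card {w \<in> X. host w = Some h} \<le> card {w. D w h}" using finite_parts(6) by (intro card_mono)
  also have "\<dots> \<le> \<Delta>" by (rule D_in)
  finally show ?thesis .
qed

definition up :: "('v \<times> 'v) set" where
  "up = {(v, w). v \<in> A \<and> host v = Some w}"

text \<open>Hosts of distinct vertices of \<open>A\<close> are distinct, so host chains never merge
  and a branch is a path ending in \<open>s\<close>. These paths are the batches for the embedding
  of \<open>A\<close> and \<open>S\<close>.\<close>

definition branch :: "'v \<Rightarrow> 'v set" where
  "branch s = {v \<in> A \<union> S. (v, s) \<in> up\<^sup>*}"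

lemma up_S: "(s, v) \<in> up\<^sup>* \<Longrightarrow> s \<in> S \<Longrightarrow> v = s"
  using part by (auto simp: up_def elim: converse_rtranclE)

lemma branch_covers: "(\<Union>s\<in>S. branch s) = A \<union> S"
proof -
  have "\<exists>s\<in>S. (v, s) \<in> up\<^sup>*" if "v \<in> A \<union> S" for v using that
  proof (induction "rank v" arbitrary: v rule: less_induct)
    case less
    show ?case
    proof (cases "v \<in> S")
      case False
      then have "v \<in> A" using less.prems by blast
      then obtain w where w: "host v = Some w" "w \<in> A \<union> S" using host_A by blast
      then obtain s where "s \<in> S" "(w, s) \<in> up\<^sup>*" using less.hyps host by blast
      moreover have "(v, w) \<in> up" using w \<open>v \<in> A\<close> by (simp add: up_def)
      ultimately show ?thesis by (meson converse_rtrancl_into_rtrancl)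
    qed blast
  qed
  then show ?thesis by (auto simp: branch_def)
qed

lemma branch_disjoint: "s \<in> S \<Longrightarrow> s' \<in> S \<Longrightarrow> s \<noteq> s' \<Longrightarrow> branch s \<inter> branch s' = {}"
proof -
  have "s = s'" if "(v, s) \<in> up\<^sup>*" "(v, s') \<in> up\<^sup>*" "s \<in> S" "s' \<in> S" for v using that(1,2)
  proof (induction rule: converse_rtrancl_induct)
    case base
    then show ?case using up_S that by blast
  next
    case (step v w)
    have "v \<noteq> s'" using step(1) that(4) part by (auto simp: up_def)
    then obtain w' where "(v, w') \<in> up" "(w', s') \<in> up\<^sup>*" using step.prems by (meson converse_rtranclE)
    moreover have "w' = w" using step(1) \<open>(v, w') \<in> up\<close> unfolding up_def by auto
    ultimately show ?case using step.IH by blast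
  qed
  then show "s \<in> S \<Longrightarrow> s' \<in> S \<Longrightarrow> s \<noteq> s' \<Longrightarrow> branch s \<inter> branch s' = {}" by (auto simp: branch_def)
qed

text \<open>At most one vertex of \<open>A\<close> is hosted by \<open>s\<close>, and the cluster is
  constant along the chain leading to it, so apart from \<open>s\<close> the branch lies in a single
  cluster.\<close>

lemma card_branch:
  assumes s: "s \<in> S"
  shows "card (branch s) \<le> 2 * t + 1"
proof -
  have *: "v = s \<or> v \<in> A \<and> (\<exists>a\<in>A. host a = Some s \<and> q v = q a)" if "(v, s) \<in> up\<^sup>*" for v using that
  proof (induction rule: converse_rtrancl_induct)
    case (step v w)
    then have v: "v \<in> A" "host v = Some w" by (auto simp: up_def)
    show ?case
    proof (cases "w = s")
      case False
      then have w: "w \<in> A" "\<exists>a\<in>A. host a = Some s \<and> q w = q a" using step.IH by auto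
      then have "q w = q v" using host_A[OF v(1)] v(2) by auto
      then show ?thesis using v w by auto
    qed (use v in blast)
  qed simp
  have "\<exists>k. branch s \<subseteq> insert s {v \<in> A \<union> B. q v = k}"
  proof (cases "\<exists>a\<in>A. host a = Some s")
    case True
    then obtain a where a: "a \<in> A" "host a = Some s" by blast
    have "q v = q a" if "v \<in> branch s" "v \<noteq> s" for v
      using * that a host_A_uniq unfolding branch_def by blast
    moreover have "v \<in> A" if "v \<in> branch s" "v \<noteq> s" for v using * that unfolding branch_def by blast
    ultimately show ?thesis by blast
  next
    case False
    then have "branch s \<subseteq> {s}" using * unfolding branch_def by blast
    then show ?thesis by blast
  qed
  then obtain k where "branch s \<subseteq> insert s {v \<in> A \<union> B. q v = k}" by blast
  then have "card (branch s) \<le> card (insert s {v \<in> A \<union> B. q v = k})"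
    using finite_parts by (intro card_mono) auto
  also have "\<dots> \<le> Suc (card {v \<in> A \<union> B. q v = k})" by (rule card_insert_le_m1) auto
  finally show ?thesis using card_q[of k] by simp
qed

text \<open>\<open>A\<close> and \<open>S\<close> are placed first, respecting \<open>conf\<close>.
  Then the clusters of \<open>B\<close> are independent of each other: hosts lie in the same cluster
  or are already placed, and positions in \<open>B\<close> are compared only within a
  cluster.\<close>

lemma positions_exist:
  assumes "expander m d Dd \<sigma> Nb" and ld: "d \<le> Dd + 3" and Dd: "3 * \<Delta> + 1 < Dd"
    and \<sigma>: "2 * t * (\<Delta> + 1) * (\<Delta> + 1) \<le> \<sigma>" and m: "3 * \<sigma> + d * \<sigma> < m" and \<Delta>: "1 \<le> \<Delta>" and t: "1 \<le> t"
  obtains p where "\<And>v. v \<in> V \<Longrightarrow> p v < m" "\<And>v w. host v = Some w \<Longrightarrow> v \<in> V \<Longrightarrow> p v \<in> Nb (p w)"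
    "inj_on p S" "\<And>k. inj_on p (layer k)" "\<And>k. inj_on p {v \<in> B. q v = k}"
proof -
  interpret expander m d Dd \<sigma> Nb by fact
  have "4 * t \<le> 2 * t * (\<Delta> + 1) * 1"
    using mult_le_mono2[of 2 "\<Delta> + 1" "2 * t"] \<Delta> by (simp only: mult_1_right) linarith
  also have "\<dots> \<le> 2 * t * (\<Delta> + 1) * (\<Delta> + 1)" by (intro mult_le_mono order_refl) auto
  finally have \<sigma>t: "4 * t \<le> \<sigma>" using \<sigma> by linarith
  obtain p1 where p1: "\<And>w. w \<in> A \<union> S \<Longrightarrow> p1 w < m"
    "\<And>w h. w \<in> A \<union> S \<Longrightarrow> host w = Some h \<Longrightarrow> p1 w \<in> Nb (p1 h)"
    "\<And>v w. v \<in> A \<union> S \<Longrightarrow> w \<in> A \<union> S \<Longrightarrow> v \<noteq> w \<Longrightarrow> conf v w \<Longrightarrow> p1 v \<noteq> p1 w"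
  proof (rule embed_batches[of S \<Delta> branch host rank conf, unfolded branch_covers])
    show "finite S" "finite (branch s)" for s using finite_parts by (auto simp: branch_def)
    show "card (branch s) \<le> \<sigma>" if "s \<in> S" for s using card_branch[OF that] \<sigma>t t by linarith
    show "h \<in> branch s \<and> rank h < rank w" if "s \<in> S" "w \<in> branch s" "host w = Some h" for s w h
    proof -
      have w: "w \<in> A" using host[OF that(3)] that(2) by (auto simp: branch_def)
      then have h: "h \<in> A \<union> S" using host_A that(3) by fastforce
      have "w \<noteq> s" using w that(1) part by blast
      then obtain h' where "(w, h') \<in> up" "(h', s) \<in> up\<^sup>*"
        using \<open>w \<in> branch s\<close> unfolding branch_def by (auto elim: converse_rtranclE)
      then have "(h, s) \<in> up\<^sup>*" using that(3) by (simp add: up_def)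
      then show ?thesis using h host[OF that(3)] by (simp add: branch_def)
    qed
    show "conf w v" if "conf v w" for v w using that by (auto simp: conf_def)
    show "card {v \<in> A \<union> S. conf w v} \<le> \<sigma>" for w using card_conf[of w] \<sigma> by linarith
  qed (use ld Dd \<Delta> m branch_disjoint card_host in auto)
  have injS: "inj_on p1 S" using p1(3) by (intro inj_onI) (auto simp: conf_def)
  have injL: "inj_on p1 (layer k)" for k using p1(3) by (intro inj_onI) (auto simp: conf_def layer_def)
  have ex: "\<exists>p. (\<forall>v. v \<notin> {v \<in> B. q v = k} \<longrightarrow> p v = p1 v) \<and> inj_on p {v \<in> B. q v = k} \<and>
      (\<forall>w\<in>{v \<in> B. q v = k}. p w < m \<and> (\<forall>h. host w = Some h \<longrightarrow> p w \<in> Nb (p h)))" for k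
  proof -
    let ?B = "{v \<in> B. q v = k}"
    have hostAS: "h \<in> A \<union> S" if "w \<in> ?B" "host w = Some h" "h \<notin> ?B" for w h
      using that host[OF that(2)] host_B[of w h] D_V part(1) by auto
    obtain p where "\<And>v. v \<notin> ?B \<Longrightarrow> p v = p1 v" "inj_on p ?B" "\<And>w. w \<in> ?B \<Longrightarrow> p w < m"
      "\<And>w. w \<in> ?B \<Longrightarrow> p w \<notin> {}" "\<And>w h. w \<in> ?B \<Longrightarrow> host w = Some h \<Longrightarrow> p w \<in> Nb (p h)"
    proof (rule embed_forest[of ?B host rank p1 \<Delta> "2 * \<Delta>" "\<lambda>_. {}" 0])
      show "finite ?B" using finite_parts by simp
      have "card ?B \<le> card {v \<in> A \<union> B. q v = k}" using finite_parts by (intro card_mono) auto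
      then show "card ?B \<le> \<sigma>" using card_q[of k] \<sigma>t by linarith
      show "rank h < rank w" if "host w = Some h" for w h using host[OF that] by blast
      show "p1 h < m" if "w \<in> ?B" "host w = Some h" "h \<notin> ?B" for w h
        using hostAS[OF that] p1(1) by blast
      \<comment> \<open>An outside host lies in \<open>S\<close> or in
        \<open>layer (Some k)\<close>. On each of them \<open>p1\<close> is injective, so at most
        two hosts share the position \<open>x\<close>, each with at most \<Delta>
        in-neighbours.\<close>
      show "card {w \<in> ?B. \<exists>h. host w = Some h \<and> h \<notin> ?B \<and> p1 h = x} \<le> 2 * \<Delta>" for x
      proof -
        let ?Y = "{h \<in> layer (Some k). p1 h = x}" and ?Z = "{h \<in> S. p1 h = x}"
          and ?T = "{w \<in> ?B. \<exists>h. host w = Some h \<and> h \<notin> ?B \<and> p1 h = x}"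
        have fYZ: "finite ?Y" "finite ?Z" using finite_parts by simp_all
        have sub: "?T \<subseteq> (\<Union>h\<in>?Y \<union> ?Z. {w. D w h})"
        proof
          fix w assume "w \<in> ?T"
          then obtain h where w: "w \<in> ?B" "host w = Some h" "h \<notin> ?B" "p1 h = x" by blast
          have "key w = Some k" using w(1) part by (auto simp: key_def)
          moreover have "D w h" using host[OF w(2)] by blast
          ultimately have "h \<in> layer (Some k) \<or> h \<in> S" using hostAS[OF w(1-3)] by (auto simp: layer_def)
          then show "w \<in> (\<Union>h\<in>?Y \<union> ?Z. {w. D w h})" using \<open>D w h\<close> w(4) by blast
        qed
        have "card ?T \<le> card (\<Union>h\<in>?Y \<union> ?Z. {w. D w h})"
          using sub fYZ finite_parts(6) by (intro card_mono) auto
        also have "\<dots> \<le> (\<Sum>h\<in>?Y \<union> ?Z. card {w. D w h})" using fYZ by (intro card_UN_le) auto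
        also have "\<dots> \<le> (\<Sum>h\<in>?Y \<union> ?Z. \<Delta>)" by (intro sum_mono D_in)
        also have "\<dots> = card (?Y \<union> ?Z) * \<Delta>" by simp
        also have "card (?Y \<union> ?Z) \<le> 2"
        proof -
          have "card ?Y \<le> Suc 0" "card ?Z \<le> Suc 0"
            using fYZ injL[of "Some k"] injS by (auto simp: card_le_Suc0_iff_eq dest: inj_onD)
          then show ?thesis using card_Un_le[of ?Y ?Z] by linarith
        qed
        finally show ?thesis by simp
      qed
      show "card {} + \<sigma> + d * \<sigma> < m" using m by simp
      show "0 + \<Delta> + 2 * \<Delta> < Dd" using Dd by simp
      show "card {w \<in> ?B. host w = Some h} \<le> \<Delta>" for h by (rule card_host)
    qed auto
    then show ?thesis by (intro exI[of _ p]) blast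
  qed
  from choice[OF allI[OF ex]] obtain p2 where Q: "\<forall>k. (\<forall>v. v \<notin> {v \<in> B. q v = k} \<longrightarrow> p2 k v = p1 v) \<and>
      inj_on (p2 k) {v \<in> B. q v = k} \<and>
      (\<forall>w\<in>{v \<in> B. q v = k}. p2 k w < m \<and> (\<forall>h. host w = Some h \<longrightarrow> p2 k w \<in> Nb (p2 k h)))" ..
  have p2: "\<And>k v. v \<notin> {v \<in> B. q v = k} \<Longrightarrow> p2 k v = p1 v" "\<And>k. inj_on (p2 k) {v \<in> B. q v = k}"
      "\<And>k w. w \<in> {v \<in> B. q v = k} \<Longrightarrow> p2 k w < m"
      "\<And>k w h. w \<in> {v \<in> B. q v = k} \<Longrightarrow> host w = Some h \<Longrightarrow> p2 k w \<in> Nb (p2 k h)"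
    using Q by blast+
  define p where "p v = (if v \<in> B then p2 (q v) v else p1 v)" for v
  have pAS: "p v = p1 v" if "v \<in> A \<union> S" for v using that part by (auto simp: p_def)
  have pk: "p v = p2 k v" if "v \<notin> B \<or> q v = k" for v k using that p2(1)[of v k] by (auto simp: p_def)
  show ?thesis
  proof (rule that[of p])
    show "p v < m" if "v \<in> V" for v
      using that p1(1)[of v] p2(3)[of v "q v"] part(1) by (auto simp: p_def)
    show "p v \<in> Nb (p w)" if hv: "host v = Some w" "v \<in> V" for v w
    proof (cases "v \<in> B")
      case True
      have "w \<notin> B \<or> q w = q v" using host_B[OF True hv(1)] by blast
      then have "p w = p2 (q v) w" by (rule pk)
      moreover have "p v = p2 (q v) v" by (rule pk) simp
      ultimately show ?thesis using p2(4)[of v "q v" w] True hv(1) by simp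
    next
      case False
      then have "v \<in> A" using host[OF hv(1)] hv(2) part(1) by blast
      then have "w \<in> A \<union> S" using host_A hv(1) by fastforce
      then show ?thesis using p1(2)[of v w] pAS \<open>v \<in> A\<close> hv(1) by simp
    qed
    show "inj_on p S" using injS pAS by (auto simp: inj_on_def)
    show "inj_on p (layer k)" for k using injL[of k] pAS by (auto simp: inj_on_def layer_def)
    show "inj_on p {v \<in> B. q v = k}" for k using p2(2)[of k] by (auto simp: inj_on_def p_def)
  qed
qed

end

section \<open>The induced copy\<close>

context scheme begin

text \<open>Tags: 0, 1, 2 mark the position of a vertex in \<open>S\<close>, \<open>A\<close>, \<open>B\<close>; 3 marks a cluster as the identity of the
  child of a special vertex, 4 marks it as a key; 5 is the common key of the special vertices.\<close>

definition kind :: "'v \<Rightarrow> nat" where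
  "kind v = (if v \<in> S then 0 else if v \<in> A then 1 else 2)"

text \<open>Special vertices share one key, while positions in \<open>B\<close> are unambiguous only
  within a cluster. So a special vertex names its tree child by the cluster of the child.\<close>

definition Out :: "('v \<Rightarrow> nat) \<Rightarrow> 'v \<Rightarrow> (nat \<times> nat) set" where
  "Out p u = (\<lambda>w. if Tarc u w then (3, q w) else (kind w, p w)) ` {w. D u w}"

definition ID :: "('v \<Rightarrow> nat) \<Rightarrow> 'v \<Rightarrow> (nat \<times> nat) set" where
  "ID p v = insert (kind v, p v) (if \<exists>s. Tarc s v then {(3, q v)} else {})"

definition Key :: "'v \<Rightarrow> (nat \<times> nat) set" where
  "Key u = {if u \<in> S then (5, 0) else (4, q u)}"

text \<open>Positions are injective on the whole of \<open>S\<close>, so arcs into \<open>S\<close>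
  need no key.\<close>

definition InK :: "'v \<Rightarrow> (nat \<times> nat) set" where
  "InK w = (if w \<in> S then {} else \<Union>(Key ` {u. D u w}))"

text \<open>A hosted vertex does not store its position: that of its host, an out-neighbour, is in
  the set anyway.\<close>

definition numbers :: "('v \<Rightarrow> nat) \<Rightarrow> 'v \<Rightarrow> nat set" where
  "numbers p v = (if v \<in> S then insert (p v) ((\<lambda>w. if Tarc v w then q w else p w) ` {w. D v w})
     else insert (q v) ((if host v = None then {p v} else {}) \<union> p ` {w. D v w} \<union>
       q ` {u. D u v \<and> u \<notin> S \<and> q u \<noteq> q v}))"

lemma Key_eq_iff: "Key u = Key v \<longleftrightarrow> key u = key v"
  by (auto simp: Key_def key_def)

lemma finite_numbers: "finite (numbers p v)"
proof -
  have "finite {u. D u v \<and> u \<notin> S \<and> q u \<noteq> q v}" by (rule finite_subset[OF _ finite_parts(6)[of v]]) auto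
  then show ?thesis using finite_parts(5)[of v] by (simp add: numbers_def)
qed

lemma card_numbers:
  assumes v: "v \<in> V"
  shows "card (numbers p v) \<le> \<Delta>"
proof (cases "v \<in> S")
  case True
  have "card (numbers p v) \<le> Suc (card ((\<lambda>w. if Tarc v w then q w else p w) ` {w. D v w}))"
    using True by (simp add: numbers_def card_insert_le_m1)
  also have "\<dots> \<le> Suc (card {w. D v w})" by (intro Suc_le_mono[THEN iffD2] card_image_le finite_parts(5))
  finally show ?thesis using budget_S[OF True] by simp
next
  case False
  let ?C = "{u. D u v \<and> u \<notin> S \<and> q u \<noteq> q v}"
  have fC: "finite ?C" by (rule finite_subset[OF _ finite_parts(6)[of v]]) auto
  let ?N = "if host v = None then {p v} else {}"
  have "card (numbers p v) \<le> Suc (card (?N \<union> p ` {w. D v w} \<union> q ` ?C))"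
    using False by (simp only: numbers_def if_False) (rule card_insert_le_m1, auto)
  also have "card (?N \<union> p ` {w. D v w} \<union> q ` ?C) \<le> card ?N + card (p ` {w. D v w}) + card (q ` ?C)"
    by (meson add_le_mono1 card_Un_le le_trans)
  also have "\<dots> \<le> card ?N + card {w. D v w} + card ?C"
    using finite_parts(5) fC by (intro add_mono card_image_le) auto
  finally have "card (numbers p v) \<le> Suc (card ?N + card {w. D v w} + card ?C)" by simp
  moreover have "v \<in> A \<union> B" using v False part(1) by blast
  from budget[OF this] have "card {w. D v w} + card ?C + Suc (card ?N) \<le> \<Delta>" by (cases "host v") simp_all
  ultimately show ?thesis by linarith
qed

context
  fixes p :: "'v \<Rightarrow> nat" and m d :: nat and \<phi> :: "nat \<Rightarrow> nat \<Rightarrow> nat"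
  assumes p_less: "v \<in> V \<Longrightarrow> p v < m"
    and p_host: "host v = Some w \<Longrightarrow> v \<in> V \<Longrightarrow> p v \<in> (\<lambda>c. \<phi> c (p w)) ` {..<d}"
    and inj_S: "inj_on p S" and inj_layer: "inj_on p (layer k)" and inj_B: "inj_on p {v \<in> B. q v = j}"
    and M_le: "M \<le> m"
begin

lemma numbers_less: "v \<in> V \<Longrightarrow> numbers p v \<subseteq> {..<m}"
proof -
  assume v: "v \<in> V"
  have q: "q u < m" if "u \<in> V" "u \<notin> S" for u using q_less[of u] M_le that part(1) by fastforce
  have "q w < m" if "Tarc u w" for u w using Tarc[OF that] q_less[of w] M_le by linarith
  then show ?thesis using v p_less q D_V by (auto simp: numbers_def split: if_splits)
qed

lemma decodable_all:
  assumes v: "v \<in> V"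
  shows "decodable 6 d \<phi> (numbers p v) (Out p v)" "decodable 6 d \<phi> (numbers p v) (Key v)"
    "decodable 6 d \<phi> (numbers p v) (ID p v)" "decodable 6 d \<phi> (numbers p v) (InK v)"
proof -
  have kind: "kind w < 6" for w by (simp add: kind_def)
  have noT: "\<not> Tarc v w" if "v \<notin> S" for w using Tarc that by blast
  show "decodable 6 d \<phi> (numbers p v) (Out p v)" unfolding decodable_def
  proof (clarify)
    fix tag x assume "(tag, x) \<in> Out p v"
    then obtain w where w: "D v w" "(tag, x) = (if Tarc v w then (3, q w) else (kind w, p w))"
      by (auto simp: Out_def)
    then have "tag < 6" using kind[of w] by (auto split: if_splits)
    moreover have "x \<in> numbers p v"
    proof (cases "v \<in> S")
      case True
      have "x = (if Tarc v w then q w else p w)" using w(2) by (auto split: if_splits)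
      then show ?thesis using True w(1) by (auto simp: numbers_def)
    next
      case False
      then have "x = p w" using w(2) noT by auto
      then show ?thesis using False w(1) by (auto simp: numbers_def)
    qed
    ultimately show "tag < 6 \<and> (x = 0 \<or> x \<in> numbers p v \<or> (\<exists>c<d. \<exists>y\<in>numbers p v. x = \<phi> c y))" by blast
  qed
  have qv: "v \<notin> S \<Longrightarrow> q v \<in> numbers p v" by (simp add: numbers_def)
  then show "decodable 6 d \<phi> (numbers p v) (Key v)" by (auto simp: decodable_def Key_def)
  have pv: "p v \<in> numbers p v \<or> (\<exists>c<d. \<exists>y\<in>numbers p v. p v = \<phi> c y)"
  proof (cases "host v")
    case None
    then show ?thesis by (simp add: numbers_def)
  next
    case (Some h)
    then have h: "v \<notin> S" "D v h" using host by blast+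
    then have "p h \<in> numbers p v" by (auto simp: numbers_def)
    moreover obtain c where "c < d" "p v = \<phi> c (p h)" using p_host[OF Some v] by auto
    ultimately show ?thesis by blast
  qed
  have "q v \<in> numbers p v" if "Tarc s v" for s using Tarc[OF that] part qv by blast
  then show "decodable 6 d \<phi> (numbers p v) (ID p v)"
    using pv kind[of v] by (auto simp: decodable_def ID_def split: if_splits)
  have "q u \<in> numbers p v" if "D u v" "u \<notin> S" "v \<notin> S" for u
    using that by (cases "q u = q v") (auto simp: numbers_def)
  then show "decodable 6 d \<phi> (numbers p v) (InK v)"
    by (auto simp: decodable_def InK_def Key_def split: if_splits)
qed

text \<open>False matches are excluded according to the tag: 0 by injectivity on \<open>S\<close>, 3
  by \<open>Tarc_uniq\<close>. For the others \<open>w\<close> has an in-neighbour \<open>u'\<close>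
  with the key of \<open>u\<close>, so \<open>w\<close> and the true out-neighbour \<open>w'\<close>
  share a layer or a cluster of \<open>B\<close>, where equal positions force
  \<open>w' = w\<close>.\<close>

lemma cert_iff:
  assumes V: "u \<in> V" "w \<in> V"
  shows "cert {0, 3} (Out p u) (Key u) (ID p w) (InK w) \<longleftrightarrow> D u w"
proof
  assume D: "D u w"
  show "cert {0, 3} (Out p u) (Key u) (ID p w) (InK w)"
  proof (cases "Tarc u w")
    case True
    then have "(3, q w) \<in> Out p u \<inter> ID p w" using D by (auto simp: Out_def ID_def image_iff)
    then show ?thesis unfolding cert_def by (intro bexI[of _ "(3, q w)"]) auto
  next
    case False
    then have e: "(kind w, p w) \<in> Out p u \<inter> ID p w" using D by (auto simp: Out_def ID_def image_iff)
    have "kind w = 0 \<or> Key u \<inter> InK w \<noteq> {}"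
    proof (cases "w \<in> S")
      case False
      then have "Key u \<subseteq> InK w" using D by (auto simp: InK_def)
      then show ?thesis by (auto simp: Key_def)
    qed (simp add: kind_def)
    then show ?thesis using e unfolding cert_def by (intro bexI[of _ "(kind w, p w)"]) auto
  qed
next
  assume "cert {0, 3} (Out p u) (Key u) (ID p w) (InK w)"
  then obtain tag x where e: "(tag, x) \<in> Out p u" "(tag, x) \<in> ID p w" "tag = 0 \<or> tag = 3 \<or> Key u \<inter> InK w \<noteq> {}"
    by (auto simp: cert_def)
  obtain w' where w': "D u w'" "(tag, x) = (if Tarc u w' then (3, q w') else (kind w', p w'))"
    using e(1) by (auto simp: Out_def)
  have kind3: "kind y \<noteq> 3" for y by (simp add: kind_def)
  show "D u w"
  proof (cases "Tarc u w'")
    case True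
    then have "tag = 3" "x = q w'" using w'(2) by auto
    then obtain s where "Tarc s w" "q w = q w'" using e(2) kind3[of w] by (auto simp: ID_def split: if_splits)
    then have "w = w'" using Tarc_uniq True by blast
    then show ?thesis using w'(1) by simp
  next
    case noT: False
    then have x: "tag = kind w'" "x = p w'" using w'(2) by auto
    then have eq: "kind w' = kind w" "p w' = p w" using e(2) kind3[of w'] by (auto simp: ID_def split: if_splits)
    have "w' = w"
    proof (cases "w \<in> S")
      case True
      then have "w' \<in> S" using eq(1) by (auto simp: kind_def split: if_splits)
      then show ?thesis using True eq(2) inj_S by (auto dest: inj_onD)
    next
      case False
      then have "tag \<noteq> 0" "tag \<noteq> 3" using x eq(1) kind3[of w'] by (auto simp: kind_def)
      then have "Key u \<inter> InK w \<noteq> {}" using e(3) by blast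
      then obtain u' where u': "D u' w" "key u' = key u"
        using False by (auto simp: InK_def Key_eq_iff[symmetric] Key_def split: if_splits)
      have S: "u' \<in> S \<longleftrightarrow> u \<in> S" using u'(2) by (auto simp: key_def split: if_splits)
      show ?thesis
      proof (cases "w \<in> A")
        case True
        then have "w' \<in> A" using eq(1) part False by (auto simp: kind_def split: if_splits)
        then have "w' \<in> layer (key u)" "w \<in> layer (key u)" using True u' w'(1) by (auto simp: layer_def)
        then show ?thesis using eq(2) inj_layer by (auto dest: inj_onD)
      next
        case wA: False
        then have wB: "w \<in> B" using V False part(1) by blast
        have "w' \<notin> S" "w' \<notin> A" using eq(1) False wA by (auto simp: kind_def split: if_splits)
        then have wB': "w' \<in> B" using D_V[OF w'(1)] part(1) by blast
        \<comment> \<open>Arcs from \<open>S\<close> into \<open>B\<close> are all named by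
          clusters, which is excluded in this case.\<close>
        have "u \<notin> S" using S_to_B[OF _ wB' w'(1)] noT by blast
        then have "q u' = q w" "q u = q w'" "q u' = q u"
          using to_B[OF wB u'(1)] to_B[OF wB' w'(1)] S u'(2) by (auto simp: key_def)
        then have "w \<in> {v \<in> B. q v = q w}" "w' \<in> {v \<in> B. q v = q w}" using wB wB' by auto
        then show ?thesis using eq(2) inj_B by (auto dest: inj_onD)
      qed
    qed
    then show ?thesis using w'(1) by simp
  qed
qed

lemma induced_copy:
  assumes irr: "\<And>u. \<not> F u u" and pos: "0 < \<Delta>" "0 < m"
  shows "induced_subgraph_copy V F (labels 6 \<Delta> d m) (label_edge {0, 3} d \<phi> (labels 6 \<Delta> d m))"
proof (rule induced_copy_in_labels[where W = "numbers p" and Out = "Out p" and Key = Key and ID = "ID p" and InK = InK])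
  show "u = v" if uv: "u \<in> V" "v \<in> V" "Key u = Key v" "ID p u = ID p v" for u v
  proof -
    have k: "key u = key v" using uv(3) Key_eq_iff by blast
    have kind3: "kind y \<noteq> 3" for y by (simp add: kind_def)
    have "(kind u, p u) \<in> ID p v" unfolding uv(4)[symmetric] by (simp add: ID_def)
    then have eq: "kind u = kind v" "p u = p v" using kind3[of u] by (auto simp: ID_def split: if_splits)
    consider "u \<in> S" "v \<in> S" | "u \<in> A" "v \<in> A" | "u \<in> B" "v \<in> B" "u \<notin> S" "v \<notin> S"
      using uv(1,2) eq(1) part by (auto simp: kind_def split: if_splits)
    then show ?thesis
    proof cases
      case 1
      then show ?thesis using eq(2) inj_S by (auto dest: inj_onD)
    next
      case 2
      then have "u \<in> layer (key u)" "v \<in> layer (key u)" using k by (auto simp: layer_def)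
      then show ?thesis using eq(2) inj_layer by (auto dest: inj_onD)
    next
      case 3
      then have "q u = q v" using k by (auto simp: key_def)
      then have "u \<in> {w \<in> B. q w = q v}" "v \<in> {w \<in> B. q w = q v}" using 3 by auto
      then show ?thesis using eq(2) inj_B by (auto dest: inj_onD)
    qed
  qed
  show "F u v \<longleftrightarrow> cert {0, 3} (Out p u) (Key u) (ID p v) (InK v) \<or> cert {0, 3} (Out p v) (Key v) (ID p u) (InK u)"
    if "u \<in> V" "v \<in> V" "u \<noteq> v" for u v
    using F_iff cert_iff that by blast
qed (use finite_numbers card_numbers numbers_less decodable_all irr pos in auto)

end

end

lemma ceil_sqrt:
  assumes "1 \<le> (n :: nat)"
  obtains t :: nat where "1 \<le> t" "n \<le> t * t" "real t \<le> 2 * sqrt (real n)"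
proof
  let ?t = "nat \<lceil>sqrt (real n)\<rceil>"
  have s: "1 \<le> sqrt (real n)" using assms by simp
  have c: "sqrt (real n) \<le> real ?t" "real ?t \<le> sqrt (real n) + 1" using s by linarith+
  then show "1 \<le> ?t" "real ?t \<le> 2 * sqrt (real n)" using s by linarith+
  have "real n = sqrt (real n) * sqrt (real n)" by simp
  also have "\<dots> \<le> real ?t * real ?t" using c(1) s by (intro mult_mono c(1)) linarith+
  finally have "real n \<le> real (?t * ?t)" by simp
  then show "n \<le> ?t * ?t" by (simp only: of_nat_le_iff)
qed

text \<open>The embeddings need a reserve above \<open>3 * \<Delta> + 1\<close>; it is
  \<open>3 * \<Delta> + 2\<close>, and \<open>d - 2\<close> must be one more. The value of \<sigma>
  bounds the conflicts, and \<open>m\<close> allows for expansion up to \<open>2 * \<sigma>\<close>,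
  for placing roots and for all cluster numbers.\<close>

lemma universal_labels:
  assumes \<Delta>: "3 \<le> \<Delta>" and t: "1 \<le> t" "n \<le> t * t"
    and \<sigma>: "\<sigma> = 2 * t * (\<Delta> + 1) * (\<Delta> + 1)" and d: "d = 3 * \<Delta> + 5"
    and m: "(3 ^ d * (d - 2)\<^sup>2 + d + 3) * (2 * \<sigma>) + 1 = m"
  shows "\<exists>\<phi>. induced_universal_for (labels 6 \<Delta> d m) (label_edge {0, 3} d \<phi> (labels 6 \<Delta> d m)) n \<Delta>"
proof -
  have \<sigma>1: "1 \<le> \<sigma>" using t(1) unfolding \<sigma> by simp
  have "(3 ^ d * (d - 2)\<^sup>2 + d) * (2 * \<sigma>) \<le> (3 ^ d * (d - 2)\<^sup>2 + d + 3) * (2 * \<sigma>)"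
    by (intro mult_le_mono1) simp
  then have m0: "0 < m" "(3 ^ d * (d - 2)\<^sup>2 + d) * (2 * \<sigma>) \<le> m" unfolding m[symmetric] by linarith+
  have m1: "3 * \<sigma> + d * \<sigma> < m"
  proof -
    have "3 * \<sigma> + d * \<sigma> = (d + 3) * \<sigma>" by (simp add: algebra_simps)
    also have "\<dots> \<le> (3 ^ d * (d - 2)\<^sup>2 + d + 3) * (2 * \<sigma>)" by (intro mult_le_mono) auto
    finally show ?thesis unfolding m[symmetric] by simp
  qed
  have m2: "2 * \<Delta> * t + (t + 1) \<le> m"
  proof -
    have "2 * \<Delta> * t + (t + 1) \<le> 2 * t * (\<Delta> + 1) * 1" using t(1) by (simp add: algebra_simps)
    also have "\<dots> \<le> \<sigma>" unfolding \<sigma> by (intro mult_le_mono) auto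
    finally show ?thesis using m1 by linarith
  qed
  \<comment> \<open>The decoding functions are fixed before \<open>F\<close> is given, as
    universality demands.\<close>
  obtain \<phi> :: "nat \<Rightarrow> nat \<Rightarrow> nat" where \<phi>: "\<And>c x. c < d \<Longrightarrow> x < m \<Longrightarrow> \<phi> c x < m"
    "\<And>X. X \<subseteq> {..<m} \<Longrightarrow> card X \<le> 2 * \<sigma> \<Longrightarrow> (d - 2) * card X \<le> card (\<Union>x\<in>X. (\<lambda>c. \<phi> c x) ` {..<d})"
    using lossless_expander_exists[of d "2 * \<sigma>" m] m0 d by auto
  let ?Nb = "\<lambda>x. (\<lambda>c. \<phi> c x) ` {..<d}"
  have ex: "expander m d (3 * \<Delta> + 2) \<sigma> ?Nb"
  proof
    show "?Nb x \<subseteq> {..<m}" if "x < m" for x using \<phi>(1) that by auto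
    show "card (?Nb x) \<le> d" for x using card_image_le[of "{..<d}" "\<lambda>c. \<phi> c x"] by simp
    have "3 * \<Delta> + 2 + 1 = d - 2" using d by simp
    then show "(3 * \<Delta> + 2 + 1) * card X \<le> card (\<Union> (?Nb ` X))" if "X \<subseteq> {..<m}" "card X \<le> 2 * \<sigma>" for X
      using \<phi>(2)[OF that] by simp
  qed (use \<sigma>1 in auto)
  have "induced_subgraph_copy {0..<n} F (labels 6 \<Delta> d m) (label_edge {0, 3} d \<phi> (labels 6 \<Delta> d m))"
    if F: "simple_graph {0..<n} F" "max_degree_le {0..<n} F \<Delta>" for F
  proof -
    have Fs: "\<And>x y. F x y \<Longrightarrow> F y x" "\<And>x. \<not> F x x" "\<And>x y. F x y \<Longrightarrow> x \<in> {0..<n} \<and> y \<in> {0..<n}"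
      using F(1) unfolding simple_graph_def by blast+
    have "\<exists>S A B D q host rank Tarc. scheme {0..<n} F \<Delta> t (2 * \<Delta> * t + (t + 1)) S A B D q host rank Tarc"
    proof (rule scheme_exists)
      show "card {y \<in> {0..<n}. F v y} \<le> \<Delta>" if "v \<in> {0..<n}" for v
        using F(2) that unfolding max_degree_le_def degree_def by blast
    qed (use Fs \<Delta> t in auto)
    then obtain S A B D q host rank Tarc
      where sc: "scheme {0..<n} F \<Delta> t (2 * \<Delta> * t + (t + 1)) S A B D q host rank Tarc"
      by (elim exE)
    interpret scheme "{0..<n}" F \<Delta> t "2 * \<Delta> * t + (t + 1)" S A B D q host rank Tarc by (rule sc)
    obtain p where p: "\<And>v. v \<in> {0..<n} \<Longrightarrow> p v < m" "\<And>v w. host v = Some w \<Longrightarrow> v \<in> {0..<n} \<Longrightarrow> p v \<in> ?Nb (p w)"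
      "inj_on p S" "\<And>k. inj_on p (layer k)" "\<And>k. inj_on p {v \<in> B. q v = k}"
    proof (rule positions_exist[OF ex])
      show "d \<le> 3 * \<Delta> + 2 + 3" "3 * \<Delta> + 1 < 3 * \<Delta> + 2" using d by auto
      show "2 * t * (\<Delta> + 1) * (\<Delta> + 1) \<le> \<sigma>" using \<sigma> by simp
    qed (use m1 \<Delta> t in auto)
    show ?thesis by (rule induced_copy[of p m \<phi> d]) (use p m0 m2 Fs(2) \<Delta> in auto)
  qed
  then show ?thesis unfolding induced_universal_for_def by blast
qed

lemma universal_graph_ge3:
  assumes \<Delta>: "3 \<le> \<Delta>"
  shows "\<exists>c::real. c > 0 \<and> (\<forall>n\<ge>1. \<exists>(V::nat set) E.
           simple_graph V E \<and> real (card V) \<le> c * real n powr (real \<Delta> / 2) \<and> induced_universal_for V E n \<Delta>)"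
proof -
  define d where "d = 3 * \<Delta> + 5"
  define k where "k = (3 ^ d * (d - 2)\<^sup>2 + d + 3) * (4 * (\<Delta> + 1) * (\<Delta> + 1)) + 1"
  define K where "K = (2 ^ (6 * (\<Delta> * (d + 2)))) ^ 4 * (2 * k) ^ \<Delta>"
  have "\<exists>(V::nat set) E. simple_graph V E \<and> real (card V) \<le> real K * real n powr (real \<Delta> / 2) \<and>
      induced_universal_for V E n \<Delta>" if n: "1 \<le> n" for n
  proof -
    obtain t where t: "1 \<le> t" "n \<le> t * t" "real t \<le> 2 * sqrt (real n)" using ceil_sqrt[OF n] .
    define \<sigma> where "\<sigma> = 2 * t * (\<Delta> + 1) * (\<Delta> + 1)"
    define m where "m = (3 ^ d * (d - 2)\<^sup>2 + d + 3) * (2 * \<sigma>) + 1"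
    obtain \<phi> where U: "induced_universal_for (labels 6 \<Delta> d m) (label_edge {0, 3} d \<phi> (labels 6 \<Delta> d m)) n \<Delta>"
      using universal_labels[OF \<Delta> t(1,2) \<sigma>_def d_def m_def[symmetric]] by blast
    obtain V :: "nat set" and E where V: "simple_graph V E" "card V = card (labels 6 \<Delta> d m)" "induced_universal_for V E n \<Delta>"
      using universal_nat_copy[OF finite_labels simple_graph_labels[OF finite_labels] U] by blast
    have "m \<le> k * t"
    proof -
      have "2 * \<sigma> = 4 * (\<Delta> + 1) * (\<Delta> + 1) * t" by (simp add: \<sigma>_def algebra_simps)
      then show ?thesis
        unfolding m_def k_def distrib_right[of _ _ t] using t(1) by (simp only: mult.assoc mult_1)
    qed
    then have "real m \<le> real (k * t)" by (simp only: of_nat_le_iff)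
    also have "\<dots> \<le> real (2 * k) * sqrt (real n)" using mult_left_mono[OF t(3), of "real k"] by simp
    finally have mk: "real m \<le> real (2 * k) * sqrt (real n)" .
    have "real (card V) = real m ^ \<Delta> * real ((2 ^ (6 * (\<Delta> * (d + 2)))) ^ 4)"
      unfolding V(2) card_labels by simp
    also have "\<dots> \<le> (real (2 * k) * sqrt (real n)) ^ \<Delta> * real ((2 ^ (6 * (\<Delta> * (d + 2)))) ^ 4)"
      using mk by (intro mult_right_mono power_mono) auto
    also have "\<dots> = real K * sqrt (real n) ^ \<Delta>" by (simp add: K_def power_mult_distrib)
    also have "sqrt (real n) ^ \<Delta> = real n powr (real \<Delta> / 2)"
      using n by (simp add: powr_half_sqrt[symmetric] powr_powr powr_realpow[symmetric])
    finally show ?thesis using V(1,3) by blast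
  qed
  moreover have "0 < k" unfolding k_def by (rule trans_less_add2) simp
  then have "0 < real K" by (simp add: K_def)
  ultimately show ?thesis by blast
qed

section \<open>Maximum degree two\<close>

text \<open>Paths are placed on one rail of a ladder. A cycle is folded: it climbs on rail 0, comes back on
  rail 1, and closes by flagged rungs at the bottom and at the top. A label consists of height,
  rail, bottom flag and top flag; the top flag is 1 or 2 for cycles of even or odd length.\<close>

type_synonym ladder = "nat \<times> nat \<times> bool \<times> nat"

text \<open>No rail edge enters a vertex with bottom flag from below; this separates stacked
  components. The top rung is horizontal for flag 1 and slanted for flag 2, because in an odd cycle
  rail 0 carries one vertex more than rail 1.\<close>

fun rung :: "ladder \<Rightarrow> ladder \<Rightarrow> bool" where
  "rung (h, s, b, p) (h', s', b', p') \<longleftrightarrow>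
     s = s' \<and> h' = Suc h \<and> \<not> b' \<or>
     s = 0 \<and> s' = 1 \<and> (h = h' \<and> b \<and> b' \<or> h = h' \<and> p = 1 \<and> p' = 1 \<or> h = Suc h' \<and> p = 2 \<and> p' = 2)"

definition ladder_adj :: "ladder \<Rightarrow> ladder \<Rightarrow> bool" where
  "ladder_adj a b \<longleftrightarrow> rung a b \<or> rung b a"

definition path_label :: "nat \<Rightarrow> nat \<Rightarrow> ladder" where
  "path_label a i = (a + i, 0, i = 0, 0)"

definition cycle_label :: "nat \<Rightarrow> nat \<Rightarrow> nat \<Rightarrow> ladder" where
  "cycle_label a k i =
    (if i \<le> k div 2 then (a + i, 0, i = 0, if i = k div 2 then (if odd k then 1 else 2) else 0)
     else (a + (k - i), 1, i = k, if i = Suc (k div 2) then (if odd k then 1 else 2) else 0))"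

lemma path_label_adj: "i < j \<Longrightarrow> ladder_adj (path_label a i) (path_label a j) \<longleftrightarrow> j = Suc i"
  by (auto simp: ladder_adj_def path_label_def)

lemma cycle_label_adj:
  assumes "2 \<le> k" "i < j" "j \<le> k"
  shows "ladder_adj (cycle_label a k i) (cycle_label a k j) \<longleftrightarrow> j = Suc i \<or> i = 0 \<and> j = k"
proof -
  obtain l where l: "k div 2 = l" "k = 2 * l \<or> k = 2 * l + 1" by fastforce
  consider "j \<le> l" | "i \<le> l" "l < j" | "l < i" by linarith
  then show ?thesis
  proof cases
    case 1
    then show ?thesis using assms l by (auto simp: ladder_adj_def cycle_label_def)
  next
    case 2
    show ?thesis using l(2)
    proof
      assume k: "k = 2 * l"
      have "cycle_label a k i = (a + i, 0, i = 0, if i = l then 2 else 0)"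
        "cycle_label a k j = (a + (2 * l - j), 1, j = 2 * l, if j = Suc l then 2 else 0)"
        using 2 by (simp_all add: cycle_label_def k)
      then show ?thesis using 2 assms k by (auto simp: ladder_adj_def)
    next
      assume k: "k = 2 * l + 1"
      have "cycle_label a k i = (a + i, 0, i = 0, if i = l then 1 else 0)"
        "cycle_label a k j = (a + (2 * l + 1 - j), 1, j = 2 * l + 1, if j = Suc l then 1 else 0)"
        using 2 by (simp_all add: cycle_label_def k)
      then show ?thesis using 2 assms k by (auto simp: ladder_adj_def)
    qed
  next
    case 3
    have "cycle_label a k i = (a + (k - i), 1, i = k, if i = Suc l then (if odd k then 1 else 2) else 0)"
      "cycle_label a k j = (a + (k - j), 1, j = k, if j = Suc l then (if odd k then 1 else 2) else 0)"
      using 3 assms(2) by (simp_all add: cycle_label_def l(1))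
    then show ?thesis using 3 assms by (auto simp: ladder_adj_def)
  qed
qed

section \<open>Stacking the components of a graph of maximum degree two\<close>

text \<open>Separates a component starting at height \<open>a\<close> from everything below: bottom
  flags stop the rail edges, and a top flag 2 on rail 0 would allow a slanted rung down to height
  \<open>a - 1\<close>.\<close>

definition bottom_ok :: "nat \<Rightarrow> ladder \<Rightarrow> bool" where
  "bottom_ok a l \<longleftrightarrow> a \<le> fst l \<and> (fst l = a \<longrightarrow> (case l of (h, s, b, p) \<Rightarrow> b \<and> \<not> (s = 0 \<and> p = 2)))"

definition shape_ok :: "ladder \<Rightarrow> bool" where
  "shape_ok l \<longleftrightarrow> (case l of (h, s, b, p) \<Rightarrow> s < 2 \<and> p < 3)"

lemma not_adj_across:
  "fst l < a \<Longrightarrow> bottom_ok a l' \<Longrightarrow> \<not> ladder_adj l l' \<and> \<not> ladder_adj l' l"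
  by (cases l; cases l') (auto simp: ladder_adj_def bottom_ok_def)

lemma component_labels:
  fixes k a :: nat
  shows "\<exists>g. inj_on g {..k} \<and> (\<forall>i\<le>k. bottom_ok a (g i) \<and> fst (g i) < a + Suc k \<and> shape_ok (g i)) \<and>
    (\<forall>i j. i < j \<longrightarrow> j \<le> k \<longrightarrow> (ladder_adj (g i) (g j) \<longleftrightarrow> j = Suc i \<or> cyc \<and> i = 0 \<and> j = k))"
\<comment> \<open>For \<open>k \<le> 1\<close> there is no closing edge apart from the path edge, so
  path labels do.\<close>
proof (cases "cyc \<and> 2 \<le> k")
  case True
  show ?thesis
  proof (intro exI conjI allI impI)
    show "inj_on (cycle_label a k) {..k}"
      by (rule inj_onI) (auto simp: cycle_label_def split: if_splits)
    fix i assume "i \<le> k"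
    then show "bottom_ok a (cycle_label a k i)" "fst (cycle_label a k i) < a + Suc k" "shape_ok (cycle_label a k i)"
      using True by (auto simp: bottom_ok_def shape_ok_def cycle_label_def)
  qed (use cycle_label_adj True in auto)
next
  case False
  then have *: "j = Suc i \<or> cyc \<and> i = 0 \<and> j = k \<longleftrightarrow> j = Suc i" if "i < j" "j \<le> k" for i j
    using that by auto
  show ?thesis
  proof (intro exI conjI allI impI)
    show "inj_on (path_label a) {..k}" by (rule inj_onI) (auto simp: path_label_def)
    fix i assume "i \<le> k"
    then show "bottom_ok a (path_label a i)" "fst (path_label a i) < a + Suc k" "shape_ok (path_label a i)"
      by (auto simp: bottom_ok_def shape_ok_def path_label_def)
  qed (use path_label_adj * in auto)
qed

text \<open>A longest path fills a component: its ends cannot be extended, inner vertices have their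
  two neighbours on the path, and the only possible chord joins the ends.\<close>

lemma maximal_path:
  assumes fin: "finite W" "W \<noteq> {}" and sym: "\<And>x y. F x y \<Longrightarrow> F y x"
    and deg: "\<And>v. v \<in> W \<Longrightarrow> card {y \<in> W. F v y} \<le> 2"
  shows "\<exists>x k. inj_on x {..k} \<and> x ` {..k} \<subseteq> W \<and> (\<forall>i j. i < j \<longrightarrow> j \<le> k \<longrightarrow>
      (F (x i) (x j) \<longleftrightarrow> j = Suc i \<or> F (x 0) (x k) \<and> i = 0 \<and> j = k)) \<and>
      (\<forall>i\<le>k. \<forall>y\<in>W. F (x i) y \<longrightarrow> y \<in> x ` {..k})"
proof -
  let ?P = "\<lambda>xs. xs \<noteq> [] \<and> distinct xs \<and> set xs \<subseteq> W \<and> (\<forall>i. Suc i < length xs \<longrightarrow> F (xs ! i) (xs ! Suc i))"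
  obtain w where "w \<in> W" using fin by blast
  then have "?P [w]" by simp
  moreover have "\<forall>xs. ?P xs \<longrightarrow> length xs < Suc (card W)"
    using fin by (metis card_mono distinct_card le_imp_less_Suc)
  ultimately have "\<exists>xs. ?P xs \<and> (\<forall>ys. ?P ys \<longrightarrow> length ys \<le> length xs)" by (rule ex_has_greatest_nat)
  then obtain xs where P: "?P xs" and max: "\<And>ys. ?P ys \<Longrightarrow> length ys \<le> length xs" by blast
  define k where "k = length xs - 1"
  have len: "length xs = Suc k" using P by (cases xs) (auto simp: k_def)
  let ?x = "\<lambda>i. xs ! i"
  have inj: "inj_on ?x {..k}" using P len by (auto simp: inj_on_def nth_eq_iff_index_eq)
  have im: "?x ` {..k} = set xs" using len by (auto simp: in_set_conv_nth less_Suc_eq_le)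
  have neq: "?x i = ?x j \<longleftrightarrow> i = j" if "i \<le> k" "j \<le> k" for i j using inj that by (auto dest: inj_onD)
  have inW: "?x i \<in> W" if "i \<le> k" for i using P that len by (auto simp: subset_iff)
  have step: "F (?x i) (?x (Suc i))" "F (?x (Suc i)) (?x i)" if "i < k" for i
    using P that len sym by auto
  have three: False if v: "v \<in> W" "F v a" "F v b" "F v c" "a \<in> W" "b \<in> W" "c \<in> W" "a \<noteq> b" "a \<noteq> c" "b \<noteq> c" for v a b c
  proof -
    have "card {a, b, c} \<le> card {y \<in> W. F v y}" using v fin by (intro card_mono) auto
    then show False using deg[OF v(1)] v by simp
  qed
  have closed: "y \<in> set xs" if i: "i \<le> k" "y \<in> W" "F (?x i) y" for i y
  proof (rule ccontr)
    assume y: "y \<notin> set xs"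
    then have yx: "y \<noteq> ?x j" if "j \<le> k" for j using that len by (auto simp: in_set_conv_nth less_Suc_eq_le)
    have "i = 0 \<or> i = k"
    proof (rule ccontr)
      assume "\<not> ?thesis"
      then obtain p where p: "i = Suc p" "i < k" using i by (cases i) auto
      then show False
        using three[of "?x i" "?x p" "?x (Suc i)" y] step(2)[of p] step(1)[of i] inW[of p] inW[of i] inW[of "Suc i"] i
          yx[of p] yx[of "Suc i"] neq[of p "Suc i"] by simp
    qed
    then show False
    proof
      assume "i = 0"
      have "F ((y # xs) ! j) ((y # xs) ! Suc j)" if "Suc j < length (y # xs)" for j
        using that P i(3) sym \<open>i = 0\<close> by (cases j) auto
      then have "?P (y # xs)" using P y i(2) by auto
      from max[OF this] show False by simp
    next
      assume "i = k"
      have "F ((xs @ [y]) ! j) ((xs @ [y]) ! Suc j)" if "Suc j < length (xs @ [y])" for j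
      proof (cases "Suc j < length xs")
        case True
        then show ?thesis using P by (auto simp: nth_append)
      next
        case False
        then have "j = k" using that len by auto
        then show ?thesis using i(3) \<open>i = k\<close> len by (auto simp: nth_append)
      qed
      then have "?P (xs @ [y])" using P y i(2) by auto
      from max[OF this] show False by simp
    qed
  qed
  have edges: "F (?x i) (?x j) \<longleftrightarrow> j = Suc i \<or> F (?x 0) (?x k) \<and> i = 0 \<and> j = k" if ij: "i < j" "j \<le> k" for i j
  proof
    assume F: "F (?x i) (?x j)"
    show "j = Suc i \<or> F (?x 0) (?x k) \<and> i = 0 \<and> j = k"
    proof (rule ccontr)
      assume neg: "\<not> ?thesis"
      then have sj: "Suc i < j" using ij by auto
      show False
      proof (cases "i = 0")
        case False
        then obtain p where p: "i = Suc p" by (cases i) auto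
        then show False
          using three[of "?x i" "?x p" "?x (Suc i)" "?x j"] step(2)[of p] step(1)[of i] inW[of p] inW[of i]
            inW[of "Suc i"] inW[of j] F ij sj neq[of p "Suc i"] neq[of p j] neq[of "Suc i" j] by simp
      next
        case True
        then have "j \<noteq> k" using neg F by blast
        moreover obtain p where "j = Suc p" using ij by (cases j) auto
        ultimately show False
          using three[of "?x j" "?x p" "?x (Suc j)" "?x i"] step(2)[of p] step(1)[of j] inW[of p] inW[of i]
            inW[of "Suc j"] inW[of j] sym[OF F] ij sj neq[of p "Suc j"] neq[of p i] neq[of "Suc j" i] by simp
      qed
    qed
  next
    assume "j = Suc i \<or> F (?x 0) (?x k) \<and> i = 0 \<and> j = k"
    then show "F (?x i) (?x j)" using step(1)[of i] ij by auto
  qed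
  show ?thesis
  proof (intro exI conjI allI impI ballI)
    show "inj_on ?x {..k}" by (rule inj)
    show "?x ` {..k} \<subseteq> W" using im P by simp
    show "F (?x i) (?x j) \<longleftrightarrow> j = Suc i \<or> F (?x 0) (?x k) \<and> i = 0 \<and> j = k" if "i < j" "j \<le> k" for i j
      using edges that .
    show "y \<in> ?x ` {..k}" if "i \<le> k" "y \<in> W" "F (?x i) y" for i y unfolding im using closed that .
  qed
qed

text \<open>A component with \<open>k + 1\<close> vertices is given \<open>k + 1\<close> heights
  from \<open>a\<close> on and the rest is stacked above. A cycle uses only about half of them; the
  waste costs no more than a constant factor.\<close>

lemma ladder_embedding:
  assumes "finite W" and sym: "\<And>x y. F x y \<Longrightarrow> F y x"
    and "\<And>v. v \<in> W \<Longrightarrow> card {y \<in> W. F v y} \<le> 2"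
  shows "\<exists>f. inj_on f W \<and> (\<forall>v\<in>W. bottom_ok a (f v) \<and> fst (f v) < a + card W \<and> shape_ok (f v)) \<and>
    (\<forall>u\<in>W. \<forall>v\<in>W. u \<noteq> v \<longrightarrow> (F u v \<longleftrightarrow> ladder_adj (f u) (f v)))"
  using assms(1,3)
proof (induction "card W" arbitrary: W a rule: less_induct)
  case less
  show ?case
  proof (cases "W = {}")
    case False
    have "\<exists>x k. inj_on x {..k} \<and> x ` {..k} \<subseteq> W \<and> (\<forall>i j. i < j \<longrightarrow> j \<le> k \<longrightarrow>
        (F (x i) (x j) \<longleftrightarrow> j = Suc i \<or> F (x 0) (x k) \<and> i = 0 \<and> j = k)) \<and>
        (\<forall>i\<le>k. \<forall>y\<in>W. F (x i) y \<longrightarrow> y \<in> x ` {..k})"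
      using less.prems False sym by (intro maximal_path)
    then obtain x k where inj: "inj_on x {..k}" and sub: "x ` {..k} \<subseteq> W"
      and adj': "\<forall>i j. i < j \<longrightarrow> j \<le> k \<longrightarrow> (F (x i) (x j) \<longleftrightarrow> j = Suc i \<or> F (x 0) (x k) \<and> i = 0 \<and> j = k)"
      and closed': "\<forall>i\<le>k. \<forall>y\<in>W. F (x i) y \<longrightarrow> y \<in> x ` {..k}" by (elim exE conjE) (rule that)
    have adj: "F (x i) (x j) \<longleftrightarrow> j = Suc i \<or> F (x 0) (x k) \<and> i = 0 \<and> j = k" if "i < j" "j \<le> k" for i j
      using adj' that by blast
    have closed: "y \<in> x ` {..k}" if "i \<le> k" "y \<in> W" "F (x i) y" for i y using closed' that by blast
    from component_labels[of k a "F (x 0) (x k)"]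
    obtain g where g1: "inj_on g {..k}"
      and g2: "\<forall>i\<le>k. bottom_ok a (g i) \<and> fst (g i) < a + Suc k \<and> shape_ok (g i)"
      and g3: "\<forall>i j. i < j \<longrightarrow> j \<le> k \<longrightarrow> (ladder_adj (g i) (g j) \<longleftrightarrow> j = Suc i \<or> F (x 0) (x k) \<and> i = 0 \<and> j = k)"
      by (elim exE conjE) (rule that)
    let ?X = "x ` {..k}" and ?W = "W - x ` {..k}"
    have cX: "card ?X = Suc k" using card_image[OF inj] by simp
    have cW: "card W = Suc k + card ?W"
      using card_Diff_subset[of ?X W] card_mono[OF less.prems(1) sub] sub cX by simp
    have degW: "card {y \<in> ?W. F v y} \<le> 2" if "v \<in> ?W" for v
    proof -
      have "card {y \<in> ?W. F v y} \<le> card {y \<in> W. F v y}" using less.prems(1) by (intro card_mono) auto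
      then show ?thesis using less.prems(2)[of v] that by simp
    qed
    have "\<exists>f. inj_on f ?W \<and> (\<forall>v\<in>?W. bottom_ok (a + Suc k) (f v) \<and> fst (f v) < a + Suc k + card ?W \<and> shape_ok (f v)) \<and>
        (\<forall>u\<in>?W. \<forall>v\<in>?W. u \<noteq> v \<longrightarrow> (F u v \<longleftrightarrow> ladder_adj (f u) (f v)))"
      using less.hyps[of ?W "a + Suc k"] less.prems(1) degW cW by auto
    then obtain f where f: "inj_on f ?W" "\<And>v. v \<in> ?W \<Longrightarrow> bottom_ok (a + Suc k) (f v) \<and> fst (f v) < a + Suc k + card ?W \<and> shape_ok (f v)"
        "\<And>u v. u \<in> ?W \<Longrightarrow> v \<in> ?W \<Longrightarrow> u \<noteq> v \<Longrightarrow> F u v \<longleftrightarrow> ladder_adj (f u) (f v)"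
      by blast
    define h where "h v = (if v \<in> ?X then g (the_inv_into {..k} x v) else f v)" for v
    have hx: "h (x i) = g i" if "i \<le> k" for i using that inj by (simp add: h_def the_inv_into_f_f)
    have hW: "h v = f v" if "v \<in> ?W" for v using that by (simp add: h_def)
    have hX: "bottom_ok a (h v) \<and> fst (h v) < a + Suc k \<and> shape_ok (h v)" if "v \<in> ?X" for v
      using that g2 hx by auto
    have cases: "P" if "\<And>i. i \<le> k \<Longrightarrow> v = x i \<Longrightarrow> P" "v \<in> ?W \<Longrightarrow> P" "v \<in> W" for P v using that by blast
    have low: "fst (h v) \<ge> a + Suc k" if "v \<in> ?W" for v
      using f(2)[OF that] hW[OF that] by (simp add: bottom_ok_def)
    have adjX: "F u v \<longleftrightarrow> ladder_adj (h u) (h v)" if "u \<in> ?X" "v \<in> ?X" "u \<noteq> v" for u v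
    proof -
      from that(1) obtain i where i: "u = x i" "i \<le> k" by blast
      from that(2) obtain j where j: "v = x j" "j \<le> k" by blast
      note ij = i(1) j(1) i(2) j(2)
      have *: "F (x i) (x j) \<longleftrightarrow> ladder_adj (g i) (g j)" if "i < j" "j \<le> k" for i j
        unfolding adj[OF that] using g3[rule_format, OF that] by (rule HOL.sym)
      have "i \<noteq> j" using ij that(3) by blast
      then consider "i < j" | "j < i" by linarith
      then show ?thesis
      proof cases
        case 1
        then show ?thesis using * ij hx by simp
      next
        case 2
        have "F (x i) (x j) \<longleftrightarrow> F (x j) (x i)" using sym by blast
        also have "\<dots> \<longleftrightarrow> ladder_adj (g j) (g i)" using *[OF 2 ij(3)] .
        also have "\<dots> \<longleftrightarrow> ladder_adj (g i) (g j)" by (auto simp: ladder_adj_def)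
        finally show ?thesis using ij hx by simp
      qed
    qed
    have cross: "\<not> F u v \<and> \<not> F v u \<and> \<not> ladder_adj (h u) (h v) \<and> \<not> ladder_adj (h v) (h u)"
      if "u \<in> ?X" "v \<in> ?W" for u v
    proof -
      have "\<not> F u v" using closed that by auto
      moreover have "bottom_ok (a + Suc k) (h v)" using f(2)[OF that(2)] hW[OF that(2)] by simp
      ultimately show ?thesis using not_adj_across[of "h u" "a + Suc k" "h v"] hX[OF that(1)] sym by blast
    qed
    show ?thesis
    proof (intro exI conjI ballI impI)
      show "inj_on h W"
      proof
        fix u v assume uv: "u \<in> W" "v \<in> W" "h u = h v"
        consider "u \<in> ?X" "v \<in> ?X" | "u \<in> ?X" "v \<in> ?W" | "u \<in> ?W" "v \<in> ?X" | "u \<in> ?W" "v \<in> ?W"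
          using uv by blast
        then show "u = v"
        proof cases
          case 1
          then show ?thesis using uv(3) hx g1 by (auto dest: inj_onD)
        next
          case 2
          then show ?thesis using hX[of u] low[of v] uv(3) by simp
        next
          case 3
          then show ?thesis using hX[of v] low[of u] uv(3) by simp
        next
          case 4
          then show ?thesis using hW f(1) uv(3) by (auto dest: inj_onD)
        qed
      qed
      fix v assume v: "v \<in> W"
      show "bottom_ok a (h v)" "fst (h v) < a + card W" "shape_ok (h v)"
      proof -
        have "bottom_ok a (h v) \<and> fst (h v) < a + card W \<and> shape_ok (h v)"
        proof (cases "v \<in> ?X")
          case True
          then show ?thesis using hX[OF True] cW by linarith
        next
          case False
          then have vW: "v \<in> ?W" using v by blast
          have "bottom_ok a (h v)" using low[OF vW] by (simp add: bottom_ok_def)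
          then show ?thesis using f(2)[OF vW] hW[OF vW] cW by simp
        qed
        then show "bottom_ok a (h v)" "fst (h v) < a + card W" "shape_ok (h v)" by blast+
      qed
      fix u assume u: "u \<in> W" "v \<noteq> u"
      consider "v \<in> ?X" "u \<in> ?X" | "v \<in> ?X" "u \<in> ?W" | "v \<in> ?W" "u \<in> ?X" | "v \<in> ?W" "u \<in> ?W"
        using u v by blast
      then show "F v u \<longleftrightarrow> ladder_adj (h v) (h u)"
      proof cases
        case 1
        then show ?thesis using adjX u(2) by blast
      next
        case 2
        then show ?thesis using cross by blast
      next
        case 3
        then show ?thesis using cross by blast
      next
        case 4
        then show ?thesis using f(3)[OF 4 u(2)] hW by simp
      qed
    qed
  qed (simp)
qed

text \<open>At each of the \<open>n\<close> heights there are two rails, two bottom flags and three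
  top flags, hence the factor 12.\<close>

lemma universal_graph_2:
  "\<exists>(V::nat set) E. simple_graph V E \<and> card V = 12 * n \<and> induced_universal_for V E n 2"
proof -
  let ?L = "{..<n} \<times> {..<2 :: nat} \<times> (UNIV :: bool set) \<times> {..<3 :: nat}"
  let ?E = "\<lambda>a b. a \<in> ?L \<and> b \<in> ?L \<and> a \<noteq> b \<and> ladder_adj a b"
  have fin: "finite ?L" by simp
  have "simple_graph ?L ?E" using fin by (auto simp: simple_graph_def ladder_adj_def)
  moreover have "induced_universal_for ?L ?E n 2" unfolding induced_universal_for_def
  proof (intro allI impI)
    fix F assume F: "simple_graph {0..<n} F \<and> max_degree_le {0..<n} F 2"
    then have sym: "\<And>x y. F x y \<Longrightarrow> F y x" and irr: "\<And>x. \<not> F x x" unfolding simple_graph_def by blast+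
    have deg: "card {y \<in> {0..<n}. F v y} \<le> 2" if "v \<in> {0..<n}" for v
      using F that unfolding max_degree_le_def degree_def by blast
    have "\<exists>f. inj_on f {0..<n} \<and>
        (\<forall>v\<in>{0..<n}. bottom_ok 0 (f v) \<and> fst (f v) < 0 + card {0..<n} \<and> shape_ok (f v)) \<and>
        (\<forall>u\<in>{0..<n}. \<forall>v\<in>{0..<n}. u \<noteq> v \<longrightarrow> (F u v \<longleftrightarrow> ladder_adj (f u) (f v)))"
      using sym deg by (intro ladder_embedding) auto
    then obtain f where f: "inj_on f {0..<n}"
      "\<And>v. v \<in> {0..<n} \<Longrightarrow> bottom_ok 0 (f v) \<and> fst (f v) < 0 + card {0..<n} \<and> shape_ok (f v)"
      "\<And>u v. u \<in> {0..<n} \<Longrightarrow> v \<in> {0..<n} \<Longrightarrow> u \<noteq> v \<Longrightarrow> F u v \<longleftrightarrow> ladder_adj (f u) (f v)"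
      by blast
    have L: "f v \<in> ?L" if "v \<in> {0..<n}" for v
      using f(2)[OF that] by (cases "f v") (auto simp: shape_ok_def)
    have "F u v \<longleftrightarrow> ?E (f u) (f v)" if "u \<in> {0..<n}" "v \<in> {0..<n}" for u v
    proof (cases "u = v")
      case False
      then have "f u \<noteq> f v" using f(1) that by (auto dest: inj_onD)
      then show ?thesis using f(3)[OF that False] L[OF that(1)] L[OF that(2)] by blast
    qed (use irr in simp)
    then show "induced_subgraph_copy {0..<n} F ?L ?E"
      unfolding induced_subgraph_copy_def using f(1) L by blast
  qed
  moreover have "card ?L = 12 * n" by (simp add: card_cartesian_product)
  ultimately show ?thesis using universal_nat_copy[OF fin, of ?E n 2] by (simp add: mult.commute)
qed

theorem theorem1:
  fixes \<Delta> :: nat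
  assumes "\<Delta> \<ge> 2"
  shows "\<exists>c::real. c > 0 \<and> (\<forall>n::nat. \<exists>(V::nat set) E.
           simple_graph V E \<and> real (card V) \<le> c * real n powr (real \<Delta> / 2)
           \<and> induced_universal_for V E n \<Delta>)"
proof (cases "\<Delta> = 2")
  case True
  have "\<exists>(V::nat set) E. simple_graph V E \<and> real (card V) \<le> 12 * real n powr (real \<Delta> / 2)
      \<and> induced_universal_for V E n \<Delta>" for n
  proof -
    from universal_graph_2[of n] obtain V :: "nat set" and E where
      "simple_graph V E" "card V = 12 * n" "induced_universal_for V E n 2"
      by blast
    then show ?thesis unfolding True by (intro exI[of _ V] exI[of _ E]) simp
  qed
  then show ?thesis by (intro exI[of _ 12]) simp
next
  case False
  then have "3 \<le> \<Delta>" using assms by simp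
  from universal_graph_ge3[OF this] obtain c :: real where c: "c > 0"
    and ge1: "\<And>n. 1 \<le> n \<Longrightarrow> \<exists>(V::nat set) E. simple_graph V E \<and>
      real (card V) \<le> c * real n powr (real \<Delta> / 2) \<and> induced_universal_for V E n \<Delta>"
    by blast
  have "\<exists>(V::nat set) E. simple_graph V E \<and> real (card V) \<le> c * real n powr (real \<Delta> / 2)
      \<and> induced_universal_for V E n \<Delta>" for n
  proof (cases "n = 0")
    case True
    \<comment> \<open>Since \<open>0 powr x\<close> is 0, the bound demands the empty graph here,
      which the graph of labels is not.\<close>
    show ?thesis by (intro exI[of _ "{}"] exI[of _ "\<lambda>_ _. False"])
        (simp add: True simple_graph_def induced_universal_for_def induced_subgraph_copy_def)
  next
    case False
    then show ?thesis using ge1 by simp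
  qed
  with c show ?thesis by blast
qed

end
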